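(* Let $X$ and $Y$ be Polish spaces, let $\mu\in\mathcal P(X)$ and $\nu\in\mathcal P(Y)$, and let $C:X\times Y\to\mathbb R$ be continuous, bounded from below, and in $L^1(\mu\otimes\nu)$. For $\varepsilon>0$ let $\pi_\varepsilon\in\Pi(\mu,\nu)$ denote the entropic minimiser, i.e. the unique minimiser over $\Pi(\mu,\nu)$ of $$F_\varepsilon(\pi)=\int_{X\times Y} C\,d\pi+\varepsilon\,\mathrm{KL}(\pi\|\mu\otimes\nu).$$ Then the weak cluster set of $(\pi_\varepsilon)_{\varepsilon>0}$ as $\varepsilon\downarrow0$ is a nonempty compact (in the weak topology) connected subset of the set of optimal plans for $C$, that is, of $$\mathrm{Opt}(\mu,\nu\mid C)=\arg\min_{\pi\in\Pi(\mu,\nu)}\int_{X\times Y} C\,d\pi .$$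
   Context: For a Polish space $S$, $\mathcal P(S)$ is the set of Borel probability measures on $S$. $\Pi(\mu,\nu)\subset\mathcal P(X\times Y)$ is the set of couplings, i.e. probability measures with first marginal $\mu$ and second marginal $\nu$. For probability measures $P,M$, $\mathrm{KL}(P\|M)=\int\log(dP/dM)\,dP$ if $P\ll M$ and $+\infty$ otherwise. Under the stated hypotheses $F_\varepsilon:\Pi(\mu,\nu)\to(-\infty,+\infty]$ has a unique minimiser for every $\varepsilon>0$. The weak cluster set as $\varepsilon\downarrow0$ is the set of all $\pi\in\Pi(\mu,\nu)$ for which there is a sequence $\varepsilon_k\downarrow0$ of positive numbers such that $\pi_{\varepsilon_k}$ converges weakly to $\pi$. *)

theory Defs
  imports "HOL-Probability.Probability"
begin

text \<open>As a set, \<^term>\<open>space (prob_algebra borel)\<close> consists of all Borel probability measures.\<close>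

abbreviation borel_probs :: "'a::topological_space measure set" where
  "borel_probs \<equiv> space (prob_algebra borel)"

text \<open>The initial topology on the Borel probability measures for the maps
  \<open>M \<mapsto> \<integral>f dM\<close>, where \<open>f\<close> is bounded and continuous.\<close>

definition weak_topology :: "'a::topological_space measure topology" where
  "weak_topology = topology_generated_by
     {{M \<in> borel_probs. (\<integral>x. f x \<partial>M) \<in> U} | f U. f \<in> bcontfun \<and> open (U :: real set)}"

lemma topspace_weak_topology [simp]: "topspace weak_topology = borel_probs"
proof -
  have "(\<lambda>_. 0 :: real) \<in> bcontfun"
    by (auto simp: bcontfun_def)
  then have "borel_probs \<in> {{M \<in> borel_probs. (\<integral>x. f x \<partial>M) \<in> U} | f U. f \<in> bcontfun \<and> open (U :: real set)}"
    by (intro CollectI exI[of _ "\<lambda>_. 0"] exI[of _ UNIV]) auto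
  then show ?thesis
    unfolding weak_topology_def topology_generated_by_topspace by blast
qed

lemma limitin_weak_topology:
  "limitin weak_topology P M F \<longleftrightarrow>
     M \<in> borel_probs \<and> (\<forall>\<^sub>F k in F. P k \<in> borel_probs) \<and>
     (\<forall>f \<in> bcontfun. ((\<lambda>k. \<integral>x. f x \<partial>P k) \<longlongrightarrow> (\<integral>x. f x \<partial>M :: real)) F)"
  (is "?L \<longleftrightarrow> ?R")
proof
  assume L: ?L
  then have M: "M \<in> borel_probs"
    by (auto simp: limitin_def)
  moreover have "\<forall>\<^sub>F k in F. P k \<in> borel_probs"
    using L M openin_topspace[of weak_topology] by (auto simp: limitin_def)
  moreover have "((\<lambda>k. \<integral>x. f x \<partial>P k) \<longlongrightarrow> (\<integral>x. f x \<partial>M :: real)) F" if f: "f \<in> bcontfun" for f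
  proof (rule topological_tendstoI)
    fix U :: "real set" assume U: "open U" "(\<integral>x. f x \<partial>M) \<in> U"
    have "openin weak_topology {M \<in> borel_probs. (\<integral>x. f x \<partial>M) \<in> U}"
      unfolding weak_topology_def using f U by (intro topology_generated_by_Basis) auto
    with L M U have "\<forall>\<^sub>F k in F. P k \<in> {M \<in> borel_probs. (\<integral>x. f x \<partial>M) \<in> U}"
      unfolding limitin_def by blast
    then show "\<forall>\<^sub>F k in F. (\<integral>x. f x \<partial>P k) \<in> U"
      by (rule eventually_mono) auto
  qed
  ultimately show ?R by blast
next
  assume R: ?R
  have "\<forall>\<^sub>F k in F. P k \<in> V" if "openin weak_topology V" "M \<in> V" for V
  proof -
    have "generate_topology_on {{M \<in> borel_probs. (\<integral>x. f x \<partial>M) \<in> U} | f U. f \<in> bcontfun \<and> open (U :: real set)} V"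
      using that(1) by (simp add: weak_topology_def openin_topology_generated_by_iff)
    then show ?thesis using that(2)
    proof (induction rule: generate_topology_on.induct)
      case (Int a b)
      then show ?case by (auto intro: eventually_conj)
    next
      case (UN K)
      then obtain k where "k \<in> K" "M \<in> k" by blast
      with UN.IH have "\<forall>\<^sub>F i in F. P i \<in> k" by blast
      then show ?case
        by (rule eventually_mono) (use \<open>k \<in> K\<close> in blast)
    next
      case (Basis s)
      then obtain f U where s: "s = {M \<in> borel_probs. (\<integral>x. f x \<partial>M) \<in> U}" "f \<in> bcontfun" "open (U :: real set)"
        by blast
      with Basis have "(\<integral>x. f x \<partial>M) \<in> U" by simp
      moreover have "((\<lambda>k. \<integral>x. f x \<partial>P k) \<longlongrightarrow> (\<integral>x. f x \<partial>M)) F"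
        using R s(2) by simp
      ultimately have "\<forall>\<^sub>F k in F. (\<integral>x. f x \<partial>P k) \<in> U"
        using s(3) by (metis topological_tendstoD)
      moreover have "\<forall>\<^sub>F k in F. P k \<in> borel_probs" using R by blast
      ultimately show ?case unfolding s by eventually_elim auto
    qed auto
  qed
  with R show ?L by (simp add: limitin_def)
qed

text \<open>The integral with values in the extended reals, for measurable \<open>f\<close> whose negative part is
  integrable. The Bochner integral would be \<open>0\<close>, not \<open>\<infinity>\<close>, if the positive part is not.\<close>

definition eintegral :: "'a measure \<Rightarrow> ('a \<Rightarrow> real) \<Rightarrow> ereal" where
  "eintegral M f = enn2ereal (\<integral>\<^sup>+x. ennreal (f x) \<partial>M) - enn2ereal (\<integral>\<^sup>+x. ennreal (- f x) \<partial>M)"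

lemma eintegral_eq_integral:
  assumes "integrable M f"
  shows "eintegral M f = ereal (\<integral>x. f x \<partial>M)"
proof -
  have "(\<integral>\<^sup>+x. ennreal (f x) \<partial>M) < \<infinity>" "(\<integral>\<^sup>+x. ennreal (- f x) \<partial>M) < \<infinity>"
    using real_integrable_def[of M f] assms by (auto simp: less_top)
  then obtain a b where "(\<integral>\<^sup>+x. ennreal (f x) \<partial>M) = ennreal a" "0 \<le> a"
    "(\<integral>\<^sup>+x. ennreal (- f x) \<partial>M) = ennreal b" "0 \<le> b"
    by (metis ennreal_cases infinity_ennreal_def less_irrefl)
  then show ?thesis
    using real_lebesgue_integral_def[OF assms] by (simp add: eintegral_def)
qed

text \<open>The negative part of \<open>log (dP/dM)\<close> is always \<open>P\<close>-integrable for probability measures. Note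
  the order of the arguments: \<^term>\<open>KL_divergence b M P\<close> is the divergence of \<open>P\<close> from \<open>M\<close>.\<close>

definition KL :: "'a measure \<Rightarrow> 'a measure \<Rightarrow> ereal" where
  "KL P M = (if absolutely_continuous M P
             then eintegral P (\<lambda>x. ln (enn2real (RN_deriv M P x))) else \<infinity>)"

lemma KL_eq_KL_divergence:
  assumes "absolutely_continuous M P" "integrable P (entropy_density (exp 1) M P)"
  shows "KL P M = ereal (KL_divergence (exp 1) M P)"
  using assms
  by (simp add: KL_def KL_divergence_def entropy_density_def comp_def log_def eintegral_eq_integral)

definition couplings ::
  "'a::topological_space measure \<Rightarrow> 'b::topological_space measure \<Rightarrow> ('a \<times> 'b) measure set" where
  "couplings \<mu> \<nu> = {\<pi> \<in> borel_probs. distr \<pi> borel fst = \<mu> \<and> distr \<pi> borel snd = \<nu>}"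

definition opt_plans ::
  "'a::topological_space measure \<Rightarrow> 'b::topological_space measure \<Rightarrow> ('a \<times> 'b \<Rightarrow> real) \<Rightarrow>
     ('a \<times> 'b) measure set" where
  "opt_plans \<mu> \<nu> C = {\<pi>. is_arg_min (\<lambda>\<rho>. eintegral \<rho> C) (\<lambda>\<rho>. \<rho> \<in> couplings \<mu> \<nu>) \<pi>}"

definition entropic_cost ::
  "'a measure \<Rightarrow> 'b measure \<Rightarrow> ('a \<times> 'b \<Rightarrow> real) \<Rightarrow> real \<Rightarrow> ('a \<times> 'b) measure \<Rightarrow> ereal" where
  "entropic_cost \<mu> \<nu> C \<epsilon> \<pi> = eintegral \<pi> C + ereal \<epsilon> * KL \<pi> (\<mu> \<Otimes>\<^sub>M \<nu>)"

definition entropic_minimiser ::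
  "'a::topological_space measure \<Rightarrow> 'b::topological_space measure \<Rightarrow> ('a \<times> 'b \<Rightarrow> real) \<Rightarrow> real \<Rightarrow>
     ('a \<times> 'b) measure" where
  "entropic_minimiser \<mu> \<nu> C \<epsilon> =
     (THE \<pi>. is_arg_min (entropic_cost \<mu> \<nu> C \<epsilon>) (\<lambda>\<rho>. \<rho> \<in> couplings \<mu> \<nu>) \<pi>)"

definition weak_cluster_set ::
  "'a::topological_space measure \<Rightarrow> 'b::topological_space measure \<Rightarrow> (real \<Rightarrow> ('a \<times> 'b) measure) \<Rightarrow>
     ('a \<times> 'b) measure set" where
  "weak_cluster_set \<mu> \<nu> P = {\<pi> \<in> couplings \<mu> \<nu>. \<exists>\<epsilon> :: nat \<Rightarrow> real.
     (\<forall>k. \<epsilon> k > 0) \<and> decseq \<epsilon> \<and> \<epsilon> \<longlonglongrightarrow> 0 \<and> limitin weak_topology (\<lambda>k. P (\<epsilon> k)) \<pi> sequentially}"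

end

theory Submission
  imports Defs
begin

text \<open>
  Write \<open>R = \<mu> \<otimes> \<nu>\<close>. The minimisers \<open>\<pi>\<^sub>\<epsilon>\<close> form a continuous curve in the compact space of couplings,
  and the cluster set of such a curve at an end of its parameter interval is nonempty, compact and
  connected. That the cluster points are optimal is the statement that the entropic problems
  approximate the unregularised one.

  The compactness argument is carried out in a metric space of real sequences. There is a countable
  family of Lipschitz functions whose integrals determine both a measure and the weak convergence of
  measures (\<open>limitin_weak_topology_iff_tent_integrals\<close>), so the weak topology is a subspace of a
  countable power of the reals. In these coordinates the couplings are a compact set
  (\<open>compact_tent_integrals_couplings\<close>), by a form of Prokhorov's theorem
  (\<open>tight_imp_weakly_convergent_subsequence\<close>): the masses of the cells of finer and finer partitions
  converge along a subsequence, and the limit measure is the image of Lebesgue measure on \<open>[0,1)\<close>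
  under a map that follows nested intervals whose lengths are the limiting masses. A continuous curve
  that had a disconnected cluster set would have to cross, at arbitrarily small parameters, the zero
  set of a function that separates the two pieces, and would therefore cluster there as well
  (\<open>cluster_set_of_curve\<close>).

  Existence, uniqueness and continuity of \<open>\<pi>\<^sub>\<epsilon>\<close> all come from one strict convexity estimate for
  \<open>t \<mapsto> t log t\<close> (\<open>ent_strong_convexity\<close>). Integrated, it bounds the \<open>L\<^sup>1\<close> distance of two densities by
  the amount by which they fail to be minimal (\<open>energy_strong_convexity\<close>). Minimising sequences are
  thus Cauchy in \<open>L\<^sup>1(R)\<close>, Fatou's lemma makes the limit a minimiser, two minimisers coincide, and the
  minimisers for nearby \<open>\<epsilon>\<close> are close in \<open>L\<^sup>1(R)\<close>, hence weakly.

  For optimality, every coupling \<open>\<rho>\<close> of finite cost has to be approximated in cost by a coupling of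
  finite entropy (\<open>bounded_coupling_density_near\<close>). Where the cost oscillates little, \<open>\<rho>\<close> is replaced by
  products of its own marginals. A small part of \<open>\<rho>\<close> is left over, on which \<open>C\<close> may be large; it is
  mixed with a small multiple of \<open>R\<close> before it is replaced by a product, and the integrability of
  \<open>C\<close> under \<open>R\<close> controls its cost. Comparing \<open>\<pi>\<^sub>\<epsilon>\<close> with this competitor as \<open>\<epsilon> \<rightarrow> 0\<close>, together with the weak lower
  semicontinuity of the cost, shows that cluster points are optimal.
\<close>

section \<open>Cluster sets of continuous curves\<close>

text \<open>The sequential description used for weak cluster points and the neighbourhood description agree in
  a metric space; the latter is the convenient one for closedness and connectedness.\<close>

lemma curve_cluster_point_iff:
  fixes \<gamma> :: "real \<Rightarrow> 'e::metric_space"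
  shows "(\<exists>\<epsilon> :: nat \<Rightarrow> real. (\<forall>k. \<epsilon> k > 0) \<and> decseq \<epsilon> \<and> \<epsilon> \<longlonglongrightarrow> 0 \<and> (\<lambda>k. \<gamma> (\<epsilon> k)) \<longlonglongrightarrow> y) \<longleftrightarrow>
         (\<forall>d>0. \<exists>\<epsilon>. 0 < \<epsilon> \<and> \<epsilon> < d \<and> dist (\<gamma> \<epsilon>) y < d)"
  (is "?L \<longleftrightarrow> ?R")
proof
  assume ?L
  then obtain \<epsilon> where \<epsilon>: "\<forall>k. \<epsilon> k > 0" "\<epsilon> \<longlonglongrightarrow> 0" "(\<lambda>k. \<gamma> (\<epsilon> k)) \<longlonglongrightarrow> y" by blast
  show ?R
  proof (intro allI impI)
    fix d :: real assume "d > 0"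
    with \<epsilon>(2,3) have "\<forall>\<^sub>F k in sequentially. \<epsilon> k < d \<and> dist (\<gamma> (\<epsilon> k)) y < d"
      by (intro eventually_conj order_tendstoD(2)[OF \<epsilon>(2)] tendstoD)
    then show "\<exists>\<epsilon>. 0 < \<epsilon> \<and> \<epsilon> < d \<and> dist (\<gamma> \<epsilon>) y < d"
      using \<epsilon>(1) unfolding eventually_sequentially by blast
  qed
next
  assume R: ?R
  have "\<exists>\<epsilon>. \<forall>k. (0 < \<epsilon> k \<and> \<epsilon> k < 1 / Suc k \<and> dist (\<gamma> (\<epsilon> k)) y < 1 / Suc k) \<and> \<epsilon> (Suc k) \<le> \<epsilon> k"
  proof (rule dependent_nat_choice)
    show "\<exists>x>0. x < 1 / real (Suc 0) \<and> dist (\<gamma> x) y < 1 / real (Suc 0)"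
      using R[rule_format, of 1] by auto
  next
    fix x n assume x: "0 < x \<and> x < 1 / real (Suc n) \<and> dist (\<gamma> x) y < 1 / real (Suc n)"
    obtain z where "0 < z" "z < min x (1 / real (Suc (Suc n)))" "dist (\<gamma> z) y < min x (1 / real (Suc (Suc n)))"
      using R[rule_format, of "min x (1 / real (Suc (Suc n)))"] x by auto
    then show "\<exists>z. (0 < z \<and> z < 1 / real (Suc (Suc n)) \<and> dist (\<gamma> z) y < 1 / real (Suc (Suc n))) \<and> z \<le> x"
      by (intro exI[of _ z]) auto
  qed
  then obtain \<epsilon> where \<epsilon>: "\<And>k. 0 < \<epsilon> k" "\<And>k. \<epsilon> k < 1 / Suc k" "\<And>k. dist (\<gamma> (\<epsilon> k)) y < 1 / Suc k"
      "\<And>k. \<epsilon> (Suc k) \<le> \<epsilon> k" by blast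
  have lim: "(\<lambda>k. 1 / real (Suc k)) \<longlonglongrightarrow> 0" using LIMSEQ_inverse_real_of_nat by (simp add: inverse_eq_divide)
  have "\<epsilon> \<longlonglongrightarrow> 0"
    by (rule tendsto_sandwich[OF _ _ tendsto_const lim]) (auto intro!: always_eventually less_imp_le[OF \<epsilon>(1)] less_imp_le[OF \<epsilon>(2)] simp del: of_nat_Suc)
  moreover have "(\<lambda>k. dist (\<gamma> (\<epsilon> k)) y) \<longlonglongrightarrow> 0"
    by (rule tendsto_sandwich[OF _ _ tendsto_const lim]) (auto intro!: always_eventually less_imp_le[OF \<epsilon>(1)] less_imp_le[OF \<epsilon>(3)] simp del: of_nat_Suc)
  then have "(\<lambda>k. \<gamma> (\<epsilon> k)) \<longlonglongrightarrow> y" by (rule tendsto_dist_iff[THEN iffD2])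
  ultimately show ?L using \<epsilon> by (auto simp: decseq_Suc_iff)
qed

text \<open>Compactness of \<open>\<Gamma>\<close> gives a cluster point along every sequence of parameters that tends to \<open>0\<close>. If
  the cluster set were the union of two disjoint closed sets \<open>A\<close> and \<open>B\<close>, the difference of the
  distances to \<open>A\<close> and to \<open>B\<close> would take both signs along the curve near \<open>0\<close>, hence vanish there by
  the intermediate value theorem; the zeros accumulate at a cluster point outside \<open>A \<union> B\<close>.\<close>

lemma cluster_set_of_curve:
  fixes \<gamma> :: "real \<Rightarrow> 'e::metric_space"
  assumes \<Gamma>: "compact \<Gamma>" "\<And>\<epsilon>. \<epsilon> > 0 \<Longrightarrow> \<gamma> \<epsilon> \<in> \<Gamma>" and cont: "continuous_on {0<..} \<gamma>"
  defines "L \<equiv> {y. \<exists>\<epsilon> :: nat \<Rightarrow> real. (\<forall>k. \<epsilon> k > 0) \<and> decseq \<epsilon> \<and> \<epsilon> \<longlonglongrightarrow> 0 \<and> (\<lambda>k. \<gamma> (\<epsilon> k)) \<longlonglongrightarrow> y}"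
  shows "L \<noteq> {}" "compact L" "connected L" "L \<subseteq> \<Gamma>"
proof -
  have L: "L = {y. \<forall>d>0. \<exists>\<epsilon>. 0 < \<epsilon> \<and> \<epsilon> < d \<and> dist (\<gamma> \<epsilon>) y < d}"
    unfolding L_def curve_cluster_point_iff ..
  have ex: "\<exists>y\<in>L. \<exists>r. strict_mono r \<and> (\<lambda>k. \<gamma> (\<epsilon> (r k))) \<longlonglongrightarrow> y"
    if \<epsilon>: "\<And>k. 0 < \<epsilon> k" "\<And>k. \<epsilon> k < 1 / Suc k" for \<epsilon> :: "nat \<Rightarrow> real"
  proof -
    obtain y r where r: "strict_mono r" "((\<lambda>k. \<gamma> (\<epsilon> k)) \<circ> r) \<longlonglongrightarrow> y"
      using seq_compactE[OF compact_imp_seq_compact[OF \<Gamma>(1)], of "\<lambda>k. \<gamma> (\<epsilon> k)"] \<Gamma>(2)[OF \<epsilon>(1)]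
      by blast
    have lim: "(\<lambda>k. 1 / real (Suc k)) \<longlonglongrightarrow> 0" using LIMSEQ_inverse_real_of_nat by (simp add: inverse_eq_divide)
    have "\<epsilon> \<longlonglongrightarrow> 0"
      by (rule tendsto_sandwich[OF _ _ tendsto_const lim]) (auto intro!: always_eventually less_imp_le[OF \<epsilon>(1)] less_imp_le[OF \<epsilon>(2)] simp del: of_nat_Suc)
    with r have "(\<epsilon> \<circ> r) \<longlonglongrightarrow> 0" by (simp add: LIMSEQ_subseq_LIMSEQ)
    then have "\<forall>\<^sub>F k in sequentially. (\<epsilon> \<circ> r) k < d \<and> dist (((\<lambda>k. \<gamma> (\<epsilon> k)) \<circ> r) k) y < d" if "d > 0" for d
      using order_tendstoD(2) tendstoD[OF r(2)] that by (intro eventually_conj) blast+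
    then have "\<exists>k. (\<epsilon> \<circ> r) k < d \<and> dist (((\<lambda>k. \<gamma> (\<epsilon> k)) \<circ> r) k) y < d" if "d > 0" for d
      using that unfolding eventually_sequentially by blast
    then have "y \<in> L" unfolding L using \<epsilon>(1) by (auto simp: comp_def)
    with r show ?thesis by (auto simp: comp_def)
  qed
  have "\<exists>y\<in>L. \<exists>r. strict_mono r \<and> (\<lambda>k. \<gamma> (1 / (real (r k) + 2))) \<longlonglongrightarrow> y"
    by (rule ex) (simp_all add: field_simps)
  then show "L \<noteq> {}" by blast
  show "L \<subseteq> \<Gamma>"
  proof
    fix y assume "y \<in> L"
    then have "\<exists>x\<in>\<Gamma>. dist x y < e" if "e > 0" for e
      using that \<Gamma>(2) unfolding L by simp metis
    then have "y \<in> closure \<Gamma>" unfolding closure_approachable by simp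
    then show "y \<in> \<Gamma>" using compact_imp_closed[OF \<Gamma>(1)] by simp
  qed
  have "closed L"
    unfolding closed_limpt islimpt_approachable
  proof (intro allI impI)
    fix y assume y: "\<forall>e>0. \<exists>x'\<in>L. x' \<noteq> y \<and> dist x' y < e"
    show "y \<in> L" unfolding L
    proof (intro CollectI allI impI)
      fix d :: real assume d: "d > 0"
      then obtain x where x: "x \<in> L" "dist x y < d/2" using y[rule_format, of "d/2"] by auto
      then obtain \<epsilon> where "0 < \<epsilon>" "\<epsilon> < d/2" "dist (\<gamma> \<epsilon>) x < d/2" using x(1)[unfolded L, simplified, rule_format, of "d/2"] d by auto
      with x d show "\<exists>\<epsilon>. 0 < \<epsilon> \<and> \<epsilon> < d \<and> dist (\<gamma> \<epsilon>) y < d"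
        using dist_triangle[of "\<gamma> \<epsilon>" y x] by (intro exI[of _ \<epsilon>]) auto
    qed
  qed
  from closed_Int_compact[OF this \<Gamma>(1)] \<open>L \<subseteq> \<Gamma>\<close> show "compact L"
    by (simp add: inf.absorb1)
  show "connected L"
  proof (rule ccontr)
    assume "\<not> connected L"
    then obtain A0 B0 where AB0: "closed A0" "closed B0" "L \<subseteq> A0 \<union> B0" "A0 \<inter> B0 \<inter> L = {}" "A0 \<inter> L \<noteq> {}" "B0 \<inter> L \<noteq> {}"
      unfolding connected_closed by blast
    define A B where "A = A0 \<inter> L" and "B = B0 \<inter> L"
    have AB: "closed A" "closed B" "L = A \<union> B" "A \<inter> B = {}" "A \<noteq> {}" "B \<noteq> {}"
      using AB0 \<open>closed L\<close> by (auto simp: A_def B_def)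
    define h where "h y = infdist y A - infdist y B" for y
    have conth: "continuous_on UNIV h" unfolding h_def by (intro continuous_intros)
    have hA: "h y < 0" if "y \<in> A" for y
      using that AB infdist_pos_not_in_closed[of B y] by (auto simp: h_def)
    have hB: "h y > 0" if "y \<in> B" for y
      using that AB infdist_pos_not_in_closed[of A y] by (auto simp: h_def)
    have near: "\<exists>\<epsilon>. 0 < \<epsilon> \<and> \<epsilon> < d \<and> \<bar>h (\<gamma> \<epsilon>) - h y\<bar> < e" if "y \<in> L" "d > 0" "e > 0" for y d e
    proof -
      have "continuous (at y) h" using conth by (simp add: continuous_on_eq_continuous_at)
      then obtain s where s: "s > 0" "\<And>z. dist z y < s \<Longrightarrow> dist (h z) (h y) < e"
        using \<open>e > 0\<close> unfolding continuous_at_eps_delta by blast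
      obtain \<epsilon> where "0 < \<epsilon>" "\<epsilon> < min s d" "dist (\<gamma> \<epsilon>) y < min s d"
        using \<open>y \<in> L\<close>[unfolded L, simplified, rule_format, of "min s d"] s(1) \<open>d > 0\<close> by auto
      then show ?thesis using s by (intro exI[of _ \<epsilon>]) (auto simp: dist_real_def)
    qed
    have "\<exists>\<epsilon>. 0 < \<epsilon> \<and> \<epsilon> < d \<and> h (\<gamma> \<epsilon>) = 0" if d: "d > 0" for d
    proof -
      obtain a b where "a \<in> A" "b \<in> B" using AB by blast
      obtain s where s: "0 < s" "s < d" "h (\<gamma> s) < 0"
      proof -
        have "a \<in> L" "h a < 0" using hA[OF \<open>a \<in> A\<close>] \<open>a \<in> A\<close> AB(3) by auto
        with near[of a d "- h a"] d that show ?thesis by auto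
      qed
      obtain t where t: "0 < t" "t < d" "h (\<gamma> t) > 0"
      proof -
        have "b \<in> L" "h b > 0" using hB[OF \<open>b \<in> B\<close>] \<open>b \<in> B\<close> AB(3) by auto
        with near[of b d "h b"] d that show ?thesis by auto
      qed
      have "continuous_on {0<..<d} (\<lambda>x. h (\<gamma> x))"
        by (rule continuous_on_compose2[OF conth continuous_on_subset[OF cont]]) auto
      then have "connected ((\<lambda>x. h (\<gamma> x)) ` {0<..<d})"
        by (rule connected_continuous_image) simp
      from connected_contains_Icc[OF this imageI imageI, of s t] s t
      have "{h (\<gamma> s)..h (\<gamma> t)} \<subseteq> (\<lambda>x. h (\<gamma> x)) ` {0<..<d}" by simp
      moreover have "0 \<in> {h (\<gamma> s)..h (\<gamma> t)}" using s t by simp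
      ultimately have "0 \<in> (\<lambda>x. h (\<gamma> x)) ` {0<..<d}" by blast
      then show ?thesis by auto
    qed
    then have "\<exists>\<epsilon>. \<forall>k. 0 < \<epsilon> k \<and> \<epsilon> k < 1 / Suc k \<and> h (\<gamma> (\<epsilon> k)) = 0"
      by (intro choice allI) simp
    then obtain \<epsilon> where \<epsilon>: "\<And>k. 0 < \<epsilon> k" "\<And>k. \<epsilon> k < 1 / Suc k" "\<And>k. h (\<gamma> (\<epsilon> k)) = 0"
      by blast
    then obtain y r where y: "y \<in> L" "(\<lambda>k. \<gamma> (\<epsilon> (r k))) \<longlonglongrightarrow> y" using ex[of \<epsilon>] by blast
    have "(\<lambda>k. h (\<gamma> (\<epsilon> (r k)))) \<longlonglongrightarrow> h y"
      by (rule continuous_on_tendsto_compose[OF conth y(2)]) auto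
    then have "h y = 0" by (simp add: \<epsilon> LIMSEQ_const_iff)
    moreover have "y \<in> A \<or> y \<in> B" using y(1) AB(3) by blast
    ultimately show False using hA[of y] hB[of y] by auto
  qed
qed

section \<open>A countable family of functions that determines weak convergence\<close>

lemma borel_probs_iff: "M \<in> borel_probs \<longleftrightarrow> sets M = sets borel \<and> prob_space M"
  by (simp add: space_prob_algebra)

lemma borel_probs_sets [measurable_cong]: "M \<in> borel_probs \<Longrightarrow> sets M = sets borel"
  and borel_probs_space: "M \<in> borel_probs \<Longrightarrow> space M = UNIV"
  and borel_probs_prob: "M \<in> borel_probs \<Longrightarrow> prob_space M"
  by (auto simp: borel_probs_iff dest: sets_eq_imp_space_eq)

lemma borel_probs_integrable:
  fixes f :: "'a::topological_space \<Rightarrow> real"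
  assumes "M \<in> borel_probs" "f \<in> borel_measurable borel" "\<And>x. \<bar>f x\<bar> \<le> B"
  shows "integrable M f"
proof -
  interpret prob_space M by (rule borel_probs_prob) fact
  show ?thesis
    by (rule integrable_const_bound[of _ B])
       (use assms in \<open>auto simp: measurable_cong_sets[OF borel_probs_sets[OF assms(1)] refl]\<close>)
qed

lemma borel_probs_integrable_bcontfun:
  fixes f :: "'a::topological_space \<Rightarrow> real"
  assumes "M \<in> borel_probs" "f \<in> bcontfun"
  shows "integrable M f"
proof -
  from assms(2) obtain B where "\<And>x. norm (f x) \<le> B" and "continuous_on UNIV f"
    by (auto simp: bcontfun_def bounded_iff)
  then show ?thesis
    by (intro borel_probs_integrable[OF assms(1), of _ B] borel_measurable_continuous_onI) auto
qed

text \<open>A fixed dense sequence of the space. It supplies the centres of the functions below and of the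
  partitions that are used for tightness.\<close>

definition dense_seq :: "nat \<Rightarrow> 'a::polish_space" where
  "dense_seq = (SOME d. \<forall>x. \<forall>e>0. \<exists>j. dist x (d j) < e)"

lemma dense_seq: "e > 0 \<Longrightarrow> \<exists>j. dist (x::'a::polish_space) (dense_seq j) < e"
proof -
  obtain D :: "'a set" where D: "countable D" "\<And>X. open X \<Longrightarrow> X \<noteq> {} \<Longrightarrow> \<exists>d\<in>D. d \<in> X"
    using countable_dense_setE by blast
  then have ne: "D \<noteq> {}" by blast
  have "\<exists>j. dist x (from_nat_into D j) < e" if "e > 0" for x e
  proof -
    obtain d where "d \<in> D" "d \<in> ball x e" using D(2)[of "ball x e"] \<open>e > 0\<close> by auto
    then show ?thesis using from_nat_into_surj[OF D(1)] by (metis mem_ball)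
  qed
  then have "\<exists>d :: nat \<Rightarrow> 'a. \<forall>x. \<forall>e>0. \<exists>j. dist x (d j) < e" by blast
  from someI_ex[OF this] show "e > 0 \<Longrightarrow> \<exists>j. dist x (dense_seq j) < e"
    unfolding dense_seq_def by blast
qed

type_synonym tent_code = "nat \<times> rat \<times> nat"

text \<open>A cone of rational height and integral slope, centred at a point of the dense sequence. There are only
  countably many finite maxima of such functions, all of them are Lipschitz, and they approximate every
  nonnegative lower semicontinuous function from below.\<close>

fun tent :: "tent_code \<Rightarrow> 'a::polish_space \<Rightarrow> real" where
  "tent (j, q, m) x = max 0 (of_rat q - real m * dist x (dense_seq j))"

fun tents :: "tent_code list \<Rightarrow> 'a::polish_space \<Rightarrow> real" where
  "tents [] x = 0"
| "tents (t # ts) x = max (tent t x) (tents ts x)"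

lemma tents_nonneg: "0 \<le> tents ts x"
  by (induction ts) (auto simp: le_max_iff_disj)

lemma tents_le_iff: "0 \<le> a \<Longrightarrow> tents ts x \<le> a \<longleftrightarrow> (\<forall>t\<in>set ts. tent t x \<le> a)"
  by (induction ts) auto

lemma tent_le_tents: "t \<in> set ts \<Longrightarrow> tent t x \<le> tents ts x"
  using tents_le_iff[OF tents_nonneg] by blast

lemma tents_bounded: "\<exists>B. \<forall>x :: 'a::polish_space. tents ts x \<le> B"
proof (induction ts)
  case (Cons t ts)
  then obtain B where B: "\<And>x::'a. tents ts x \<le> B" by blast
  obtain j q m where t: "t = (j, q, m)" by (cases t)
  have "tents (t # ts) x \<le> max \<bar>of_rat q\<bar> B" for x :: 'a
  proof -
    have "0 \<le> real m * dist x (dense_seq j)" by simp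
    with B[of x] show ?thesis unfolding t tents.simps tent.simps by linarith
  qed
  then show ?case by blast
qed auto

lemma tents_lipschitz: "\<exists>K\<ge>0. \<forall>x y :: 'a::polish_space. \<bar>tents ts x - tents ts y\<bar> \<le> K * dist x y"
proof (induction ts)
  case (Cons t ts)
  then obtain K where K: "K \<ge> 0" "\<And>x y::'a. \<bar>tents ts x - tents ts y\<bar> \<le> K * dist x y" by blast
  obtain j q m where t: "t = (j, q, m)" by (cases t)
  have "\<bar>tents (t # ts) x - tents (t # ts) y\<bar> \<le> (K + real m) * dist x y" for x y :: 'a
  proof -
    have "\<bar>dist x (dense_seq j) - dist y (dense_seq j)\<bar> \<le> dist x y"
      using dist_triangle[of x "dense_seq j" y] dist_triangle[of y "dense_seq j" x] by (simp add: dist_commute)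
    then have "real m * \<bar>dist x (dense_seq j) - dist y (dense_seq j)\<bar> \<le> real m * dist x y"
      by (rule mult_left_mono) simp
    then have 1: "\<bar>real m * dist x (dense_seq j) - real m * dist y (dense_seq j)\<bar> \<le> real m * dist x y"
      by (simp add: abs_mult flip: right_diff_distrib)
    have 2: "K * dist x y \<ge> 0" "real m * dist x y \<ge> 0" using K by auto
    show ?thesis unfolding t tents.simps tent.simps ring_distribs using 1 2 K(2)[of x y] by linarith
  qed
  then show ?case using K(1) by (intro exI[of _ "K + real m"]) auto
qed auto

lemma continuous_on_tents: "continuous_on UNIV (tents ts :: 'a::polish_space \<Rightarrow> real)"
proof -
  obtain K where "K \<ge> 0" "\<And>x y::'a. \<bar>tents ts x - tents ts y\<bar> \<le> K * dist x y" using tents_lipschitz by blast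
  then have "K-lipschitz_on UNIV (tents ts :: 'a \<Rightarrow> real)" by (intro lipschitz_onI) (auto simp: dist_real_def)
  then show ?thesis by (rule lipschitz_on_continuous_on)
qed

lemma tents_bcontfun: "(tents ts :: 'a::polish_space \<Rightarrow> real) \<in> bcontfun"
proof -
  obtain B where "\<And>x::'a. tents ts x \<le> B" using tents_bounded by blast
  then have "bounded (range (tents ts :: 'a \<Rightarrow> real))"
    unfolding bounded_iff by (intro exI[of _ B]) (auto simp: tents_nonneg)
  with continuous_on_tents show ?thesis by (simp add: bcontfun_def)
qed

text \<open>Enumerate all tents below \<open>f\<close> and take the maximum of the first \<open>n\<close>. At every point there are tents
  below \<open>f\<close> with values as close to \<open>f\<close> as desired: \<open>f\<close> exceeds a rational \<open>q\<close> on a ball, and a steep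
  cone of height \<open>q\<close> centred nearby fits into that ball.\<close>

lemma tents_approximate_lsc:
  fixes f :: "'a::polish_space \<Rightarrow> real"
  assumes f0: "\<And>x. 0 \<le> f x" and lsc: "\<And>x a. a < f x \<Longrightarrow> \<exists>r>0. \<forall>y. dist x y < r \<longrightarrow> a < f y"
  obtains T where "\<And>n x. tents (T n) x \<le> f x" "\<And>x. (\<lambda>n. tents (T n) x) \<longlonglongrightarrow> f x"
proof -
  define S where "S = {t. \<forall>x. tent t x \<le> f x}"
  have "(0, 0, 0) \<in> S" by (auto simp: S_def f0)
  then have S: "S \<noteq> {}" "countable S" by (auto intro: countableI_type)
  define T where "T n = map (from_nat_into S) [0..<n]" for n
  have le: "tents (T n) x \<le> f x" for n x
    using from_nat_into[OF S(1)] by (auto simp: tents_le_iff[OF f0] T_def S_def)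
  have above: "\<exists>t\<in>S. a < tent t x" if "a < f x" for a x
  proof (cases "a < 0")
    case True
    then show ?thesis using \<open>(0,0,0) \<in> S\<close> by (intro bexI[of _ "(0,0,0)"]) auto
  next
    case False
    obtain q where q: "a < of_rat q" "of_rat q < f x" using of_rat_dense[OF \<open>a < f x\<close>] by blast
    obtain r where r: "r > 0" "\<And>y. dist x y < r \<Longrightarrow> of_rat q < f y" using lsc[OF q(2)] by blast
    obtain m :: nat where m: "of_rat q / (r/2) < real m" using reals_Archimedean2 by blast
    have qpos: "(of_rat q :: real) > 0" using q False by linarith
    have "0 < of_rat q / (r/2)" using qpos r(1) by simp
    with m have m0: "real m > 0" by linarith
    obtain j where j: "dist x (dense_seq j) < min (r/2) ((of_rat q - a) / real m)"
      using dense_seq[of "min (r/2) ((of_rat q - a) / real m)" x] r(1) q(1) m0 by auto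
    have "tent (j, q, m) y \<le> f y" for y
    proof (cases "dist x y < r")
      case True
      with r(2)[OF True] f0[of y] show ?thesis by (auto intro: order_trans[of _ "of_rat q"] less_imp_le)
    next
      case False
      then have "r/2 \<le> dist y (dense_seq j)"
        using j dist_triangle[of x y "dense_seq j"] by (simp add: dist_commute)
      then have "real m * (r/2) \<le> real m * dist y (dense_seq j)" by (rule mult_left_mono) simp
      moreover have "of_rat q < real m * (r/2)" using m r(1) by (simp add: divide_less_eq)
      ultimately show ?thesis using f0[of y] by simp
    qed
    then have "(j, q, m) \<in> S" by (auto simp: S_def)
    moreover have "real m * dist x (dense_seq j) < of_rat q - a"
      using j m0 by (simp add: pos_less_divide_eq mult.commute)
    then have "a < tent (j, q, m) x" by auto
    ultimately show ?thesis by blast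
  qed
  have lim: "(\<lambda>n. tents (T n) x) \<longlonglongrightarrow> f x" for x
  proof (rule order_tendstoI)
    fix a assume "a < f x"
    with above obtain t where t: "t \<in> S" "a < tent t x" by blast
    then obtain k where k: "from_nat_into S k = t" using from_nat_into_surj[OF S(2)] by blast
    have "a < tents (T n) x" if "n > k" for n
      using t k that by (intro less_le_trans[OF t(2) tent_le_tents]) (auto simp: T_def)
    then show "\<forall>\<^sub>F n in sequentially. a < tents (T n) x"
      by (rule eventually_mono[OF eventually_gt_at_top[of k]])
  next
    fix a assume "f x < a"
    with le show "\<forall>\<^sub>F n in sequentially. tents (T n) x < a" by (intro always_eventually allI) (rule le_less_trans)
  qed
  from that[OF le lim] show thesis .
qed

lemma tents_below_lsc_integral:
  fixes f :: "'a::polish_space \<Rightarrow> real"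
  assumes M: "M \<in> borel_probs" and f: "\<And>x. 0 \<le> f x" "\<And>x. f x \<le> B" "f \<in> borel_measurable borel"
    and lsc: "\<And>x a. a < f x \<Longrightarrow> \<exists>r>0. \<forall>y. dist x y < r \<longrightarrow> a < f y"
    and a: "a < (\<integral>x. f x \<partial>M)"
  obtains ts where "\<And>x. tents ts x \<le> f x" "a < (\<integral>x. tents ts x \<partial>M)"
proof -
  obtain T where T: "\<And>n x. tents (T n) x \<le> f x" "\<And>x. (\<lambda>n. tents (T n) x) \<longlonglongrightarrow> f x"
    using tents_approximate_lsc[OF f(1) lsc] by metis
  have "(\<lambda>n. \<integral>x. tents (T n) x \<partial>M) \<longlonglongrightarrow> (\<integral>x. f x \<partial>M)"
  proof (rule integral_dominated_convergence)
    show "integrable M f" by (rule borel_probs_integrable[OF M f(3), of B]) (simp add: f)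
    show "f \<in> borel_measurable M" "tents (T n) \<in> borel_measurable M" for n
      unfolding measurable_cong_sets[OF borel_probs_sets[OF M] refl]
      by (auto intro: f(3) borel_measurable_continuous_onI continuous_on_tents)
  qed (auto simp: T tents_nonneg)
  then have "\<forall>\<^sub>F n in sequentially. a < (\<integral>x. tents (T n) x \<partial>M)" using a by (rule order_tendstoD)
  then obtain n where "a < (\<integral>x. tents (T n) x \<partial>M)" unfolding eventually_sequentially by blast
  with T(1) show thesis by (intro that[of "T n"])
qed

lemma continuous_lsc:
  fixes f :: "'a::metric_space \<Rightarrow> real"
  assumes "continuous_on UNIV f" "a < f x"
  shows "\<exists>r>0. \<forall>y. dist x y < r \<longrightarrow> a < f y"
proof -
  have "open (f -` {a<..})" using assms(1) by (simp add: open_vimage)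
  then have "\<exists>r>0. ball x r \<subseteq> f -` {a<..}" using assms(2) open_contains_ball by blast
  then show ?thesis by (auto simp: subset_iff)
qed

text \<open>Integrals of tents below \<open>f\<close> give the lower bound for the limit inferior of \<open>\<integral>f\<close>, for nonnegative
  bounded continuous \<open>f\<close>. Applied to \<open>B + f\<close> and to \<open>B - f\<close>, where \<open>B\<close> bounds \<open>|f|\<close>, this gives
  both halves of the convergence.\<close>

lemma tendsto_integral_of_tents:
  fixes f :: "'a::polish_space \<Rightarrow> real"
  assumes P: "\<forall>\<^sub>F i in F. P i \<in> borel_probs" and M: "M \<in> borel_probs"
    and lim: "\<And>ts. ((\<lambda>i. \<integral>x. tents ts x \<partial>P i) \<longlongrightarrow> (\<integral>x. tents ts x \<partial>M)) F"
    and f: "f \<in> bcontfun"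
  shows "((\<lambda>i. \<integral>x. f x \<partial>P i) \<longlongrightarrow> (\<integral>x. f x \<partial>M)) F"
proof -
  have lower: "\<forall>\<^sub>F i in F. a < (\<integral>x. g x \<partial>P i)"
    if g: "g \<in> bcontfun" "\<And>x. 0 \<le> g x" and a: "a < (\<integral>x. g x \<partial>M)" for a and g :: "'a \<Rightarrow> real"
  proof -
    from g obtain B where B: "\<And>x. norm (g x) \<le> B" and c: "continuous_on UNIV g"
      by (auto simp: bcontfun_def bounded_iff)
    have "g x \<le> B" for x using B[of x] by simp
    then obtain ts where ts: "\<And>x. tents ts x \<le> g x" "a < (\<integral>x. tents ts x \<partial>M)"
      using tents_below_lsc_integral[OF M g(2) _ borel_measurable_continuous_onI[OF c] continuous_lsc[OF c] a]
      by metis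
    from order_tendstoD(1)[OF lim ts(2)] P show ?thesis
    proof eventually_elim
      case (elim i)
      have "(\<integral>x. tents ts x \<partial>P i) \<le> (\<integral>x. g x \<partial>P i)"
        using elim g ts by (intro integral_mono borel_probs_integrable_bcontfun tents_bcontfun) auto
      with elim show ?case by linarith
    qed
  qed
  from f obtain B where B: "\<And>x. norm (f x) \<le> B" and c: "continuous_on UNIV f"
    by (auto simp: bcontfun_def bounded_iff)
  have B': "\<bar>f x\<bar> \<le> B" for x using B[of x] by simp
  have b: "(\<lambda>x. B + f x) \<in> bcontfun" "(\<lambda>x. B - f x) \<in> bcontfun"
    using f c by (auto simp: bcontfun_def intro!: continuous_intros bounded_plus_comp bounded_minus_comp)
  have shift: "(\<integral>x. B + f x \<partial>N) = B + (\<integral>x. f x \<partial>N)" "(\<integral>x. B - f x \<partial>N) = B - (\<integral>x. f x \<partial>N)"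
    if N: "N \<in> borel_probs" for N
  proof -
    interpret prob_space N by (rule borel_probs_prob) fact
    have "integrable N f" by (rule borel_probs_integrable_bcontfun[OF N f])
    then show "(\<integral>x. B + f x \<partial>N) = B + (\<integral>x. f x \<partial>N)" "(\<integral>x. B - f x \<partial>N) = B - (\<integral>x. f x \<partial>N)"
      by (simp_all add: prob_space)
  qed
  show ?thesis
  proof (rule order_tendstoI)
    fix a assume "a < (\<integral>x. f x \<partial>M)"
    moreover have "0 \<le> B + f x" for x using B'[of x] by linarith
    ultimately have "\<forall>\<^sub>F i in F. B + a < (\<integral>x. B + f x \<partial>P i)"
      by (intro lower b) (auto simp: shift[OF M])
    with P show "\<forall>\<^sub>F i in F. a < (\<integral>x. f x \<partial>P i)"
      by eventually_elim (simp add: shift)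
  next
    fix a assume "(\<integral>x. f x \<partial>M) < a"
    moreover have "0 \<le> B - f x" for x using B'[of x] by linarith
    ultimately have "\<forall>\<^sub>F i in F. B - a < (\<integral>x. B - f x \<partial>P i)"
      by (intro lower b) (auto simp: shift[OF M])
    with P show "\<forall>\<^sub>F i in F. (\<integral>x. f x \<partial>P i) < a"
      by eventually_elim (simp add: shift)
  qed
qed

text \<open>Indicators of open sets are lower semicontinuous, so their integrals are suprema of integrals of
  tents. The open sets generate the Borel sets and are stable under intersection.\<close>

lemma borel_probs_eqI_tents:
  fixes M N :: "'a::polish_space measure"
  assumes M: "M \<in> borel_probs" and N: "N \<in> borel_probs"
    and eq: "\<And>ts. (\<integral>x. tents ts x \<partial>M) = (\<integral>x. tents ts x \<partial>N)"
  shows "M = N"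
proof -
  interpret M: prob_space M by (rule borel_probs_prob) fact
  interpret N: prob_space N by (rule borel_probs_prob) fact
  have le: "measure M U \<le> measure N U"
    if M: "M \<in> borel_probs" and N: "N \<in> borel_probs"
    and eq: "\<And>ts. (\<integral>x. tents ts x \<partial>M) = (\<integral>x. tents ts x \<partial>N)" and U: "open U"
    for U and M N :: "'a measure"
  proof (rule ccontr)
    have UM: "U \<in> sets M" "U \<in> sets N" "U \<in> sets borel"
      using U M N by (auto simp: borel_probs_sets)
    assume "\<not> measure M U \<le> measure N U"
    then have a: "measure N U < (\<integral>x. indicator U x \<partial>M)" using UM borel_probs_space[OF that(1)] by simp
    have "\<exists>r>0. \<forall>y. dist x y < r \<longrightarrow> a < (indicator U y :: real)" if "a < indicator U x" for a and x :: 'a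
    proof (cases "x \<in> U")
      case True
      then obtain r where "r > 0" "ball x r \<subseteq> U" using U open_contains_ball by blast
      with True that show ?thesis by (intro exI[of _ r]) (auto simp: subset_iff)
    next
      case False
      then show ?thesis using that by (intro exI[of _ 1]) (auto simp: indicator_def)
    qed
    then obtain ts where ts: "\<And>x. tents ts x \<le> (indicator U x :: real)" "measure N U < (\<integral>x. tents ts x \<partial>M)"
      using tents_below_lsc_integral[OF M _ _ _ _ a, of 1] UM by (metis (no_types, lifting) borel_measurable_indicator indicator_le_1 indicator_pos_le)
    have "(\<integral>x. tents ts x \<partial>N) \<le> (\<integral>x. indicator U x \<partial>N)"
      using ts(1) UM by (intro integral_mono borel_probs_integrable_bcontfun[OF that(2)] tents_bcontfun
          borel_probs_integrable[OF that(2), of _ 1]) auto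
    with ts(2) that(3)[of ts] UM borel_probs_space[OF that(2)] show False by simp
  qed
  show ?thesis
  proof (rule measure_eqI_generator_eq[where E="{U. open U}" and \<Omega>=UNIV and A="\<lambda>_. UNIV"])
    show "Int_stable {U::'a set. open U}" by (auto simp: Int_stable_def)
    show "sets M = sigma_sets UNIV {U. open U}" "sets N = sigma_sets UNIV {U. open U}"
      using M N by (simp_all add: borel_probs_sets borel_def)
    show "emeasure M U = emeasure N U" if "U \<in> {U. open U}" for U
      using le[OF M N eq, of U] le[OF N M eq[symmetric], of U] that
      by (simp add: M.emeasure_eq_measure N.emeasure_eq_measure)
  qed (use M in \<open>auto simp: M.emeasure_eq_measure\<close>)
qed

lemma tendsto_fun_iff:
  fixes f :: "'i \<Rightarrow> 'b \<Rightarrow> 'c::topological_space"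
  shows "(f \<longlongrightarrow> l) F \<longleftrightarrow> (\<forall>x. ((\<lambda>i. f i x) \<longlongrightarrow> l x) F)"
proof -
  have "(f \<longlongrightarrow> l) F \<longleftrightarrow> limitin (product_topology (\<lambda>_. euclidean) UNIV) f l F"
    by (simp add: euclidean_product_topology)
  then show ?thesis unfolding limitin_componentwise by (simp add: euclidean_product_topology)
qed

text \<open>The coordinates in which the weak topology becomes a subspace of a countable power of the reals.\<close>

definition tent_integrals :: "'a::polish_space measure \<Rightarrow> tent_code list \<Rightarrow> real" where
  "tent_integrals M = (\<lambda>ts. \<integral>x. tents ts x \<partial>M)"

lemma inj_on_tent_integrals: "inj_on tent_integrals (borel_probs :: 'a::polish_space measure set)"
  by (intro inj_onI borel_probs_eqI_tents) (auto simp: tent_integrals_def dest: fun_cong)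

lemma limitin_weak_topology_iff_tent_integrals:
  fixes P :: "'i \<Rightarrow> 'a::polish_space measure"
  assumes M: "M \<in> borel_probs" and P: "\<forall>\<^sub>F i in F. P i \<in> borel_probs"
  shows "limitin weak_topology P M F \<longleftrightarrow> ((\<lambda>i. tent_integrals (P i)) \<longlongrightarrow> tent_integrals M) F"
  unfolding limitin_weak_topology
proof safe
  assume "\<forall>f\<in>bcontfun. ((\<lambda>k. \<integral>x. f x \<partial>P k) \<longlongrightarrow> (\<integral>x. f x \<partial>M :: real)) F"
  then show "((\<lambda>i. tent_integrals (P i)) \<longlongrightarrow> tent_integrals M) F"
    by (simp add: tendsto_fun_iff tent_integrals_def tents_bcontfun)
next
  fix f :: "'a \<Rightarrow> real"
  assume "((\<lambda>i. tent_integrals (P i)) \<longlongrightarrow> tent_integrals M) F" and f: "f \<in> bcontfun"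
  then have "((\<lambda>i. \<integral>x. tents ts x \<partial>P i) \<longlongrightarrow> (\<integral>x. tents ts x \<partial>M)) F" for ts
    by (simp add: tendsto_fun_iff tent_integrals_def)
  then show "((\<lambda>k. \<integral>x. f x \<partial>P k) \<longlongrightarrow> (\<integral>x. f x \<partial>M)) F"
    by (rule tendsto_integral_of_tents[OF P M _ f])
qed (use M P in auto)

section \<open>Weak sequential compactness of tight families\<close>

text \<open>A consistent assignment of masses to the nodes of the tree of finite words over the natural numbers
  is realised by random words on \<open>[0,1)\<close>: the node \<open>w\<close> owns an interval of length \<open>p w\<close>, the intervals
  of its children fill it from left to right, and \<open>code n u\<close> is the node of depth \<open>n\<close> whose interval
  contains \<open>u\<close>.\<close>

lemma tree_measure_on_unit_interval:
  fixes p :: "nat list \<Rightarrow> real"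
  assumes p0: "\<And>w. 0 \<le> p w" and p1: "p [] = 1" and sums: "\<And>w. (\<lambda>k. p (w @ [k])) sums p w"
  obtains code :: "nat \<Rightarrow> real \<Rightarrow> nat list" where
    "\<And>n. code n \<in> measurable borel (count_space UNIV)"
    "\<And>n u. length (code n u) = n"
    "\<And>n u. take n (code (Suc n) u) = code n u"
    "\<And>n u. u \<in> {0..<1} \<Longrightarrow> 0 < p (code n u)"
    "\<And>w. measure lborel {u \<in> {0..<1}. code (length w) u = w} = p w"
proof -
  \<comment> \<open>The left end of the interval of \<open>w\<close>: at each level, add the masses of the elder siblings.\<close>
  define a where "a w = (\<Sum>n<length w. \<Sum>k<w ! n. p (take n w @ [k]))" for w
  have a_Nil: "a [] = 0" by (simp add: a_def)
  have a_snoc: "a (w @ [k]) = a w + (\<Sum>j<k. p (w @ [j]))" for w k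
    by (simp add: a_def nth_append)
  define next_digit where "next_digit w u = (LEAST k. u < a w + (\<Sum>j<Suc k. p (w @ [j])))" for w u
  define code where "code = rec_nat (\<lambda>u :: real. []) (\<lambda>n c u. c u @ [next_digit (c u) u])"
  have code_0: "code 0 u = []" and code_Suc: "code (Suc n) u = code n u @ [next_digit (code n u) u]" for n u
    by (simp_all add: code_def)
  have sub: "{a (w @ [k])..<a (w @ [k]) + p (w @ [k])} \<subseteq> {a w..<a w + p w}" for w k
  proof -
    have "(\<Sum>j<Suc k. p (w @ [j])) \<le> p w"
      using sum_le_suminf[OF sums_summable[OF sums[of w]], of "{..<Suc k}"] p0 sums_unique[OF sums[of w]] by simp
    moreover have "0 \<le> (\<Sum>j<k. p (w @ [j]))" by (intro sum_nonneg p0)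
    ultimately show ?thesis by (auto simp: a_snoc)
  qed
  have step: "u \<in> {a (w @ [k])..<a (w @ [k]) + p (w @ [k])} \<longleftrightarrow> k = next_digit w u"
    if u: "u \<in> {a w..<a w + p w}" for u w k
  proof -
    have mono: "(\<Sum>j<i. p (w @ [j])) \<le> (\<Sum>j<i'. p (w @ [j]))" if "i \<le> i'" for i i'
      using that by (intro sum_mono2) (auto intro: p0)
    have "(\<lambda>k. a w + (\<Sum>j<k. p (w @ [j]))) \<longlonglongrightarrow> a w + p w"
      using sums[of w] unfolding sums_def by (intro tendsto_intros)
    then have "\<forall>\<^sub>F k in sequentially. u < a w + (\<Sum>j<k. p (w @ [j]))" using u by (intro order_tendstoD) auto
    then obtain N where "\<And>k. k \<ge> N \<Longrightarrow> u < a w + (\<Sum>j<k. p (w @ [j]))" unfolding eventually_sequentially by blast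
    then have ex: "u < a w + (\<Sum>j<Suc N. p (w @ [j]))" by (metis le_Suc_eq order_refl)
    have least: "u < a w + (\<Sum>j<Suc (next_digit w u). p (w @ [j]))"
      unfolding next_digit_def by (rule LeastI[of "\<lambda>k. u < a w + (\<Sum>j<Suc k. p (w @ [j]))", OF ex])
    have not: "a w + (\<Sum>j<Suc i. p (w @ [j])) \<le> u" if "i < next_digit w u" for i
      using not_less_Least[OF that[unfolded next_digit_def]] by simp
    show ?thesis
    proof
      assume k: "u \<in> {a (w @ [k])..<a (w @ [k]) + p (w @ [k])}"
      then have "a w + (\<Sum>j<k. p (w @ [j])) \<le> u" "u < a w + (\<Sum>j<Suc k. p (w @ [j]))" by (auto simp: a_snoc)
      moreover have "\<not> Suc (next_digit w u) \<le> k"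
        using calculation(1) least mono[of "Suc (next_digit w u)" k] by linarith
      moreover have "\<not> k < next_digit w u" using not[of k] calculation(2) by linarith
      ultimately show "k = next_digit w u" by linarith
    next
      assume k: "k = next_digit w u"
      have "a w + (\<Sum>j<k. p (w @ [j])) \<le> u"
      proof (cases k)
        case (Suc i)
        then show ?thesis using not[of i] k by simp
      qed (use u in simp)
      with least k show "u \<in> {a (w @ [k])..<a (w @ [k]) + p (w @ [k])}" by (simp add: a_snoc)
    qed
  qed
  have len: "length (code n u) = n" for n u by (induction n) (auto simp: code_0 code_Suc)
  have tk: "take n (code (Suc n) u) = code n u" for n u using len[of n u] by (simp add: code_Suc)
  have inside: "u \<in> {a (code n u)..<a (code n u) + p (code n u)}" if "u \<in> {0..<1}" for n u
  proof (induction n)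
    case (Suc n)
    from step[OF Suc] show ?case by (simp add: code_Suc)
  qed (use that in \<open>simp add: code_0 a_Nil p1\<close>)
  have unit: "{a w..<a w + p w} \<subseteq> {0..<1}" for w
  proof (induction w rule: rev_induct)
    case (snoc k w)
    with sub[of w k] show ?case by blast
  qed (simp add: a_Nil p1)
  have unique: "w = code (length w) u" if "u \<in> {a w..<a w + p w}" for u w
    using that
  proof (induction w rule: rev_induct)
    case (snoc k w)
    from subsetD[OF sub snoc.prems] have u: "u \<in> {a w..<a w + p w}" .
    from snoc.IH[OF this] have "w = code (length w) u" .
    moreover have "k = next_digit w u" using step[OF u, of k] snoc.prems by blast
    ultimately show ?case by (simp add: code_Suc)
  qed (simp add: code_0)
  have "{u \<in> {0..<1}. code (length w) u = w} = {a w..<a w + p w}" for w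
    using inside unique[of _ w] unit[of w] by (safe; metis subsetD)
  then have meas: "measure lborel {u \<in> {0..<1}. code (length w) u = w} = p w" for w
    using p0[of w] by simp
  have measurable: "code n \<in> measurable borel (count_space UNIV)" for n
  proof (induction n)
    case (Suc n)
    have "(\<lambda>u. w @ [next_digit w u]) \<in> measurable borel (count_space UNIV)" for w
    proof -
      have "(\<lambda>u. next_digit w u) \<in> measurable borel (count_space UNIV)"
        unfolding next_digit_def by measurable
      then show ?thesis by (rule measurable_compose) simp
    qed
    from measurable_compose_countable[OF this Suc] show ?case by (simp add: code_Suc[abs_def])
  qed (simp add: code_0[abs_def])
  have pos: "0 < p (code n u)" if "u \<in> {0..<1}" for n u
    using inside[OF that, of n] by auto
  show thesis by (rule that[OF measurable len tk pos meas])
qed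

text \<open>For laws on a countable set, convergence of the point masses to a law of total mass \<open>1\<close> implies
  convergence of the integrals of bounded functions: integrals over finite sets converge, and they
  bound the limit inferior of the full integrals from below, for \<open>B + h\<close> as well as for \<open>B - h\<close>.\<close>

lemma tendsto_integral_countable_valued:
  fixes h :: "'c::countable \<Rightarrow> real" and Q :: "'d measure" and P :: "nat \<Rightarrow> 'e measure"
  assumes P: "\<And>i. prob_space (P i)" and Q: "prob_space Q"
    and X: "\<And>i. X \<in> measurable (P i) (count_space UNIV)" and Y: "Y \<in> measurable Q (count_space UNIV)"
    and lim: "\<And>w. (\<lambda>i. measure (P i) {x \<in> space (P i). X x = w}) \<longlonglongrightarrow> measure Q {x \<in> space Q. Y x = w}"
    and h: "\<And>w. \<bar>h w\<bar> \<le> B"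
  shows "(\<lambda>i. \<integral>x. h (X x) \<partial>P i) \<longlonglongrightarrow> (\<integral>x. h (Y x) \<partial>Q)"
proof -
  define W :: "nat \<Rightarrow> 'c set" where "W n = from_nat ` {..<n}" for n
  have finW: "finite (W n)" for n by (simp add: W_def)
  have trunc: "(\<integral>x. g (Z x) * indicator (W n) (Z x) \<partial>M) = (\<Sum>w\<in>W n. g w * measure M {x \<in> space M. Z x = w})"
    if "prob_space M" and Z: "Z \<in> measurable M (count_space UNIV)"
    for n and g :: "'c \<Rightarrow> real" and M :: "'f measure" and Z
  proof -
    interpret prob_space M by fact
    have m: "{x \<in> space M. Z x = w} \<in> sets M" for w using Z by measurable
    have "(\<integral>x. g (Z x) * indicator (W n) (Z x) \<partial>M) = (\<integral>x. (\<Sum>w\<in>W n. g w * indicator {x \<in> space M. Z x = w} x) \<partial>M)"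
    proof (rule Bochner_Integration.integral_cong[OF refl])
      fix x assume "x \<in> space M"
      then have "(\<Sum>w\<in>W n. g w * indicator {x \<in> space M. Z x = w} x) = (\<Sum>w\<in>W n. if w = Z x then g w else 0)"
        by (intro sum.cong) auto
      then show "g (Z x) * indicator (W n) (Z x) = (\<Sum>w\<in>W n. g w * indicator {x \<in> space M. Z x = w} x)"
        using finW[of n] by (simp add: indicator_def)
    qed
    also have "\<dots> = (\<Sum>w\<in>W n. g w * measure M {x \<in> space M. Z x = w})"
      using m by (subst Bochner_Integration.integral_sum) (auto simp: less_top[symmetric])
    finally show ?thesis .
  qed
  have int: "integrable M (\<lambda>x. g (Z x))"
    if "prob_space M" and Z: "Z \<in> measurable M (count_space UNIV)" and "\<And>w. \<bar>g w\<bar> \<le> b"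
    for g :: "'c \<Rightarrow> real" and M :: "'f measure" and Z b
  proof -
    interpret prob_space M by fact
    show ?thesis using that measurable_compose[OF Z, of g borel] by (intro integrable_const_bound[of _ b]) auto
  qed
  have lower: "\<forall>\<^sub>F i in sequentially. a < (\<integral>x. g (X x) \<partial>P i)"
    if g: "\<And>w. 0 \<le> g w" "\<And>w. g w \<le> b" and a: "a < (\<integral>x. g (Y x) \<partial>Q)" for g :: "'c \<Rightarrow> real" and a b
  proof -
    have "(\<lambda>n. \<integral>x. g (Y x) * indicator (W n) (Y x) \<partial>Q) \<longlonglongrightarrow> (\<integral>x. g (Y x) \<partial>Q)"
    proof (rule integral_dominated_convergence)
      show "integrable Q (\<lambda>x. g (Y x))" by (rule int[OF Q Y, of _ b]) (use g in auto)
      show "(\<lambda>x. g (Y x)) \<in> borel_measurable Q" "(\<lambda>x. g (Y x) * indicator (W n) (Y x)) \<in> borel_measurable Q" for n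
        using measurable_compose[OF Y, of g borel] measurable_compose[OF Y, of "\<lambda>w. g w * indicator (W n) w" borel] by auto
      have "(\<lambda>n. g w * indicator (W n) w) \<longlonglongrightarrow> g w" for w
      proof (rule tendsto_eventually, rule eventually_mono[OF eventually_gt_at_top[of "to_nat w"]])
        fix n assume "to_nat w < n"
        then have "w \<in> W n" unfolding W_def by (intro image_eqI[of _ _ "to_nat w"]) auto
        then show "g w * indicator (W n) w = g w" by simp
      qed
      then show "AE x in Q. (\<lambda>n. g (Y x) * indicator (W n) (Y x)) \<longlonglongrightarrow> g (Y x)" by simp
    qed (use g in \<open>auto simp: indicator_def\<close>)
    from order_tendstoD(1)[OF this a]
    obtain n where "a < (\<integral>x. g (Y x) * indicator (W n) (Y x) \<partial>Q)" unfolding eventually_sequentially by blast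
    moreover have "(\<lambda>i. \<Sum>w\<in>W n. g w * measure (P i) {x \<in> space (P i). X x = w})
        \<longlonglongrightarrow> (\<Sum>w\<in>W n. g w * measure Q {x \<in> space Q. Y x = w})"
      by (intro tendsto_intros lim)
    ultimately have "\<forall>\<^sub>F i in sequentially. a < (\<Sum>w\<in>W n. g w * measure (P i) {x \<in> space (P i). X x = w})"
      unfolding trunc[OF Q Y] by (intro order_tendstoD)
    then show ?thesis
    proof (rule eventually_mono)
      fix i assume "a < (\<Sum>w\<in>W n. g w * measure (P i) {x \<in> space (P i). X x = w})"
      also have "\<dots> = (\<integral>x. g (X x) * indicator (W n) (X x) \<partial>P i)" by (rule trunc[OF P X, symmetric])
      also have "\<dots> \<le> (\<integral>x. g (X x) \<partial>P i)"
        using g by (intro integral_mono int[OF P X, of "\<lambda>w. g w * indicator (W n) w" b] int[OF P X, of _ b])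
          (auto simp: indicator_def intro: order_trans)
      finally show "a < (\<integral>x. g (X x) \<partial>P i)" .
    qed
  qed
  have bounds: "0 \<le> B + h w" "0 \<le> B - h w" "B + h w \<le> 2 * B" "B - h w \<le> 2 * B" for w
    using h[of w] by linarith+
  have shift: "(\<integral>x. B + h (Z x) \<partial>M) = B + (\<integral>x. h (Z x) \<partial>M)" "(\<integral>x. B - h (Z x) \<partial>M) = B - (\<integral>x. h (Z x) \<partial>M)"
    if M: "prob_space M" and Z: "Z \<in> measurable M (count_space UNIV)" for M :: "'f measure" and Z
  proof -
    interpret prob_space M by fact
    show "(\<integral>x. B + h (Z x) \<partial>M) = B + (\<integral>x. h (Z x) \<partial>M)" "(\<integral>x. B - h (Z x) \<partial>M) = B - (\<integral>x. h (Z x) \<partial>M)"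
      using int[OF M Z, of h, OF h] by (simp_all add: prob_space)
  qed
  show ?thesis
  proof (rule order_tendstoI)
    fix a assume "a < (\<integral>x. h (Y x) \<partial>Q)"
    then have "\<forall>\<^sub>F i in sequentially. B + a < (\<integral>x. B + h (X x) \<partial>P i)"
      using bounds by (intro lower[of "\<lambda>w. B + h w" "2 * B"]) (auto simp: shift[OF Q Y])
    then show "\<forall>\<^sub>F i in sequentially. a < (\<integral>x. h (X x) \<partial>P i)" by (simp add: shift[OF P X])
  next
    fix a assume "(\<integral>x. h (Y x) \<partial>Q) < a"
    then have "\<forall>\<^sub>F i in sequentially. B - a < (\<integral>x. B - h (X x) \<partial>P i)"
      using bounds by (intro lower[of "\<lambda>w. B - h w" "2 * B"]) (auto simp: shift[OF Q Y])
    then show "\<forall>\<^sub>F i in sequentially. (\<integral>x. h (X x) \<partial>P i) < a" by (simp add: shift[OF P X])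
  qed
qed

text \<open>For fixed \<open>n\<close> this is a Borel partition into countably many sets of radius at most \<open>2\<^sup>-\<^sup>n\<close>; the sets
  of points with prescribed first digits are the cells of a nested sequence of partitions.\<close>

definition digit :: "nat \<Rightarrow> 'a::polish_space \<Rightarrow> nat" where
  "digit n x = (LEAST j. dist x (dense_seq j) < (1/2) ^ n)"

definition digits :: "nat \<Rightarrow> 'a::polish_space \<Rightarrow> nat list" where
  "digits n x = map (\<lambda>m. digit m x) [0..<n]"

lemma dist_digit: "dist x (dense_seq (digit n x)) < (1/2) ^ n"
  unfolding digit_def by (rule LeastI_ex) (intro dense_seq, simp)

lemma digit_le: "dist x (dense_seq j) < (1/2) ^ n \<Longrightarrow> digit n x \<le> j"
  unfolding digit_def by (rule Least_le)

lemma length_digits [simp]: "length (digits n x) = n"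
  by (simp add: digits_def)

lemma digits_Suc: "digits (Suc n) x = digits n x @ [digit n x]"
  by (simp add: digits_def)

lemma nth_digits: "m < n \<Longrightarrow> digits n x ! m = digit m x"
  by (simp add: digits_def)

lemma measurable_digit: "digit n \<in> measurable borel (count_space UNIV)"
  unfolding digit_def[abs_def] by measurable

lemma measurable_digits: "digits n \<in> measurable borel (count_space UNIV)"
proof (induction n)
  case (Suc n)
  have "(\<lambda>x. w @ [digit n x]) \<in> measurable borel (count_space UNIV)" for w
    by (rule measurable_compose[OF measurable_digit]) simp
  from measurable_compose_countable[OF this Suc] show ?case by (simp add: digits_Suc[abs_def])
qed (simp add: digits_def[abs_def])

lemma (in prob_space) integral_diff_le:
  fixes f g :: "'a \<Rightarrow> real"
  assumes "integrable M f" "integrable M g" "\<And>x. x \<in> space M \<Longrightarrow> \<bar>f x - g x\<bar> \<le> c"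
  shows "\<bar>(\<integral>x. f x \<partial>M) - (\<integral>x. g x \<partial>M)\<bar> \<le> c"
proof -
  have "(\<integral>x. f x \<partial>M) - (\<integral>x. g x \<partial>M) = (\<integral>x. f x - g x \<partial>M)" using assms by simp
  also have "\<bar>\<dots>\<bar> \<le> (\<integral>x. \<bar>f x - g x\<bar> \<partial>M)" using integral_norm_bound[of M "\<lambda>x. f x - g x"] by simp
  also have "\<dots> \<le> (\<integral>x. c \<partial>M)" using assms by (intro integral_mono) auto
  finally show ?thesis by (simp add: prob_space)
qed

text \<open>Prokhorov's theorem, with tightness in the form of uniform total boundedness. Along a subsequence
  the masses of all cells converge. Tightness keeps mass from escaping to infinitely many cells, so
  the limits are again consistent and are realised by random words on \<open>[0,1)\<close>. The centres of the
  cells along such a word form a Cauchy sequence, and the law of their limit is the weak limit.\<close>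

theorem tight_imp_weakly_convergent_subsequence:
  fixes P :: "nat \<Rightarrow> 'a::polish_space measure"
  assumes P: "\<And>i. P i \<in> borel_probs"
    and tight: "\<And>r e. r > 0 \<Longrightarrow> e > 0 \<Longrightarrow> \<exists>F. finite F \<and> (\<forall>i. 1 - e \<le> measure (P i) (\<Union>x\<in>F. ball x r))"
  obtains r M where "strict_mono r" "M \<in> borel_probs" "limitin weak_topology (\<lambda>i. P (r i)) M sequentially"
proof -
  note spaceP = borel_probs_space[OF P] and setsP = borel_probs_sets[OF P]
  interpret P: prob_space "P i" for i by (rule borel_probs_prob[OF P])
  define cell where "cell w = {x :: 'a. digits (length w) x = w}" for w
  have cell_meas: "cell w \<in> sets (P i)" for w i
  proof -
    have "cell w = digits (length w) -` {w} \<inter> space borel" by (auto simp: cell_def)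
    then show ?thesis unfolding setsP using measurable_sets[OF measurable_digits] by simp
  qed
  \<comment> \<open>Uniformly in \<open>i\<close>, all but a small part of the mass has its \<open>n\<close>-th digit in a finite set.\<close>
  have few: "\<exists>N. \<forall>i. measure (P i) {x. \<not> digit n x < N} \<le> e" if "e > 0" for n e
  proof -
    obtain F :: "'a set" where F: "finite F" "\<And>i. 1 - e \<le> measure (P i) (\<Union>x\<in>F. ball x ((1/2) ^ Suc n))"
      using tight[of "(1/2) ^ Suc n" e] \<open>e > 0\<close> by auto
    obtain j where j: "\<And>x :: 'a. dist x (dense_seq (j x)) < (1/2) ^ Suc n"
      using dense_seq[of "(1/2) ^ Suc n"] by (metis zero_less_divide_1_iff zero_less_numeral zero_less_power)
    define N where "N = Suc (Max (insert 0 (j ` F)))"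
    have sub: "{x. \<not> digit n x < N} \<subseteq> UNIV - (\<Union>x\<in>F. ball x ((1/2) ^ Suc n))"
    proof (intro subsetI DiffI UNIV_I notI)
      fix y assume "y \<in> {x. \<not> digit n x < N}" "y \<in> (\<Union>x\<in>F. ball x ((1/2) ^ Suc n))"
      then obtain x where y: "\<not> digit n y < N" "x \<in> F" "y \<in> ball x ((1/2) ^ Suc n)" by blast
      have "dist y (dense_seq (j x)) < (1/2) ^ Suc n + (1/2) ^ Suc n"
        using y(3) j[of x] dist_triangle[of y "dense_seq (j x)" x] by (simp add: dist_commute)
      then have "digit n y \<le> j x" by (intro digit_le) simp
      also have "\<dots> < N" using F(1) y(2) by (simp add: N_def less_Suc_eq_le)
      finally show False using y(1) by simp
    qed
    have "measure (P i) {x. \<not> digit n x < N} \<le> e" for i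
    proof -
      have op: "(\<Union>x\<in>F. ball x ((1/2) ^ Suc n)) \<in> sets (P i)" unfolding setsP by (intro borel_open) blast
      have "measure (P i) {x. \<not> digit n x < N} \<le> measure (P i) (UNIV - (\<Union>x\<in>F. ball x ((1/2) ^ Suc n)))"
        using op sets.compl_sets[OF op] unfolding spaceP by (intro P.finite_measure_mono sub)
      also have "\<dots> = 1 - measure (P i) (\<Union>x\<in>F. ball x ((1/2) ^ Suc n))"
        using P.prob_compl[OF op] unfolding spaceP .
      finally show ?thesis using F(2)[of i] by linarith
    qed
    then show ?thesis by blast
  qed
  have "compact (PiE UNIV (\<lambda>_ :: nat list. {0..1 :: real}))"
    using compactin_PiE[of "\<lambda>_ :: nat list. euclidean :: real topology" UNIV "\<lambda>_. {0..1}"]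
    by (simp add: euclidean_product_topology)
  then have "seq_compact (PiE UNIV (\<lambda>_ :: nat list. {0..1 :: real}))" by (rule compact_imp_seq_compact)
  moreover have "\<forall>i. (\<lambda>w. measure (P i) (cell w)) \<in> PiE UNIV (\<lambda>_. {0..1})"
    by (auto simp: PiE_UNIV_domain)
  ultimately obtain p r where r: "strict_mono r" and p: "((\<lambda>i w. measure (P i) (cell w)) \<circ> r) \<longlonglongrightarrow> p"
    by (rule seq_compactE) blast
  have lim: "(\<lambda>i. measure (P (r i)) (cell w)) \<longlonglongrightarrow> p w" for w
    using p by (simp add: tendsto_fun_iff comp_def)
  have p0: "0 \<le> p w" for w by (rule LIMSEQ_le_const[OF lim]) simp
  have p1: "p [] = 1"
    using lim[of "[]"] P.prob_space unfolding spaceP by (simp add: cell_def digits_def LIMSEQ_const_iff)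
  have split: "measure (P i) (\<Union>k<N. cell (w @ [k])) = (\<Sum>k<N. measure (P i) (cell (w @ [k])))" for w i N
    by (rule P.finite_measure_finite_Union) (use cell_meas in \<open>auto simp: disjoint_family_on_def\<close>, auto simp: cell_def)
  have sums: "(\<lambda>k. p (w @ [k])) sums p w" for w
  proof -
    have upper: "(\<Sum>k<N. p (w @ [k])) \<le> p w" for N
    proof (rule LIMSEQ_le[OF tendsto_sum[OF lim] lim], intro exI allI impI)
      show "(\<Sum>k<N. measure (P (r i)) (cell (w @ [k]))) \<le> measure (P (r i)) (cell w)" for i
        unfolding split[symmetric]
        by (intro P.finite_measure_mono cell_meas) (auto simp: cell_def digits_Suc)
    qed
    have lower: "\<exists>N. p w - e \<le> (\<Sum>k<N. p (w @ [k]))" if e: "e > 0" for e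
    proof -
      obtain N where N: "\<And>i. measure (P i) {x. \<not> digit (length w) x < N} \<le> e" using few[OF e] by blast
      have "p w \<le> (\<Sum>k<N. p (w @ [k])) + e"
      proof (rule LIMSEQ_le[OF lim tendsto_add[OF tendsto_sum[OF lim] tendsto_const]], intro exI allI impI)
        fix i
        have D: "{x. \<not> digit (length w) x < N} \<in> sets (P (r i))"
        proof -
          have "{x. \<not> digit (length w) x < N} = digit (length w) -` {N..} \<inter> space (borel :: 'a measure)" by auto
          then show ?thesis unfolding setsP using measurable_sets[OF measurable_digit] by simp
        qed
        have "measure (P (r i)) (cell w) \<le> measure (P (r i)) ((\<Union>k<N. cell (w @ [k])) \<union> {x. \<not> digit (length w) x < N})"
        proof (rule P.finite_measure_mono)
          show "cell w \<subseteq> (\<Union>k<N. cell (w @ [k])) \<union> {x. \<not> digit (length w) x < N}"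
            by (auto simp: cell_def digits_Suc)
          show "(\<Union>k<N. cell (w @ [k])) \<union> {x. \<not> digit (length w) x < N} \<in> sets (P (r i))"
            using D cell_meas by auto
        qed
        also have "\<dots> \<le> measure (P (r i)) (\<Union>k<N. cell (w @ [k])) + measure (P (r i)) {x. \<not> digit (length w) x < N}"
          using D by (intro measure_Un_le) (auto simp: cell_meas)
        finally show "measure (P (r i)) (cell w) \<le> (\<Sum>k<N. measure (P (r i)) (cell (w @ [k]))) + e"
          using N[of "r i"] by (simp add: split)
      qed
      then show ?thesis by (intro exI[of _ N]) simp
    qed
    show ?thesis unfolding sums_def
    proof (rule order_tendstoI)
      fix a assume "a < p w"
      then obtain N where N: "p w - (p w - a) / 2 \<le> (\<Sum>k<N. p (w @ [k]))" using lower[of "(p w - a) / 2"] by auto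
      have "a < (\<Sum>k<n. p (w @ [k]))" if "n \<ge> N" for n
      proof -
        have "(\<Sum>k<N. p (w @ [k])) \<le> (\<Sum>k<n. p (w @ [k]))" using that by (intro sum_mono2) (auto intro: p0)
        with N \<open>a < p w\<close> show ?thesis by (simp add: field_simps)
      qed
      then show "\<forall>\<^sub>F n in sequentially. a < (\<Sum>k<n. p (w @ [k]))" unfolding eventually_sequentially by blast
    next
      fix a assume "p w < a"
      then show "\<forall>\<^sub>F n in sequentially. (\<Sum>k<n. p (w @ [k])) < a"
        by (intro always_eventually allI le_less_trans[OF upper])
    qed
  qed
  obtain code :: "nat \<Rightarrow> real \<Rightarrow> nat list" where code_meas: "\<And>n. code n \<in> measurable borel (count_space UNIV)"
    and len: "\<And>n u. length (code n u) = n"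
    and take: "\<And>n u. take n (code (Suc n) u) = code n u"
    and pos: "\<And>n u. u \<in> {0..<1} \<Longrightarrow> 0 < p (code n u)"
    and code_p: "\<And>w. measure lborel {u \<in> {0..<1}. code (length w) u = w} = p w"
  proof (rule tree_measure_on_unit_interval[of p, OF p0 p1 sums])
    fix c :: "nat \<Rightarrow> real \<Rightarrow> nat list"
    assume "\<And>n. c n \<in> measurable borel (count_space UNIV)" "\<And>n u. length (c n u) = n"
      "\<And>n u. take n (c (Suc n) u) = c n u" "\<And>n u. u \<in> {0..<1} \<Longrightarrow> 0 < p (c n u)"
      "\<And>w. measure lborel {u \<in> {0..<1}. c (length w) u = w} = p w"
    then show thesis by (rule that[of c])
  qed
  define U where "U = restrict_space lborel {0..<1::real}"
  have spaceU: "space U = {0..<1}" by (simp add: U_def space_restrict_space)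
  have "emeasure U (space U) = 1" by (simp add: U_def emeasure_restrict_space spaceU)
  then interpret U: prob_space U by (rule prob_spaceI)
  have U_meas: "f \<in> measurable U N" if "f \<in> measurable borel N" for f :: "real \<Rightarrow> 'c" and N
    unfolding U_def using that by (simp add: measurable_restrict_space1 measurable_lborel1)
  have code_law: "measure U {u \<in> space U. code n u = w} = (if length w = n then p w else 0)" for n w
  proof (cases "length w = n")
    case True
    have "measure U {u \<in> {0..<1}. code (length w) u = w} = p w"
      unfolding U_def code_p[symmetric]
      by (rule measure_restrict_space) auto
    with True show ?thesis by (simp add: spaceU)
  next
    case False
    with len have none: "{u \<in> space U. code n u = w} = {}" by auto
    with False show ?thesis unfolding none by simp
  qed
  have take_le: "take n (code m u) = code n u" if "n \<le> m" for n m u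
    using that
  proof (induction m rule: dec_induct)
    case base
    show ?case using len[of n u] by simp
  next
    case (step m)
    have "take n (code (Suc m) u) = take n (take m (code (Suc m) u))" using step by (simp add: min_def)
    with step show ?case by (simp add: take)
  qed
  define Z where "Z n u = (dense_seq (last (code (Suc n) u)) :: 'a)" for n and u :: real
  have Z_last: "dense_seq (code (Suc m) u ! n) = Z n u" if "n \<le> m" for n m u
  proof -
    have "code (Suc m) u ! n = take (Suc n) (code (Suc m) u) ! n" by simp
    also have "take (Suc n) (code (Suc m) u) = code (Suc n) u" using that by (intro take_le) simp
    also have "code (Suc n) u ! n = last (code (Suc n) u)" using len[of "Suc n" u] by (subst last_conv_nth) auto
    finally show ?thesis by (simp add: Z_def)
  qed
  \<comment> \<open>A cell with positive limiting mass is nonempty, and a common point of the cells compares the centres.\<close>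
  have Z_close: "dist (Z n u) (Z m u) \<le> 2 * (1/2) ^ n" if u: "u \<in> {0..<1}" and nm: "n \<le> m" for u n m
  proof -
    have "\<forall>\<^sub>F i in sequentially. 0 < measure (P (r i)) (cell (code (Suc m) u))"
      by (rule order_tendstoD(1)[OF lim pos[OF u]])
    then obtain i where "0 < measure (P (r i)) (cell (code (Suc m) u))" unfolding eventually_sequentially by blast
    then have "cell (code (Suc m) u) \<noteq> {}" by (metis less_irrefl measure_empty)
    then obtain x :: 'a where x: "digits (Suc m) x = code (Suc m) u" by (auto simp: cell_def len)
    have "dist x (Z k u) < (1/2) ^ k" if "k \<le> m" for k
      using dist_digit[of x k] Z_last[OF that, of u] nth_digits[of k "Suc m" x] that unfolding x[symmetric] by simp
    from this[OF nm] this[of m] have "dist x (Z n u) < (1/2) ^ n" "dist x (Z m u) < (1/2) ^ m" by auto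
    moreover have "(1/2 :: real) ^ m \<le> (1/2) ^ n" using nm by (intro power_decreasing) auto
    ultimately show ?thesis
      using dist_triangle[of "Z n u" "Z m u" x] unfolding dist_commute[of "Z n u" x] by linarith
  qed
  have half: "\<exists>n. c * (1/2) ^ n < e" if "e > 0" for c e :: real
  proof -
    have "(\<lambda>n. c * (1/2) ^ n) \<longlonglongrightarrow> c * 0" by (intro tendsto_intros LIMSEQ_realpow_zero) auto
    from order_tendstoD(2)[OF this, of e] that show ?thesis unfolding eventually_sequentially by auto
  qed
  have "convergent (\<lambda>n. Z n u)" if u: "u \<in> {0..<1}" for u
  proof (rule Cauchy_convergent, rule metric_CauchyI)
    fix e :: real assume "e > 0"
    then obtain N where N: "4 * (1/2) ^ N < e" using half by blast
    have "dist (Z m u) (Z n u) < e" if "m \<ge> N" "n \<ge> N" for m n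
      using Z_close[OF u that(1)] Z_close[OF u that(2)] dist_triangle[of "Z m u" "Z n u" "Z N u"] N
      by (simp add: dist_commute)
    then show "\<exists>N. \<forall>m\<ge>N. \<forall>n\<ge>N. dist (Z m u) (Z n u) < e" by blast
  qed
  then obtain T where T: "\<And>u. u \<in> {0..<1} \<Longrightarrow> (\<lambda>n. Z n u) \<longlonglongrightarrow> T u" unfolding convergent_def by metis
  have Z_meas: "Z n \<in> borel_measurable U" for n
    unfolding Z_def by (intro measurable_compose[OF U_meas[OF code_meas]]) simp
  have T_meas: "T \<in> borel_measurable U"
    by (rule borel_measurable_LIMSEQ_metric[of Z, OF Z_meas]) (simp add: T spaceU)
  have T_close: "dist (Z n u) (T u) \<le> 2 * (1/2) ^ n" if u: "u \<in> {0..<1}" for u n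
    by (rule LIMSEQ_le_const2[OF tendsto_dist[OF tendsto_const T[OF u]]]) (use Z_close[OF u] in blast)
  define M where "M = distr U borel T"
  have M: "M \<in> borel_probs"
    unfolding borel_probs_iff M_def using U.prob_space_distr[OF T_meas] by simp
  have "(\<lambda>i. \<integral>x. tents ts x \<partial>P (r i)) \<longlonglongrightarrow> (\<integral>x. tents ts x \<partial>M)" for ts
  proof -
    let ?g = "tents ts :: 'a \<Rightarrow> real"
    obtain K where K: "K \<ge> 0" "\<And>x y. \<bar>?g x - ?g y\<bar> \<le> K * dist x y" using tents_lipschitz by blast
    obtain B where B: "\<And>x. ?g x \<le> B" using tents_bounded by blast
    have absB: "\<bar>?g x\<bar> \<le> B" for x using B[of x] tents_nonneg[of ts x] by simp
    have gm: "?g \<in> borel_measurable borel" by (rule borel_measurable_continuous_onI[OF continuous_on_tents])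
    have gi: "integrable (P i) ?g" for i by (rule borel_probs_integrable[OF P gm absB])
    have gTi: "integrable U (\<lambda>u. ?g (T u))"
      by (rule U.integrable_const_bound[of _ B]) (use absB measurable_compose[OF T_meas gm] in auto)
    have gM: "(\<integral>x. ?g x \<partial>M) = (\<integral>u. ?g (T u) \<partial>U)"
      unfolding M_def by (rule integral_distr[OF T_meas gm])
    define h where "h w = ?g (dense_seq (last w))" for w
    have hi: "integrable (P i) (\<lambda>x. h (digits n x))" for i n
      by (rule borel_probs_integrable[OF P, of _ B])
        (use measurable_compose[OF measurable_digits, of h borel] absB in \<open>auto simp: h_def\<close>)
    have hci: "integrable U (\<lambda>u. h (code n u))" for n
      by (rule U.integrable_const_bound[of _ B])
        (use measurable_compose[OF U_meas[OF code_meas], of h borel] absB in \<open>auto simp: h_def\<close>)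
    have hP: "\<bar>(\<integral>x. ?g x \<partial>P i) - (\<integral>x. h (digits (Suc n) x) \<partial>P i)\<bar> \<le> K * (1/2) ^ n" for i n
    proof (rule P.integral_diff_le[OF gi hi])
      fix x
      have "\<bar>?g x - h (digits (Suc n) x)\<bar> \<le> K * dist x (dense_seq (digit n x))"
        using K(2) by (simp add: h_def digits_Suc)
      also have "\<dots> \<le> K * (1/2) ^ n" using dist_digit[of x n] K(1) by (intro mult_left_mono) auto
      finally show "\<bar>?g x - h (digits (Suc n) x)\<bar> \<le> K * (1/2) ^ n" .
    qed
    have hU: "\<bar>(\<integral>u. ?g (T u) \<partial>U) - (\<integral>u. h (code (Suc n) u) \<partial>U)\<bar> \<le> K * (2 * (1/2) ^ n)" for n
    proof (rule U.integral_diff_le[OF gTi hci])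
      fix u assume u: "u \<in> space U"
      have "\<bar>?g (T u) - h (code (Suc n) u)\<bar> \<le> K * dist (T u) (Z n u)"
        using K(2) by (simp add: h_def Z_def)
      also have "\<dots> \<le> K * (2 * (1/2) ^ n)"
        using T_close[of u n] u K(1) unfolding spaceU by (intro mult_left_mono) (auto simp: dist_commute)
      finally show "\<bar>?g (T u) - h (code (Suc n) u)\<bar> \<le> K * (2 * (1/2) ^ n)" .
    qed
    \<comment> \<open>At a fixed level only the laws of the words matter, and these converge by construction.\<close>
    have conv: "(\<lambda>i. \<integral>x. h (digits (Suc n) x) \<partial>P (r i)) \<longlonglongrightarrow> (\<integral>u. h (code (Suc n) u) \<partial>U)" for n
    proof (rule tendsto_integral_countable_valued[of "\<lambda>i. P (r i)" U _ _ h B])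
      show "digits (Suc n) \<in> measurable (P (r i)) (count_space UNIV)" for i
        using measurable_digits unfolding measurable_cong_sets[OF setsP refl] .
      show "code (Suc n) \<in> measurable U (count_space UNIV)" by (rule U_meas[OF code_meas])
      show "(\<lambda>i. measure (P (r i)) {x \<in> space (P (r i)). digits (Suc n) x = w})
          \<longlonglongrightarrow> measure U {x \<in> space U. code (Suc n) x = w}" for w
      proof (cases "length w = Suc n")
        case True
        then show ?thesis using lim[of w] by (simp add: code_law spaceP cell_def)
      next
        case False
        then have "{x \<in> space (P (r i)). digits (Suc n) x = w} = {}" for i
          by (metis (mono_tags, lifting) empty_Collect_eq length_digits)
        with False show ?thesis unfolding code_law by (simp only: measure_empty if_False tendsto_const)
      qed
    qed (use absB in \<open>auto simp: h_def P.prob_space_axioms U.prob_space_axioms\<close>)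
    show ?thesis unfolding gM
    proof (rule tendstoI)
      fix e :: real assume e: "e > 0"
      obtain n where n: "(3 * K) * (1/2) ^ n < e / 2" using half[of "e / 2" "3 * K"] e by auto
      have "\<forall>\<^sub>F i in sequentially. dist (\<integral>x. h (digits (Suc n) x) \<partial>P (r i)) (\<integral>u. h (code (Suc n) u) \<partial>U) < e / 2"
        using e by (intro tendstoD[OF conv]) simp
      then show "\<forall>\<^sub>F i in sequentially. dist (\<integral>x. ?g x \<partial>P (r i)) (\<integral>u. ?g (T u) \<partial>U) < e"
      proof eventually_elim
        case (elim i)
        have "K * (2 * (1/2) ^ n) = 2 * (K * (1/2) ^ n)" "(3 * K) * (1/2) ^ n = 3 * (K * (1/2) ^ n)" by simp_all
        with elim hP[of "r i" n] hU[of n] n show ?case unfolding dist_real_def by linarith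
      qed
    qed
  qed
  then have "limitin weak_topology (\<lambda>i. P (r i)) M sequentially"
    using limitin_weak_topology_iff_tent_integrals[OF M, of "\<lambda>i. P (r i)" sequentially] P
    by (simp add: tendsto_fun_iff tent_integrals_def)
  with r M show thesis by (rule that)
qed

section \<open>The set of couplings\<close>

text \<open>Couplings live on the product space, to which the results on Polish spaces are to be applied.\<close>

instance prod :: (polish_space, polish_space) polish_space ..

lemma couplings_iff:
  fixes \<mu> :: "'a::polish_space measure" and \<nu> :: "'b::polish_space measure"
  shows "\<pi> \<in> couplings \<mu> \<nu> \<longleftrightarrow> \<pi> \<in> borel_probs \<and> distr \<pi> borel fst = \<mu> \<and> distr \<pi> borel snd = \<nu>"
  by (auto simp: couplings_def)

lemma borel_probs_measurable:
  assumes "M \<in> borel_probs" "f \<in> measurable borel N"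
  shows "f \<in> measurable M N"
  using assms measurable_cong_sets[OF borel_probs_sets[OF assms(1)] refl] by blast

text \<open>Composition with \<open>h\<close> turns test functions for the image measures into test functions for \<open>P i\<close>.\<close>

lemma image_measure_of_weak_limit:
  fixes h :: "'a::topological_space \<Rightarrow> 'b::polish_space"
  assumes h: "continuous_on UNIV h" and \<kappa>: "\<kappa> \<in> borel_probs"
    and F: "F \<noteq> bot" and P: "\<And>i. P i \<in> borel_probs" "\<And>i. distr (P i) borel h = \<kappa>"
    and lim: "limitin weak_topology P M F"
  shows "distr M borel h = \<kappa>"
proof (rule borel_probs_eqI_tents[OF _ \<kappa>])
  have M: "M \<in> borel_probs"
    and conv: "\<And>f. f \<in> bcontfun \<Longrightarrow> ((\<lambda>i. \<integral>x. f x \<partial>P i) \<longlongrightarrow> (\<integral>x. f x \<partial>M :: real)) F"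
    using lim by (auto simp: limitin_weak_topology)
  have hm: "h \<in> measurable N borel" if "N \<in> borel_probs" for N
    by (rule borel_probs_measurable[OF that borel_measurable_continuous_onI[OF h]])
  interpret prob_space M by (rule borel_probs_prob[OF M])
  show "distr M borel h \<in> borel_probs" unfolding borel_probs_iff using prob_space_distr[OF hm[OF M]] by simp
  fix ts
  have tm: "(tents ts :: 'b \<Rightarrow> real) \<in> borel_measurable borel"
    by (rule borel_measurable_continuous_onI[OF continuous_on_tents])
  have "(\<lambda>x. tents ts (h x)) \<in> bcontfun"
    using tents_bcontfun[of ts, where 'a='b] continuous_on_compose2[OF continuous_on_tents h]
    by (auto simp: bcontfun_def intro: bounded_subset)
  from conv[OF this] have "((\<lambda>i. \<integral>x. tents ts x \<partial>distr (P i) borel h) \<longlongrightarrow> (\<integral>x. tents ts x \<partial>distr M borel h)) F"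
    by (simp add: integral_distr[OF hm tm] P(1) M)
  then show "(\<integral>x. tents ts x \<partial>distr M borel h) = (\<integral>x. tents ts x \<partial>\<kappa>)"
    using F unfolding P(2) by (simp add: tendsto_const_iff)
qed

lemma limit_of_couplings:
  fixes \<mu> :: "'a::polish_space measure" and \<nu> :: "'b::polish_space measure"
  assumes "\<mu> \<in> borel_probs" "\<nu> \<in> borel_probs" "F \<noteq> bot" "\<And>i. P i \<in> couplings \<mu> \<nu>"
    and lim: "limitin weak_topology P M F"
  shows "M \<in> couplings \<mu> \<nu>"
proof -
  have "distr M borel fst = \<mu>" "distr M borel snd = \<nu>"
    using assms(4) by (auto intro!: image_measure_of_weak_limit[OF _ _ assms(3) _ _ lim] assms(1,2) continuous_intros
        simp: couplings_iff)
  with lim show ?thesis by (simp add: couplings_iff limitin_weak_topology)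
qed

lemma borel_probs_finitely_many_balls:
  fixes \<mu> :: "'a::polish_space measure"
  assumes \<mu>: "\<mu> \<in> borel_probs" and "r > 0" "e > 0"
  obtains N where "1 - e \<le> measure \<mu> (\<Union>j<N. ball (dense_seq j) r)"
proof -
  interpret prob_space \<mu> by (rule borel_probs_prob[OF \<mu>])
  have "(\<Union>N. \<Union>j<N. ball (dense_seq j) r) = (UNIV :: 'a set)"
  proof (intro set_eqI iffI UNIV_I)
    fix x :: 'a
    obtain j where "dist x (dense_seq j) < r" using dense_seq[OF \<open>r > 0\<close>] by blast
    then show "x \<in> (\<Union>N. \<Union>j<N. ball (dense_seq j) r)"
      by (auto simp: dist_commute intro!: exI[of _ "Suc j"] bexI[of _ j])
  qed
  moreover have "(\<lambda>N. measure \<mu> (\<Union>j<N. ball (dense_seq j) r)) \<longlonglongrightarrow> measure \<mu> (\<Union>N. \<Union>j<N. ball (dense_seq j) r)"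
  proof (rule finite_Lim_measure_incseq)
    show "range (\<lambda>N. \<Union>j<N. ball (dense_seq j) r) \<subseteq> sets \<mu>"
      unfolding borel_probs_sets[OF \<mu>] by (auto intro!: borel_open)
    show "incseq (\<lambda>N. \<Union>j<N. ball (dense_seq j :: 'a) r)" by (force simp: incseq_def)
  qed
  ultimately have "(\<lambda>N. measure \<mu> (\<Union>j<N. ball (dense_seq j) r)) \<longlonglongrightarrow> 1"
    using prob_space by (simp add: borel_probs_space[OF \<mu>])
  from order_tendstoD(1)[OF this, of "1 - e"] \<open>e > 0\<close> obtain N where "1 - e < measure \<mu> (\<Union>j<N. ball (dense_seq j) r)"
    unfolding eventually_sequentially by auto
  then show thesis by (intro that[of N]) simp
qed

text \<open>The marginals of a coupling are fixed, and the mass outside a product set is at most the sum of the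
  masses of \<open>\<mu>\<close> and \<open>\<nu>\<close> outside its factors. Hence all couplings together are uniformly tight.\<close>

lemma couplings_sequentially_compact:
  fixes \<mu> :: "'a::polish_space measure" and \<nu> :: "'b::polish_space measure"
  assumes \<mu>: "\<mu> \<in> borel_probs" and \<nu>: "\<nu> \<in> borel_probs" and P: "\<And>i :: nat. P i \<in> couplings \<mu> \<nu>"
  obtains r M where "strict_mono r" "M \<in> couplings \<mu> \<nu>" "limitin weak_topology (\<lambda>i. P (r i)) M sequentially"
proof -
  have Pb: "P i \<in> borel_probs" for i using P by (simp add: couplings_iff)
  interpret P: prob_space "P i" for i by (rule borel_probs_prob[OF Pb])
  have tight: "\<exists>F. finite F \<and> (\<forall>i. 1 - e \<le> measure (P i) (\<Union>x\<in>F. ball x r))" if "r > 0" "e > 0" for r e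
  proof -
    have pos: "r / 2 > 0" "e / 2 > 0" using that by simp_all
    obtain N1 where N1: "1 - e / 2 \<le> measure \<mu> (\<Union>j<N1. ball (dense_seq j) (r / 2))"
      using borel_probs_finitely_many_balls[OF \<mu> pos] by blast
    obtain N2 where N2: "1 - e / 2 \<le> measure \<nu> (\<Union>j<N2. ball (dense_seq j) (r / 2))"
      using borel_probs_finitely_many_balls[OF \<nu> pos] by blast
    define A where "A = (\<Union>j<N1. ball (dense_seq j :: 'a) (r / 2))"
    define B where "B = (\<Union>j<N2. ball (dense_seq j :: 'b) (r / 2))"
    define F where "F = (\<lambda>(i, j). (dense_seq i :: 'a, dense_seq j :: 'b)) ` ({..<N1} \<times> {..<N2})"
    have AB: "A \<in> sets borel" "B \<in> sets borel" unfolding A_def B_def by (auto intro: borel_open)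
    have sub: "A \<times> B \<subseteq> (\<Union>x\<in>F. ball x r)"
    proof
      fix z assume "z \<in> A \<times> B"
      then obtain x y i j where z: "z = (x, y)" "i < N1" "dist (dense_seq i) x < r / 2" "j < N2" "dist (dense_seq j) y < r / 2"
        unfolding A_def B_def by auto
      have "dist (dense_seq i, dense_seq j) (x, y) \<le> dist (dense_seq i) x + dist (dense_seq j) y"
        unfolding dist_prod_def by (simp add: sqrt_sum_squares_le_sum)
      with z show "z \<in> (\<Union>x\<in>F. ball x r)"
        by (intro UN_I[of "(dense_seq i, dense_seq j)"]) (auto simp: F_def)
    qed
    have "1 - e \<le> measure (P i) (\<Union>x\<in>F. ball x r)" for i
    proof -
      have m: "fst \<in> measurable (P i) borel" "snd \<in> measurable (P i) borel"
        by (auto intro!: borel_probs_measurable[OF Pb] borel_measurable_continuous_onI continuous_intros)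
      have sp: "space (P i) = UNIV" by (rule borel_probs_space[OF Pb])
      have d: "distr (P i) borel fst = \<mu>" "distr (P i) borel snd = \<nu>" using P by (simp_all add: couplings_iff)
      have sets: "fst -` A \<in> sets (P i)" "snd -` B \<in> sets (P i)"
        using measurable_sets[OF m(1) AB(1)] measurable_sets[OF m(2) AB(2)] by (simp_all add: sp)
      have "measure (P i) (fst -` A) = measure \<mu> A" "measure (P i) (snd -` B) = measure \<nu> B"
        using measure_distr[OF m(1) AB(1)] measure_distr[OF m(2) AB(2)] d by (simp_all add: sp)
      then have "1 - e / 2 \<le> measure (P i) (fst -` A)" "1 - e / 2 \<le> measure (P i) (snd -` B)"
        using N1 N2 by (simp_all add: A_def B_def)
      moreover have "measure (P i) (fst -` A \<union> snd -` B) \<le> 1" by simp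
      moreover have "measure (P i) (fst -` A \<union> snd -` B) = measure (P i) (fst -` A) + measure (P i) (snd -` B - fst -` A)"
        using sets by (intro P.finite_measure_Union') auto
      moreover have "measure (P i) (snd -` B) = measure (P i) (snd -` B \<inter> fst -` A) + measure (P i) (snd -` B - fst -` A)"
      proof -
        have un: "snd -` B = (snd -` B \<inter> fst -` A) \<union> (snd -` B - fst -` A)" by blast
        show ?thesis by (subst un, rule P.finite_measure_Union) (use sets in auto)
      qed
      moreover have "measure (P i) (snd -` B \<inter> fst -` A) \<le> measure (P i) (\<Union>x\<in>F. ball x r)"
      proof (rule P.finite_measure_mono)
        show "snd -` B \<inter> fst -` A \<subseteq> (\<Union>x\<in>F. ball x r)" using sub by (auto simp: subset_iff)
        show "(\<Union>x\<in>F. ball x r) \<in> sets (P i)" unfolding borel_probs_sets[OF Pb] by (intro borel_open open_UN) auto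
      qed
      ultimately show ?thesis by linarith
    qed
    moreover have "finite F" by (simp add: F_def)
    ultimately show ?thesis by blast
  qed
  obtain r M where "strict_mono r" "limitin weak_topology (\<lambda>i. P (r i)) M sequentially"
    using tight_imp_weakly_convergent_subsequence[of P, OF Pb tight] .
  with limit_of_couplings[OF \<mu> \<nu> sequentially_bot, of "\<lambda>i. P (r i)" M] P show thesis
    by (intro that) auto
qed

lemma compact_tent_integrals_couplings:
  fixes \<mu> :: "'a::polish_space measure" and \<nu> :: "'b::polish_space measure"
  assumes \<mu>: "\<mu> \<in> borel_probs" and \<nu>: "\<nu> \<in> borel_probs"
  shows "compact (tent_integrals ` couplings \<mu> \<nu>)"
  unfolding compact_eq_seq_compact_metric
proof (rule seq_compactI)
  fix g assume "\<forall>n :: nat. g n \<in> tent_integrals ` couplings \<mu> \<nu>"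
  then have "\<forall>n. \<exists>M. M \<in> couplings \<mu> \<nu> \<and> g n = tent_integrals M" by blast
  then obtain P where P: "\<And>n. P n \<in> couplings \<mu> \<nu>" "\<And>n. g n = tent_integrals (P n)"
    using choice[of "\<lambda>n M. M \<in> couplings \<mu> \<nu> \<and> g n = tent_integrals M"] by blast
  obtain r M where r: "strict_mono r" "M \<in> couplings \<mu> \<nu>" "limitin weak_topology (\<lambda>i. P (r i)) M sequentially"
    using couplings_sequentially_compact[OF \<mu> \<nu> P(1)] .
  have "(\<lambda>i. tent_integrals (P (r i))) \<longlonglongrightarrow> tent_integrals M"
    using r P(1) limitin_weak_topology_iff_tent_integrals[of M "\<lambda>i. P (r i)" sequentially] by (simp add: couplings_iff)
  then have "(g \<circ> r) \<longlonglongrightarrow> tent_integrals M" by (simp add: comp_def P(2))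
  with r show "\<exists>l\<in>tent_integrals ` couplings \<mu> \<nu>. \<exists>r. strict_mono r \<and> (g \<circ> r) \<longlonglongrightarrow> l" by blast
qed

text \<open>On probability measures \<open>tent_integrals\<close> is injective with continuous inverse \<open>\<Psi>\<close>, and it carries
  the weak cluster set to the cluster set of a curve in a compact metric space. The topological
  properties come back through \<open>\<Psi>\<close>.\<close>

lemma weak_cluster_set_of_curve:
  fixes \<mu> :: "'a::polish_space measure" and \<nu> :: "'b::polish_space measure"
  assumes \<mu>: "\<mu> \<in> borel_probs" and \<nu>: "\<nu> \<in> borel_probs"
    and P: "\<And>\<epsilon>. \<epsilon> > 0 \<Longrightarrow> P \<epsilon> \<in> couplings \<mu> \<nu>"
    and cont: "\<And>f. f \<in> bcontfun \<Longrightarrow> continuous_on {0<..} (\<lambda>\<epsilon>. \<integral>x. f x \<partial>P \<epsilon> :: real)"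
  shows "weak_cluster_set \<mu> \<nu> P \<noteq> {}" "compactin weak_topology (weak_cluster_set \<mu> \<nu> P)"
    "connectedin weak_topology (weak_cluster_set \<mu> \<nu> P)"
proof -
  define S where "S = tent_integrals ` (borel_probs :: ('a \<times> 'b) measure set)"
  define \<Psi> where "\<Psi> = inv_into (borel_probs :: ('a \<times> 'b) measure set) tent_integrals"
  have \<Psi>: "\<Psi> y \<in> borel_probs" "tent_integrals (\<Psi> y) = y" if "y \<in> S" for y
    using that inv_into_into[of y tent_integrals borel_probs] f_inv_into_f[of y tent_integrals borel_probs]
    by (auto simp: S_def \<Psi>_def)
  have \<Psi>_eq: "\<Psi> (tent_integrals M) = M" if "M \<in> borel_probs" for M :: "('a \<times> 'b) measure"
    unfolding \<Psi>_def using inj_on_tent_integrals that by (rule inv_into_f_f)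
  have cont\<Psi>: "continuous_map (top_of_set S) weak_topology \<Psi>"
    unfolding continuous_map_atin
  proof
    fix y assume "y \<in> topspace (top_of_set S)"
    then have y: "y \<in> S" by simp
    have ev: "\<forall>\<^sub>F z in at y within S. z \<in> S" by (simp add: eventually_at_filter)
    have "((\<lambda>z. tent_integrals (\<Psi> z)) \<longlongrightarrow> y) (at y within S)"
      using tendsto_ident_at by (rule tendsto_cong[THEN iffD1, rotated]) (use ev \<Psi> in \<open>auto elim!: eventually_mono\<close>)
    with ev \<Psi> y have "limitin weak_topology \<Psi> (\<Psi> y) (at y within S)"
      by (subst limitin_weak_topology_iff_tent_integrals) (auto elim!: eventually_mono)
    moreover have "atin_within euclidean y S = at y within S"
      by (auto simp: filter_eq_iff eventually_atin_within eventually_at_topological)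
    ultimately show "limitin weak_topology \<Psi> (\<Psi> y) (atin (top_of_set S) y)"
      using y by (simp add: atin_subtopology_within)
  qed
  define \<gamma> where "\<gamma> \<epsilon> = tent_integrals (P \<epsilon>)" for \<epsilon>
  define L where "L = {y. \<exists>\<epsilon> :: nat \<Rightarrow> real. (\<forall>k. \<epsilon> k > 0) \<and> decseq \<epsilon> \<and> \<epsilon> \<longlonglongrightarrow> 0 \<and> (\<lambda>k. \<gamma> (\<epsilon> k)) \<longlonglongrightarrow> y}"
  have "continuous_on {0<..} \<gamma>"
    unfolding \<gamma>_def tent_integrals_def by (intro continuous_on_coordinatewise_then_product cont tents_bcontfun)
  then have L: "L \<noteq> {}" "compact L" "connected L" "L \<subseteq> tent_integrals ` couplings \<mu> \<nu>"
    unfolding L_def using cluster_set_of_curve[OF compact_tent_integrals_couplings[OF \<mu> \<nu>], of \<gamma>] P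
    by (simp_all add: \<gamma>_def)
  have LS: "L \<subseteq> S" using L(4) by (auto simp: S_def couplings_iff)
  have lim_iff: "limitin weak_topology (\<lambda>k. P (\<epsilon> k)) M sequentially \<longleftrightarrow> (\<lambda>k. \<gamma> (\<epsilon> k)) \<longlonglongrightarrow> tent_integrals M"
    if "M \<in> couplings \<mu> \<nu>" "\<forall>k. \<epsilon> k > 0" for M and \<epsilon> :: "nat \<Rightarrow> real"
    unfolding \<gamma>_def using that P by (intro limitin_weak_topology_iff_tent_integrals) (auto simp: couplings_iff)
  have K: "weak_cluster_set \<mu> \<nu> P = \<Psi> ` L"
  proof (intro set_eqI iffI)
    fix M assume "M \<in> weak_cluster_set \<mu> \<nu> P"
    then have "M \<in> couplings \<mu> \<nu>" "tent_integrals M \<in> L"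
      unfolding weak_cluster_set_def L_def using lim_iff by auto
    then show "M \<in> \<Psi> ` L" using \<Psi>_eq[of M] by (metis couplings_iff imageI)
  next
    fix M assume "M \<in> \<Psi> ` L"
    then obtain y where y: "y \<in> L" "M = \<Psi> y" by blast
    then obtain M' where M': "M' \<in> couplings \<mu> \<nu>" "y = tent_integrals M'" using L(4) by blast
    then have "M = M'" using \<Psi>_eq[of M'] y(2) by (simp add: couplings_iff)
    with M' y(1) show "M \<in> weak_cluster_set \<mu> \<nu> P"
      unfolding weak_cluster_set_def L_def using lim_iff by auto
  qed
  show "weak_cluster_set \<mu> \<nu> P \<noteq> {}" unfolding K using L(1) by simp
  show "compactin weak_topology (weak_cluster_set \<mu> \<nu> P)"
    unfolding K using L(2) LS by (intro image_compactin[OF _ cont\<Psi>]) (simp add: compactin_subtopology)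
  show "connectedin weak_topology (weak_cluster_set \<mu> \<nu> P)"
    unfolding K using L(3) LS by (intro connectedin_continuous_map_image[OF cont\<Psi>]) (simp add: connectedin_subtopology)
qed

section \<open>The relative entropy of a density\<close>

text \<open>The integrand of the relative entropy, normalised to be nonnegative with minimum \<open>0\<close> at \<open>1\<close>; the added
  affine part integrates to \<open>0\<close> against probability densities.\<close>

definition ent :: "real \<Rightarrow> real" where
  "ent t = t * ln t - t + 1"

lemma ent_nonneg: "0 \<le> t \<Longrightarrow> 0 \<le> ent t"
proof (cases "t = 0")
  case False
  assume "0 \<le> t"
  with False have t: "0 < t" by simp
  have "ln (1 / t) \<le> 1 / t - 1" using t by (intro ln_le_minus_one) simp
  then have "t * (1 - 1 / t) \<le> t * ln t" using t by (intro mult_left_mono) (auto simp: ln_div)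
  then show ?thesis using t by (simp add: ent_def algebra_simps)
qed (simp add: ent_def)

text \<open>From \<open>log t \<le> t - 1\<close>. It makes the entropy of bounded densities finite.\<close>

lemma ent_le_square: "0 \<le> t \<Longrightarrow> ent t \<le> (t - 1)\<^sup>2"
proof (cases "t = 0")
  case False
  assume "0 \<le> t"
  with False have t: "0 < t" by simp
  have "t * ln t \<le> t * (t - 1)" using t by (intro mult_left_mono ln_le_minus_one) auto
  then show ?thesis by (simp add: ent_def power2_eq_square algebra_simps)
qed (simp add: ent_def)

text \<open>The critical point is \<open>0\<close>, where \<open>t log t\<close> is dominated by a multiple of \<open>\<surd>t + t\<^sup>2\<close>.\<close>

lemma tendsto_ent:
  assumes "u \<longlonglongrightarrow> l" "\<And>n. 0 \<le> u n"
  shows "(\<lambda>n. ent (u n)) \<longlonglongrightarrow> ent l"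
proof (cases "l = 0")
  case False
  with assms have "l > 0" using LIMSEQ_le_const[OF assms(1), of 0] by force
  with assms show ?thesis unfolding ent_def by (intro tendsto_intros) auto
next
  case True
  have bound: "\<bar>t * ln t\<bar> \<le> 4 * (sqrt t + t\<^sup>2)" if "t \<ge> 0" for t :: real
  proof (cases "t = 0")
    case False
    with that have t: "t > 0" by simp
    have "ln t \<le> t - 1" by (rule ln_le_minus_one[OF t])
    then have up: "t * ln t \<le> t * (t - 1)" using t by (intro mult_left_mono) auto
    have "ln (1 / sqrt t) \<le> 1 / sqrt t - 1" using t by (intro ln_le_minus_one) simp
    then have "- ln t \<le> 2 * (1 / sqrt t)" using t by (simp add: ln_div ln_sqrt)
    then have "t * (- ln t) \<le> t * (2 * (1 / sqrt t))" using t by (intro mult_left_mono) auto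
    also have "\<dots> = 2 * sqrt t" using real_div_sqrt[of t] t by (simp add: field_simps)
    finally have lo: "- (t * ln t) \<le> 2 * sqrt t" by simp
    have "0 \<le> sqrt t" "0 \<le> t\<^sup>2" using t by auto
    moreover have "t * (t - 1) \<le> t\<^sup>2" using t by (simp add: power2_eq_square right_diff_distrib)
    then have "t * ln t \<le> t\<^sup>2" by (rule order_trans[OF up])
    ultimately have "t * ln t \<le> 4 * (sqrt t + t\<^sup>2)" "- (t * ln t) \<le> 4 * (sqrt t + t\<^sup>2)"
      using lo unfolding distrib_left by linarith+
    then show ?thesis by (rule abs_leI)
  qed simp
  have "(\<lambda>n. 4 * (sqrt (u n) + (u n)\<^sup>2)) \<longlonglongrightarrow> 4 * (sqrt l + l\<^sup>2)" by (intro tendsto_intros assms)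
  then have "(\<lambda>n. 4 * (sqrt (u n) + (u n)\<^sup>2)) \<longlonglongrightarrow> 0" by (simp add: True)
  then have "(\<lambda>n. u n * ln (u n)) \<longlonglongrightarrow> 0"
    by (rule Lim_null_comparison[rotated]) (use bound assms(2) in simp)
  then have "(\<lambda>n. u n * ln (u n) - u n + 1) \<longlonglongrightarrow> 0 - l + 1" by (intro tendsto_intros assms)
  then show ?thesis by (simp add: ent_def True)
qed

text \<open>With \<open>s = (p + q) / 2\<close> and \<open>log x \<le> x - 1\<close> at \<open>x = \<surd>(s/p)\<close> and \<open>x = \<surd>(s/q)\<close>, the convexity defect is at
  least \<open>(\<surd>p - \<surd>q)\<^sup>2 / 2\<close>. On the other hand \<open>|p - q| = |\<surd>p - \<surd>q| (\<surd>p + \<surd>q)\<close>, and the free parameter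
  \<open>t\<close> splits this product. It does the work of the Cauchy--Schwarz inequality pointwise, so that the
  estimate can be integrated as it stands.\<close>

lemma ent_strong_convexity:
  assumes p: "0 \<le> p" and q: "0 \<le> q" and t: "0 \<le> t"
  shows "2 * ent ((p + q) / 2) + t * \<bar>p - q\<bar> \<le> ent p + ent q + t\<^sup>2 * (p + q)"
proof (cases "p + q = 0")
  case True
  with p q have "p = 0" "q = 0" by linarith+
  then show ?thesis by (simp add: ent_def)
next
  case False
  define s where "s = (p + q) / 2"
  define a where "a = sqrt p"
  define b where "b = sqrt q"
  define c where "c = sqrt s"
  have s: "s > 0" using False p q by (simp add: s_def)
  have sq: "a\<^sup>2 = p" "b\<^sup>2 = q" "c\<^sup>2 = s" "a \<ge> 0" "b \<ge> 0" "c > 0"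
    using p q s by (auto simp: a_def b_def c_def)
  have key: "x * ln x - x * ln s \<ge> 2 * x - 2 * (c * sqrt x)" if "x \<ge> 0" for x
  proof (cases "x = 0")
    case False
    with that have x: "x > 0" by simp
    have "ln (c / sqrt x) \<le> c / sqrt x - 1" using x sq by (intro ln_le_minus_one) simp
    moreover have "ln (c / sqrt x) = (ln s - ln x) / 2" using x s by (simp add: ln_div ln_sqrt c_def)
    ultimately have "ln x - ln s \<ge> 2 - 2 * (c / sqrt x)" by (simp add: field_simps)
    then have "x * (2 - 2 * (c / sqrt x)) \<le> x * (ln x - ln s)" using x by (intro mult_left_mono) auto
    moreover have "x * (2 - 2 * (c / sqrt x)) = 2 * x - 2 * (c * (x / sqrt x))" by (simp add: right_diff_distrib)
    ultimately show ?thesis using real_div_sqrt[of x] x by (simp add: right_diff_distrib)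
  qed simp
  have "2 * ent s = (p + q) * ln s - (p + q) + 2"
    unfolding ent_def s_def by (simp add: algebra_simps add_divide_distrib)
  then have "ent p + ent q - 2 * ent s = (p * ln p - p * ln s) + (q * ln q - q * ln s)"
    by (simp add: ent_def algebra_simps)
  also have "\<dots> \<ge> 2 * (p + q) - 2 * (c * (a + b))"
    using key[OF p] key[OF q] by (simp add: a_def b_def algebra_simps)
  finally have 1: "ent p + ent q - 2 * ent s \<ge> 2 * (p + q) - 2 * (c * (a + b))" .
  \<comment> \<open>Opaque names for the two squares keep the remaining steps linear.\<close>
  define X Y where "X = (a - b)\<^sup>2" and "Y = (a + b)\<^sup>2"
  have "0 \<le> (2 * c - (a + b))\<^sup>2" by simp
  also have "\<dots> = 4 * c\<^sup>2 - 4 * (c * (a + b)) + Y"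
    by (simp add: Y_def power2_eq_square algebra_simps)
  also have "4 * c\<^sup>2 = 2 * (p + q)" unfolding sq(3) by (simp add: s_def)
  finally have 2: "4 * (c * (a + b)) \<le> 2 * (p + q) + Y" by linarith
  have 3: "X + Y = 2 * (p + q)"
    unfolding sq(1,2)[symmetric] X_def Y_def by (simp add: power2_eq_square algebra_simps)
  have "p - q = (a - b) * (a + b)" unfolding sq(1,2)[symmetric] by (simp add: power2_eq_square algebra_simps)
  then have abs: "\<bar>p - q\<bar> = \<bar>a - b\<bar> * (a + b)" using sq by (simp add: abs_mult)
  have "0 \<le> (\<bar>a - b\<bar> - t * (a + b))\<^sup>2" by simp
  also have "\<dots> = \<bar>a - b\<bar>\<^sup>2 - 2 * (t * (\<bar>a - b\<bar> * (a + b))) + t\<^sup>2 * Y"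
    by (simp add: Y_def power2_eq_square algebra_simps)
  finally have 4: "2 * (t * \<bar>p - q\<bar>) \<le> X + t\<^sup>2 * Y" unfolding abs power2_abs X_def[symmetric] by linarith
  have "0 \<le> X" by (simp add: X_def)
  with 3 have "t\<^sup>2 * Y \<le> t\<^sup>2 * (2 * (p + q))" by (intro mult_left_mono) auto
  also have "\<dots> = 2 * (t\<^sup>2 * (p + q))" by simp
  finally have 5: "t\<^sup>2 * Y \<le> 2 * (t\<^sup>2 * (p + q))" .
  from 1 2 3 4 5 show ?thesis unfolding s_def by linarith
qed

lemma measurable_ent [measurable]: "ent \<in> borel_measurable borel"
  unfolding ent_def[abs_def] by measurable

text \<open>Two differences of nonnegative extended numbers agree if the crosswise sums do; this moves
  identities between positive and negative parts from additive form to \<open>eintegral\<close>.\<close>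

lemma enn2ereal_diff_eq:
  assumes "U + B = A + V" "B \<noteq> \<infinity>" "V \<noteq> \<infinity>"
  shows "enn2ereal A - enn2ereal B = enn2ereal U - enn2ereal V"
proof -
  obtain b where b: "B = ennreal b" "0 \<le> b" using assms(2) by (cases B) auto
  obtain v where v: "V = ennreal v" "0 \<le> v" using assms(3) by (cases V) auto
  show ?thesis
  proof (cases U)
    case (real u)
    with assms(1) b v obtain a where a: "A = ennreal a" "0 \<le> a" by (cases A) (auto simp flip: ennreal_plus)
    have "u + b = a + v" using assms(1) real a b v by (simp flip: ennreal_plus)
    then show ?thesis using real a b v by simp
  next
    case top
    with assms(1) b v have "A = \<infinity>" by (cases A) (auto simp flip: ennreal_plus)
    with top b v show ?thesis by simp
  qed
qed

lemma eintegral_bounded_below: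
  assumes "prob_space P" and f: "f \<in> borel_measurable P" and b: "0 \<le> b" "\<And>x. 0 \<le> f x + b"
  shows "eintegral P f = enn2ereal (\<integral>\<^sup>+x. ennreal (f x + b) \<partial>P) - ereal b"
proof -
  interpret prob_space P by fact
  have "(\<integral>\<^sup>+x. ennreal (f x + b) \<partial>P) + (\<integral>\<^sup>+x. ennreal (- f x) \<partial>P) = (\<integral>\<^sup>+x. ennreal (f x + b) + ennreal (- f x) \<partial>P)"
    using f by (intro nn_integral_add[symmetric]) auto
  also have "\<dots> = (\<integral>\<^sup>+x. ennreal (f x) + ennreal b \<partial>P)"
  proof (rule nn_integral_cong)
    fix x show "ennreal (f x + b) + ennreal (- f x) = ennreal (f x) + ennreal b"
      using b(1) b(2)[of x] by (cases "f x \<ge> 0") (auto simp: ennreal_neg simp flip: ennreal_plus)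
  qed
  also have "\<dots> = (\<integral>\<^sup>+x. ennreal (f x) \<partial>P) + ennreal b"
    using f by (subst nn_integral_add) (auto simp: emeasure_space_1)
  finally have eq: "(\<integral>\<^sup>+x. ennreal (f x + b) \<partial>P) + (\<integral>\<^sup>+x. ennreal (- f x) \<partial>P) = (\<integral>\<^sup>+x. ennreal (f x) \<partial>P) + ennreal b" .
  have "(\<integral>\<^sup>+x. ennreal (- f x) \<partial>P) \<le> (\<integral>\<^sup>+x. ennreal b \<partial>P)"
  proof (intro nn_integral_mono ennreal_leI)
    fix x show "- f x \<le> b" using b(2)[of x] by linarith
  qed
  then have "(\<integral>\<^sup>+x. ennreal (- f x) \<partial>P) \<noteq> \<infinity>" by (auto simp: emeasure_space_1 top_unique)
  from enn2ereal_diff_eq[OF eq this] b(1) show ?thesis unfolding eintegral_def by simp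
qed

text \<open>Writing the logarithm of the density under \<open>p R\<close> as an integral under \<open>R\<close> turns the positive and the
  negative part of the integrand into those of \<open>p log p\<close>, and \<open>ent p + p\<close> exceeds \<open>p log p\<close> by \<open>1\<close>.\<close>

lemma KL_density:
  fixes p :: "'a \<Rightarrow> real"
  assumes R: "prob_space R" and p: "p \<in> borel_measurable R" "\<And>x. 0 \<le> p x" and P: "prob_space (density R p)"
  shows "KL (density R p) R = enn2ereal (\<integral>\<^sup>+x. ennreal (ent (p x)) \<partial>R)"
proof -
  interpret R: prob_space R by fact
  interpret P: prob_space "density R p" by fact
  let ?P = "density R p"
  have pm: "(\<lambda>x. ennreal (p x)) \<in> borel_measurable R" using p by simp
  have mass: "(\<integral>\<^sup>+x. ennreal (p x) \<partial>R) = 1"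
    using P.emeasure_space_1 pm by (simp add: emeasure_density cong: nn_integral_cong)
  have ac: "absolutely_continuous R ?P" by (rule absolutely_continuousI_density[OF pm])
  have "AE x in R. ennreal (p x) = RN_deriv R ?P x" by (rule R.RN_deriv_unique[OF pm]) simp
  then have "AE x in R. enn2real (RN_deriv R ?P x) = p x" by eventually_elim (metis enn2real_ennreal p(2))
  then have rn: "AE x in ?P. enn2real (RN_deriv R ?P x) = p x"
    using p by (subst AE_density) auto
  have pos: "(\<integral>\<^sup>+x. ennreal (ln (enn2real (RN_deriv R ?P x))) \<partial>?P) = (\<integral>\<^sup>+x. ennreal (p x * ln (p x)) \<partial>R)"
  proof -
    have "(\<integral>\<^sup>+x. ennreal (ln (enn2real (RN_deriv R ?P x))) \<partial>?P) = (\<integral>\<^sup>+x. ennreal (ln (p x)) \<partial>?P)"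
      by (rule nn_integral_cong_AE) (use rn in auto)
    also have "\<dots> = (\<integral>\<^sup>+x. ennreal (p x * ln (p x)) \<partial>R)"
      using p by (subst nn_integral_density) (auto simp: ennreal_mult')
    finally show ?thesis .
  qed
  have neg: "(\<integral>\<^sup>+x. ennreal (- ln (enn2real (RN_deriv R ?P x))) \<partial>?P) = (\<integral>\<^sup>+x. ennreal (- (p x * ln (p x))) \<partial>R)"
  proof -
    have "(\<integral>\<^sup>+x. ennreal (- ln (enn2real (RN_deriv R ?P x))) \<partial>?P) = (\<integral>\<^sup>+x. ennreal (- ln (p x)) \<partial>?P)"
      by (rule nn_integral_cong_AE) (use rn in auto)
    also have "\<dots> = (\<integral>\<^sup>+x. ennreal (p x) * ennreal (- ln (p x)) \<partial>R)"
      using p by (subst nn_integral_density) auto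
    also have "\<dots> = (\<integral>\<^sup>+x. ennreal (- (p x * ln (p x))) \<partial>R)"
      using p(2) by (intro nn_integral_cong) (simp flip: ennreal_mult')
    finally show ?thesis .
  qed
  let ?A = "\<integral>\<^sup>+x. ennreal (p x * ln (p x)) \<partial>R" and ?B = "\<integral>\<^sup>+x. ennreal (- (p x * ln (p x))) \<partial>R"
  have low: "p x * ln (p x) \<ge> p x - 1" for x using ent_nonneg[OF p(2)[of x]] by (simp add: ent_def)
  have "(\<integral>\<^sup>+x. ennreal (ent (p x)) \<partial>R) + 1 + ?B =
      (\<integral>\<^sup>+x. ennreal (ent (p x)) + ennreal (p x) + ennreal (- (p x * ln (p x))) \<partial>R)"
    using p by (simp add: nn_integral_add mass)
  also have "\<dots> = (\<integral>\<^sup>+x. ennreal (p x * ln (p x)) + 1 \<partial>R)"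
  proof (rule nn_integral_cong)
    fix x
    have *: "ent (p x) + p x = p x * ln (p x) + 1" by (simp add: ent_def)
    show "ennreal (ent (p x)) + ennreal (p x) + ennreal (- (p x * ln (p x))) = ennreal (p x * ln (p x)) + 1"
    proof (cases "p x * ln (p x) \<ge> 0")
      case True
      then show ?thesis using ent_nonneg[OF p(2)[of x]] p(2)[of x] *
        by (simp add: ennreal_neg flip: ennreal_plus ennreal_1)
    next
      case False
      then have "ennreal (ent (p x)) + ennreal (p x) + ennreal (- (p x * ln (p x))) = ennreal (ent (p x) + p x - p x * ln (p x))"
        using ent_nonneg[OF p(2)[of x]] p(2)[of x] by (simp flip: ennreal_plus)
      with False * show ?thesis by (simp add: ennreal_neg)
    qed
  qed
  also have "\<dots> = ?A + 1" using p by (simp add: nn_integral_add R.emeasure_space_1)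
  finally have "(\<integral>\<^sup>+x. ennreal (ent (p x)) \<partial>R) + ?B + 1 = ?A + 1" by (simp add: ac_simps)
  then have eq: "(\<integral>\<^sup>+x. ennreal (ent (p x)) \<partial>R) + ?B = ?A + 0"
    using ennreal_add_left_cancel[of 1] by (simp add: ac_simps)
  have "?B \<le> (\<integral>\<^sup>+x. 1 \<partial>R)"
  proof (intro nn_integral_mono)
    fix x show "ennreal (- (p x * ln (p x))) \<le> 1"
      using low[of x] p(2)[of x] by (subst ennreal_1[symmetric], intro ennreal_leI) linarith
  qed
  then have "?B \<noteq> \<infinity>" by (auto simp: R.emeasure_space_1 top_unique)
  from enn2ereal_diff_eq[OF eq this] show ?thesis using ac unfolding KL_def eintegral_def pos neg by (simp add: zero_ennreal.rep_eq)
qed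

section \<open>The entropic minimisers\<close>

text \<open>Completeness of \<open>L\<^sup>1\<close> with an almost everywhere convergent subsequence, and a limit that is
  nonnegative at every point.\<close>

lemma L1_Cauchy_subsequence_converges:
  fixes u :: "nat \<Rightarrow> 'a \<Rightarrow> real"
  assumes int: "\<And>n. integrable M (u n)"
    and Cauchy: "\<And>e. e > 0 \<Longrightarrow> \<exists>N. \<forall>i\<ge>N. \<forall>j\<ge>N. (\<integral>x. \<bar>u i x - u j x\<bar> \<partial>M) < e"
    and nonneg: "\<And>n x. 0 \<le> u n x"
  obtains r f where "strict_mono r" "integrable M f" "\<And>x. 0 \<le> f x" "AE x in M. (\<lambda>n. u (r n) x) \<longlonglongrightarrow> f x"
    "(\<lambda>n. \<integral>\<^sup>+x. ennreal \<bar>u (r n) x - f x\<bar> \<partial>M) \<longlonglongrightarrow> 0"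
proof -
  have "\<exists>N. \<forall>i\<ge>N. \<forall>j\<ge>N. (\<integral>x. norm (u i x - u j x) \<partial>M) < e" if "e > 0" for e
    using Cauchy[OF that] by simp
  from cauchy_L1_AE_cauchy_subseq[of M u, OF int this]
  obtain r where r: "strict_mono r" "AE x in M. Cauchy (\<lambda>i. u (r i) x)" by blast
  have um[measurable]: "u n \<in> borel_measurable M" for n using int by auto
  define f where "f x = max 0 (lim (\<lambda>i. u (r i) x))" for x
  have fm[measurable]: "f \<in> borel_measurable M" unfolding f_def by measurable
  have AE: "AE x in M. (\<lambda>n. u (r n) x) \<longlonglongrightarrow> f x"
    using r(2)
  proof eventually_elim
    case (elim x)
    then have lim: "(\<lambda>n. u (r n) x) \<longlonglongrightarrow> lim (\<lambda>i. u (r i) x)"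
      by (simp add: Cauchy_convergent_iff convergent_LIMSEQ_iff)
    then have "0 \<le> lim (\<lambda>i. u (r i) x)" by (rule LIMSEQ_le_const) (use nonneg in auto)
    with lim show ?case by (simp add: f_def)
  qed
  have bound: "(\<integral>\<^sup>+x. ennreal \<bar>u (r n) x - f x\<bar> \<partial>M) \<le> ennreal e"
    if "e > 0" and N: "\<And>i j. i \<ge> N \<Longrightarrow> j \<ge> N \<Longrightarrow> (\<integral>x. \<bar>u i x - u j x\<bar> \<partial>M) < e" and n: "n \<ge> N" for e N n
  proof -
    have "(\<integral>\<^sup>+x. ennreal \<bar>u (r n) x - f x\<bar> \<partial>M) = (\<integral>\<^sup>+x. liminf (\<lambda>j. ennreal \<bar>u (r n) x - u (r j) x\<bar>) \<partial>M)"
    proof (rule nn_integral_cong_AE)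
      show "AE x in M. ennreal \<bar>u (r n) x - f x\<bar> = liminf (\<lambda>j. ennreal \<bar>u (r n) x - u (r j) x\<bar>)"
        using AE
      proof eventually_elim
        case (elim x)
        then have "(\<lambda>j. ennreal \<bar>u (r n) x - u (r j) x\<bar>) \<longlonglongrightarrow> ennreal \<bar>u (r n) x - f x\<bar>"
          by (intro tendsto_intros)
        then show ?case by (rule lim_imp_Liminf[OF sequentially_bot, symmetric])
      qed
    qed
    also have "\<dots> \<le> liminf (\<lambda>j. \<integral>\<^sup>+x. ennreal \<bar>u (r n) x - u (r j) x\<bar> \<partial>M)"
      by (rule nn_integral_liminf) simp
    also have "\<dots> \<le> limsup (\<lambda>j. \<integral>\<^sup>+x. ennreal \<bar>u (r n) x - u (r j) x\<bar> \<partial>M)"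
      by (rule Liminf_le_Limsup) simp
    also have "\<dots> \<le> ennreal e"
    proof (rule Limsup_bounded, rule eventually_mono[OF eventually_ge_at_top[of N]])
      fix j assume "j \<ge> N"
      then have "(\<integral>x. \<bar>u (r n) x - u (r j) x\<bar> \<partial>M) < e"
        using N n seq_suble[OF r(1)] le_trans by metis
      then show "(\<integral>\<^sup>+x. ennreal \<bar>u (r n) x - u (r j) x\<bar> \<partial>M) \<le> ennreal e"
        using int by (subst nn_integral_eq_integral) (auto intro!: ennreal_leI)
    qed
    finally show ?thesis .
  qed
  have lim0: "(\<lambda>n. \<integral>\<^sup>+x. ennreal \<bar>u (r n) x - f x\<bar> \<partial>M) \<longlonglongrightarrow> 0"
  proof (rule order_tendstoI)
    fix a :: ennreal assume "0 < a"
    then obtain e where e: "e > 0" "ennreal e < a"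
      by (metis dense ennreal_cases ennreal_less_zero_iff less_top order.strict_trans not_less_iff_gr_or_eq top.not_eq_extremum)
    obtain N where "\<And>i j. i \<ge> N \<Longrightarrow> j \<ge> N \<Longrightarrow> (\<integral>x. \<bar>u i x - u j x\<bar> \<partial>M) < e" using Cauchy[OF e(1)] by blast
    from bound[OF e(1) this] e(2) show "\<forall>\<^sub>F n in sequentially. (\<integral>\<^sup>+x. ennreal \<bar>u (r n) x - f x\<bar> \<partial>M) < a"
      unfolding eventually_sequentially by (meson le_less_trans)
  qed simp
  have "\<forall>\<^sub>F n in sequentially. (\<integral>\<^sup>+x. ennreal \<bar>u (r n) x - f x\<bar> \<partial>M) < 1"
    by (rule order_tendstoD(2)[OF lim0]) simp
  then obtain n where n: "(\<integral>\<^sup>+x. ennreal \<bar>u (r n) x - f x\<bar> \<partial>M) < 1" unfolding eventually_sequentially by blast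
  have "integrable M (\<lambda>x. u (r n) x - f x)"
    using n by (intro integrableI_bounded) (auto intro: less_trans simp: ennreal_one_less_top)
  from Bochner_Integration.integrable_diff[OF int[of "r n"] this] have fi: "integrable M f" by simp
  have f0: "0 \<le> f x" for x by (simp add: f_def)
  from that[OF r(1) fi f0 AE lim0] show thesis .
qed

text \<open>The number \<open>b\<close> shifts the cost to a nonnegative one. The shift changes all costs by the same
  constant, and it makes all integrands nonnegative.\<close>

locale entropic_problem =
  fixes \<mu> :: "'a::polish_space measure" and \<nu> :: "'b::polish_space measure"
    and C :: "'a \<times> 'b \<Rightarrow> real" and b :: real
  assumes \<mu>: "\<mu> \<in> borel_probs" and \<nu>: "\<nu> \<in> borel_probs" and cont_C: "continuous_on UNIV C"
    and b: "0 \<le> b" and C_bound: "\<And>z. 0 \<le> C z + b" and int_C: "integrable (\<mu> \<Otimes>\<^sub>M \<nu>) C"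
begin

abbreviation R :: "('a \<times> 'b) measure" where "R \<equiv> \<mu> \<Otimes>\<^sub>M \<nu>"

definition D :: "'a \<times> 'b \<Rightarrow> real" where "D z = C z + b"

text \<open>The entropic cost of the measure with density \<open>p\<close>, up to the additive constant \<open>b\<close>.\<close>

definition energy :: "real \<Rightarrow> ('a \<times> 'b \<Rightarrow> real) \<Rightarrow> ennreal" where
  "energy \<epsilon> p = (\<integral>\<^sup>+z. ennreal (D z * p z + \<epsilon> * ent (p z)) \<partial>R)"

text \<open>The marginal conditions are linear in \<open>p\<close> and continuous in \<open>L\<^sup>1\<close>, which makes convex combinations and
  \<open>L\<^sup>1\<close> limits immediate.\<close>

definition coupling_density :: "('a \<times> 'b \<Rightarrow> real) \<Rightarrow> bool" where
  "coupling_density p \<longleftrightarrow> integrable R p \<and> (\<forall>z. 0 \<le> p z) \<and>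
     (\<forall>A\<in>sets borel. (\<integral>z. p z * indicator A (fst z) \<partial>R) = measure \<mu> A) \<and>
     (\<forall>B\<in>sets borel. (\<integral>z. p z * indicator B (snd z) \<partial>R) = measure \<nu> B)"

sublocale M: prob_space \<mu> by (rule borel_probs_prob[OF \<mu>])
sublocale N: prob_space \<nu> by (rule borel_probs_prob[OF \<nu>])
sublocale R: pair_prob_space \<mu> \<nu> ..

lemma sets_R [measurable_cong, simp]: "sets R = sets borel"
proof -
  have "sets R = sets (borel \<Otimes>\<^sub>M borel :: ('a \<times> 'b) measure)"
    by (rule sets_pair_measure_cong[OF borel_probs_sets[OF \<mu>] borel_probs_sets[OF \<nu>]])
  also have "(borel \<Otimes>\<^sub>M borel :: ('a \<times> 'b) measure) = borel" by (rule borel_prod)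
  finally show ?thesis .
qed

lemma space_R [simp]: "space R = UNIV"
  using sets_eq_imp_space_eq[OF sets_R] by simp

lemma D_nonneg: "0 \<le> D z" using C_bound by (simp add: D_def)

lemma continuous_D: "continuous_on UNIV D" unfolding D_def by (intro continuous_intros cont_C)

lemma measurable_D [measurable]: "D \<in> borel_measurable borel"
  by (rule borel_measurable_continuous_onI[OF continuous_D])

lemma integrable_D: "integrable R D" unfolding D_def using int_C by simp

lemma coupling_densityD:
  assumes "coupling_density p"
  shows "integrable R p" "\<And>z. 0 \<le> p z" "p \<in> borel_measurable borel" "(\<integral>z. p z \<partial>R) = 1"
    "(\<integral>\<^sup>+z. ennreal (p z) \<partial>R) = 1"
proof -
  show *: "integrable R p" "\<And>z. 0 \<le> p z" using assms by (auto simp: coupling_density_def)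
  then have "p \<in> borel_measurable R" by auto
  then show "p \<in> borel_measurable borel" by (simp add: measurable_cong_sets[OF sets_R refl])
  have "\<forall>A\<in>sets borel. (\<integral>z. p z * indicator A (fst z) \<partial>R) = measure \<mu> A"
    using assms unfolding coupling_density_def by blast
  from bspec[OF this, of UNIV] have "(\<integral>z. p z * indicator UNIV (fst z) \<partial>R) = measure \<mu> UNIV" by simp
  then show 1: "(\<integral>z. p z \<partial>R) = 1" using M.prob_space borel_probs_space[OF \<mu>] by simp
  show "(\<integral>\<^sup>+z. ennreal (p z) \<partial>R) = 1" using * 1 by (subst nn_integral_eq_integral) auto
qed

lemma vimage_sets: "A \<in> sets borel \<Longrightarrow> {z :: 'a \<times> 'b. fst z \<in> A} \<in> sets borel"
  "B \<in> sets borel \<Longrightarrow> {z :: 'a \<times> 'b. snd z \<in> B} \<in> sets borel"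
proof -
  have m: "fst \<in> measurable (borel :: ('a \<times> 'b) measure) borel" "snd \<in> measurable (borel :: ('a \<times> 'b) measure) borel"
    by (auto intro!: borel_measurable_continuous_onI continuous_intros)
  show "A \<in> sets borel \<Longrightarrow> {z :: 'a \<times> 'b. fst z \<in> A} \<in> sets borel"
    using measurable_sets[OF m(1)] by (simp add: vimage_def)
  show "B \<in> sets borel \<Longrightarrow> {z :: 'a \<times> 'b. snd z \<in> B} \<in> sets borel"
    using measurable_sets[OF m(2)] by (simp add: vimage_def)
qed

lemma emeasure_density_vimage:
  assumes "integrable R p" "\<And>z. 0 \<le> p z"
  shows "A \<in> sets borel \<Longrightarrow> emeasure (density R p) {z. fst z \<in> A} = ennreal (\<integral>z. p z * indicator A (fst z) \<partial>R)"
    "B \<in> sets borel \<Longrightarrow> emeasure (density R p) {z. snd z \<in> B} = ennreal (\<integral>z. p z * indicator B (snd z) \<partial>R)"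
proof -
  have pm: "(\<lambda>z. ennreal (p z)) \<in> borel_measurable R" using assms by simp
  have *: "emeasure (density R p) S = ennreal (\<integral>z. p z * indicator S z \<partial>R)" if S: "S \<in> sets borel" for S
  proof -
    have "integrable R (\<lambda>z. p z * indicator S z)"
      using S assms(1) by (intro integrable_real_mult_indicator) auto
    then have "(\<integral>\<^sup>+z. ennreal (p z * indicator S z) \<partial>R) = ennreal (\<integral>z. p z * indicator S z \<partial>R)"
      using assms by (intro nn_integral_eq_integral) auto
    moreover have "(\<integral>\<^sup>+z. ennreal (p z * indicator S z) \<partial>R) = (\<integral>\<^sup>+z. ennreal (p z) * indicator S z \<partial>R)"
      by (intro nn_integral_cong) (auto simp: indicator_def)
    ultimately show ?thesis using S pm by (simp add: emeasure_density)
  qed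
  have ind: "indicator {z :: 'a \<times> 'b. fst z \<in> A} z = (indicator A (fst z) :: real)"
    "indicator {z :: 'a \<times> 'b. snd z \<in> B} z = (indicator B (snd z) :: real)" for z
    by (auto simp: indicator_def)
  show "A \<in> sets borel \<Longrightarrow> emeasure (density R p) {z. fst z \<in> A} = ennreal (\<integral>z. p z * indicator A (fst z) \<partial>R)"
    using *[OF vimage_sets(1)] by (simp add: ind)
  show "B \<in> sets borel \<Longrightarrow> emeasure (density R p) {z. snd z \<in> B} = ennreal (\<integral>z. p z * indicator B (snd z) \<partial>R)"
    using *[OF vimage_sets(2)] by (simp add: ind)
qed

lemma coupling_marginals:
  fixes \<pi> :: "('a \<times> 'b) measure"
  assumes s: "sets \<pi> = sets borel"
  shows "\<pi> \<in> couplings \<mu> \<nu> \<longleftrightarrow> (\<forall>A\<in>sets borel. emeasure \<pi> {z. fst z \<in> A} = emeasure \<mu> A) \<and>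
     (\<forall>B\<in>sets borel. emeasure \<pi> {z. snd z \<in> B} = emeasure \<nu> B)"
proof -
  have sp: "space \<pi> = UNIV" using sets_eq_imp_space_eq[OF s] by simp
  have m: "fst \<in> measurable \<pi> borel" "snd \<in> measurable \<pi> borel"
    unfolding measurable_cong_sets[OF s refl]
    by (auto intro!: borel_measurable_continuous_onI continuous_intros)
  have 1: "distr \<pi> borel fst = \<mu> \<longleftrightarrow> (\<forall>A\<in>sets borel. emeasure \<pi> {z. fst z \<in> A} = emeasure \<mu> A)"
  proof
    assume "distr \<pi> borel fst = \<mu>"
    then show "\<forall>A\<in>sets borel. emeasure \<pi> {z. fst z \<in> A} = emeasure \<mu> A"
      using emeasure_distr[OF m(1)] by (auto simp: sp vimage_def)
  next
    assume "\<forall>A\<in>sets borel. emeasure \<pi> {z. fst z \<in> A} = emeasure \<mu> A"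
    then show "distr \<pi> borel fst = \<mu>"
      by (intro measure_eqI) (auto simp: borel_probs_sets[OF \<mu>] emeasure_distr[OF m(1)] sp vimage_def)
  qed
  have 2: "distr \<pi> borel snd = \<nu> \<longleftrightarrow> (\<forall>A\<in>sets borel. emeasure \<pi> {z. snd z \<in> A} = emeasure \<nu> A)"
  proof
    assume "distr \<pi> borel snd = \<nu>"
    then show "\<forall>A\<in>sets borel. emeasure \<pi> {z. snd z \<in> A} = emeasure \<nu> A"
      using emeasure_distr[OF m(2)] by (auto simp: sp vimage_def)
  next
    assume "\<forall>A\<in>sets borel. emeasure \<pi> {z. snd z \<in> A} = emeasure \<nu> A"
    then show "distr \<pi> borel snd = \<nu>"
      by (intro measure_eqI) (auto simp: borel_probs_sets[OF \<nu>] emeasure_distr[OF m(2)] sp vimage_def)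
  qed
  have "prob_space \<pi>" if "distr \<pi> borel fst = \<mu>"
  proof (rule prob_spaceI)
    show "emeasure \<pi> (space \<pi>) = 1"
      using emeasure_distr[OF m(1), of UNIV] M.emeasure_space_1 borel_probs_space[OF \<mu>] unfolding that
      by (simp add: sp)
  qed
  with 1 2 s show ?thesis by (auto simp: couplings_iff borel_probs_iff)
qed

lemma coupling_density_iff:
  assumes p: "p \<in> borel_measurable borel" "\<And>z. 0 \<le> p z"
  shows "coupling_density p \<longleftrightarrow> density R p \<in> couplings \<mu> \<nu>"
proof
  assume *: "coupling_density p"
  note cd = coupling_densityD[OF *]
  show "density R p \<in> couplings \<mu> \<nu>"
    using * by (subst coupling_marginals)
      (auto simp: emeasure_density_vimage[OF cd(1,2)] coupling_density_def M.emeasure_eq_measure N.emeasure_eq_measure)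
next
  assume *: "density R p \<in> couplings \<mu> \<nu>"
  have pm: "p \<in> borel_measurable R" using p by (simp add: measurable_cong_sets[OF sets_R refl])
  have "prob_space (density R p)" using * by (simp add: couplings_iff borel_probs_iff)
  then have "(\<integral>\<^sup>+z. ennreal (p z) \<partial>R) = 1"
    using pm prob_space.emeasure_space_1[of "density R p"] by (simp add: emeasure_density)
  then have int: "integrable R p" using pm p by (intro integrableI_nn_integral_finite[of _ _ 1]) auto
  have nn: "0 \<le> (\<integral>z. p z * indicator A (fst z) \<partial>R)" "0 \<le> (\<integral>z. p z * indicator B (snd z) \<partial>R)" for A B
    using p by (auto intro!: Bochner_Integration.integral_nonneg)
  from * have "\<forall>A\<in>sets borel. emeasure (density R p) {z. fst z \<in> A} = emeasure \<mu> A"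
    "\<forall>B\<in>sets borel. emeasure (density R p) {z. snd z \<in> B} = emeasure \<nu> B"
    by (subst (asm) coupling_marginals; simp)+
  then show "coupling_density p"
    using int p nn by (auto simp: coupling_density_def emeasure_density_vimage[OF int p(2)] M.emeasure_eq_measure N.emeasure_eq_measure)
qed


lemma measurable_R: "f \<in> measurable borel K \<Longrightarrow> f \<in> measurable R K"
  using measurable_cong_sets[OF sets_R refl] by blast

lemma measurable_D_R [measurable]: "D \<in> borel_measurable R"
  by (rule measurable_R[OF measurable_D])

lemma coupling_density_measurable: "coupling_density p \<Longrightarrow> p \<in> borel_measurable R"
  by (rule measurable_R[OF coupling_densityD(3)])

lemma coupling_has_density:
  assumes \<pi>: "\<pi> \<in> couplings \<mu> \<nu>" and ac: "absolutely_continuous R \<pi>"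
  obtains p where "coupling_density p" "\<pi> = density R p"
proof -
  have s: "sets \<pi> = sets R" using \<pi> by (simp add: couplings_iff borel_probs_iff)
  interpret P: prob_space \<pi> using \<pi> by (simp add: couplings_iff borel_probs_iff)
  define p where "p z = enn2real (RN_deriv R \<pi> z)" for z
  have pm: "p \<in> borel_measurable R" unfolding p_def by measurable
  have "AE z in R. RN_deriv R \<pi> z \<noteq> \<infinity>"
    by (rule R.RN_deriv_finite[OF P.sigma_finite_measure_axioms ac s])
  then have "AE z in R. RN_deriv R \<pi> z = ennreal (p z)" by eventually_elim (simp add: p_def ennreal_enn2real_if)
  then have "density R (RN_deriv R \<pi>) = density R p" using pm by (intro density_cong) auto
  then have eq: "\<pi> = density R p" using R.density_RN_deriv[OF ac s] by simp
  have "p \<in> borel_measurable borel" using pm by (simp add: measurable_cong_sets[OF sets_R refl])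
  moreover have "0 \<le> p z" for z by (simp add: p_def)
  ultimately have "coupling_density p \<longleftrightarrow> density R p \<in> couplings \<mu> \<nu>" by (rule coupling_density_iff)
  then have "coupling_density p" unfolding eq[symmetric] using \<pi> by blast
  from this eq show thesis by (rule that)
qed

lemma eintegral_cost:
  assumes "\<pi> \<in> couplings \<mu> \<nu>"
  shows "eintegral \<pi> C = enn2ereal (\<integral>\<^sup>+z. ennreal (D z) \<partial>\<pi>) - ereal b"
proof -
  have \<pi>: "\<pi> \<in> borel_probs" using assms by (simp add: couplings_iff)
  then show ?thesis unfolding D_def
    by (intro eintegral_bounded_below borel_probs_prob b C_bound borel_probs_measurable[OF \<pi>]
        borel_measurable_continuous_onI cont_C)
qed

lemma entropic_cost_density:
  assumes p: "coupling_density p" and \<epsilon>: "\<epsilon> > 0"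
  shows "entropic_cost \<mu> \<nu> C \<epsilon> (density R p) = enn2ereal (energy \<epsilon> p) - ereal b"
proof -
  note cd = coupling_densityD[OF p]
  have c: "density R p \<in> couplings \<mu> \<nu>" using p coupling_density_iff[OF cd(3,2)] by simp
  have [measurable]: "p \<in> borel_measurable R" by (rule coupling_density_measurable[OF p])
  have D: "(\<integral>\<^sup>+z. ennreal (D z) \<partial>density R p) = (\<integral>\<^sup>+z. ennreal (D z * p z) \<partial>R)"
    using cd(2) D_nonneg by (subst nn_integral_density) (auto simp: ennreal_mult' mult.commute intro!: measurable_R)
  have KL: "KL (density R p) R = enn2ereal (\<integral>\<^sup>+z. ennreal (ent (p z)) \<partial>R)"
    using c cd by (intro KL_density) (auto simp: couplings_iff borel_probs_iff R.prob_space_axioms intro!: measurable_R)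
  have "energy \<epsilon> p = (\<integral>\<^sup>+z. ennreal (D z * p z) + ennreal \<epsilon> * ennreal (ent (p z)) \<partial>R)"
    unfolding energy_def using \<epsilon> D_nonneg cd(2) ent_nonneg
    by (intro nn_integral_cong) (simp add: ennreal_mult' ennreal_plus)
  also have "\<dots> = (\<integral>\<^sup>+z. ennreal (D z * p z) \<partial>R) + ennreal \<epsilon> * (\<integral>\<^sup>+z. ennreal (ent (p z)) \<partial>R)"
    by (simp add: nn_integral_add nn_integral_cmult)
  finally have e: "enn2ereal (energy \<epsilon> p) = enn2ereal (\<integral>\<^sup>+z. ennreal (D z * p z) \<partial>R)
      + ereal \<epsilon> * enn2ereal (\<integral>\<^sup>+z. ennreal (ent (p z)) \<partial>R)"
    using \<epsilon> by (simp add: plus_ennreal.rep_eq times_ennreal.rep_eq)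
  have "enn2ereal x - ereal b + enn2ereal y = enn2ereal x + enn2ereal y - ereal b" for x y
    by (cases "enn2ereal x"; cases "enn2ereal y"; simp add: enn2ereal_nonneg)
  from this[of _ "ennreal \<epsilon> * (\<integral>\<^sup>+z. ennreal (ent (p z)) \<partial>R)"] \<epsilon> show ?thesis
    unfolding entropic_cost_def eintegral_cost[OF c] D KL e by (simp add: times_ennreal.rep_eq)
qed

text \<open>Only couplings with a density compete for the minimum.\<close>

lemma entropic_cost_singular:
  assumes \<pi>: "\<pi> \<in> couplings \<mu> \<nu>" and "\<not> absolutely_continuous R \<pi>" and \<epsilon>: "\<epsilon> > 0"
  shows "entropic_cost \<mu> \<nu> C \<epsilon> \<pi> = \<infinity>"
proof -
  have "enn2ereal x - ereal b \<noteq> -\<infinity>" for x by (cases x) auto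
  then show ?thesis using assms unfolding entropic_cost_def eintegral_cost[OF \<pi>] KL_def by simp
qed

lemma coupling_density_midpoint:
  assumes p: "coupling_density p" and q: "coupling_density q"
  shows "coupling_density (\<lambda>z. (p z + q z) / 2)"
proof -
  note cp = coupling_densityD[OF p] and cq = coupling_densityD[OF q]
  have i: "(\<integral>z. (p z + q z) / 2 * indicator S (h z) \<partial>R) =
      ((\<integral>z. p z * indicator S (h z) \<partial>R) + (\<integral>z. q z * indicator S (h z) \<partial>R)) / 2"
    if "{z. h z \<in> S} \<in> sets borel" for S and h :: "'a \<times> 'b \<Rightarrow> 'c"
  proof -
    have ind: "indicator S (h z) = (indicator {z. h z \<in> S} z :: real)" for z by (simp add: indicator_def)
    have "integrable R (\<lambda>z. p z * indicator S (h z))" "integrable R (\<lambda>z. q z * indicator S (h z))"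
      unfolding ind using that cp(1) cq(1) by (auto intro!: integrable_real_mult_indicator)
    then have "(\<integral>z. (p z * indicator S (h z) + q z * indicator S (h z)) / 2 \<partial>R) =
      ((\<integral>z. p z * indicator S (h z) \<partial>R) + (\<integral>z. q z * indicator S (h z) \<partial>R)) / 2" by simp
    then show ?thesis by (simp add: distrib_right)
  qed
  show ?thesis
    unfolding coupling_density_def
  proof (intro conjI allI ballI)
    show "integrable R (\<lambda>z. (p z + q z) / 2)" using cp cq by simp
    show "0 \<le> (p z + q z) / 2" for z using cp(2)[of z] cq(2)[of z] by simp
    show "(\<integral>z. (p z + q z) / 2 * indicator A (fst z) \<partial>R) = measure \<mu> A" if "A \<in> sets borel" for A
      using p q that by (subst i[OF vimage_sets(1)[OF that]]) (simp add: coupling_density_def)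
    show "(\<integral>z. (p z + q z) / 2 * indicator A (snd z) \<partial>R) = measure \<nu> A" if "A \<in> sets borel" for A
      using p q that by (subst i[OF vimage_sets(2)[OF that]]) (simp add: coupling_density_def)
  qed
qed

text \<open>The cost is linear in the density and cancels, so only the convexity of the entropy enters. The
  statement avoids subtraction because the energies may be infinite.\<close>

lemma energy_strong_convexity:
  assumes p: "coupling_density p" and q: "coupling_density q" and \<epsilon>: "\<epsilon> > 0" and t: "0 \<le> t"
  shows "2 * energy \<epsilon> (\<lambda>z. (p z + q z) / 2) + ennreal (\<epsilon> * t * (\<integral>z. \<bar>p z - q z\<bar> \<partial>R))
    \<le> energy \<epsilon> p + energy \<epsilon> q + ennreal (2 * \<epsilon> * t\<^sup>2)"
proof -
  note cp = coupling_densityD[OF p] and cq = coupling_densityD[OF q]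
  have [measurable]: "p \<in> borel_measurable R" "q \<in> borel_measurable R"
    by (rule coupling_density_measurable p q)+
  let ?s = "\<lambda>z. (p z + q z) / 2"
  let ?h = "\<lambda>p z. D z * p z + \<epsilon> * ent (p z)"
  have h0: "0 \<le> ?h r z" if "0 \<le> r z" for r z using that D_nonneg \<epsilon> ent_nonneg by (auto intro!: add_nonneg_nonneg)
  have s0: "0 \<le> ?s z" for z using cp(2)[of z] cq(2)[of z] by simp
  have "ennreal (\<epsilon> * t * (\<integral>z. \<bar>p z - q z\<bar> \<partial>R)) = (\<integral>\<^sup>+z. ennreal (\<epsilon> * t * \<bar>p z - q z\<bar>) \<partial>R)"
    using cp cq \<epsilon> t by (subst nn_integral_eq_integral) auto
  then have "2 * energy \<epsilon> ?s + ennreal (\<epsilon> * t * (\<integral>z. \<bar>p z - q z\<bar> \<partial>R))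
      = (\<integral>\<^sup>+z. 2 * ennreal (?h ?s z) + ennreal (\<epsilon> * t * \<bar>p z - q z\<bar>) \<partial>R)"
    by (simp add: energy_def nn_integral_add nn_integral_cmult)
  also have "\<dots> \<le> (\<integral>\<^sup>+z. ennreal (?h p z) + ennreal (?h q z) + ennreal (\<epsilon> * t\<^sup>2) * (ennreal (p z) + ennreal (q z)) \<partial>R)"
  proof (rule nn_integral_mono)
    fix z
    have "\<epsilon> * (2 * ent (?s z) + t * \<bar>p z - q z\<bar>) \<le> \<epsilon> * (ent (p z) + ent (q z) + t\<^sup>2 * (p z + q z))"
      using \<epsilon> by (intro mult_left_mono ent_strong_convexity cp(2) cq(2) t) auto
    moreover have "2 * (d * ((x + y) / 2) + \<epsilon> * e) + \<epsilon> * t * a = d * (x + y) + \<epsilon> * (2 * e + t * a)" for d x y e a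
      by (simp add: algebra_simps add_divide_distrib)
    moreover have "?h p z + ?h q z + \<epsilon> * t\<^sup>2 * (p z + q z) = D z * (p z + q z) + \<epsilon> * (ent (p z) + ent (q z) + t\<^sup>2 * (p z + q z))"
      by (simp add: algebra_simps)
    ultimately have "2 * ?h ?s z + \<epsilon> * t * \<bar>p z - q z\<bar> \<le> ?h p z + ?h q z + \<epsilon> * t\<^sup>2 * (p z + q z)"
      by (simp only: add_left_mono)
    then have "ennreal (2 * ?h ?s z + \<epsilon> * t * \<bar>p z - q z\<bar>) \<le> ennreal (?h p z + ?h q z + \<epsilon> * t\<^sup>2 * (p z + q z))"
      by (rule ennreal_leI)
    moreover have "ennreal (2 * ?h ?s z + \<epsilon> * t * \<bar>p z - q z\<bar>) = 2 * ennreal (?h ?s z) + ennreal (\<epsilon> * t * \<bar>p z - q z\<bar>)"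
    proof -
      have "ennreal (2 * x + y) = 2 * ennreal x + ennreal y" if "0 \<le> x" "0 \<le> y" for x y
        using that by (simp add: ennreal_mult')
      from this[OF h0[of ?s z, OF s0], of "\<epsilon> * t * \<bar>p z - q z\<bar>"] \<epsilon> t show ?thesis by (simp only: mult_nonneg_nonneg abs_ge_zero less_imp_le)
    qed
    moreover have "ennreal (?h p z + ?h q z + \<epsilon> * t\<^sup>2 * (p z + q z))
        = ennreal (?h p z) + ennreal (?h q z) + ennreal (\<epsilon> * t\<^sup>2) * (ennreal (p z) + ennreal (q z))"
      using h0[of p z, OF cp(2)] h0[of q z, OF cq(2)] \<epsilon> cp(2)[of z] cq(2)[of z]
      by (simp add: ennreal_mult' ennreal_plus)
    ultimately show "2 * ennreal (?h ?s z) + ennreal (\<epsilon> * t * \<bar>p z - q z\<bar>)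
       \<le> ennreal (?h p z) + ennreal (?h q z) + ennreal (\<epsilon> * t\<^sup>2) * (ennreal (p z) + ennreal (q z))" by simp
  qed
  also have "\<dots> = energy \<epsilon> p + energy \<epsilon> q + ennreal (\<epsilon> * t\<^sup>2) * 2"
    using cp cq by (simp add: energy_def nn_integral_add nn_integral_cmult)
  also have "ennreal (\<epsilon> * t\<^sup>2) * 2 = ennreal (2 * \<epsilon> * t\<^sup>2)"
    using \<epsilon> by (simp add: mult.assoc ennreal_mult' mult.left_commute mult.commute)
  finally show ?thesis .
qed

lemma coupling_density_1: "coupling_density (\<lambda>_. 1)"
proof -
  have "emeasure R {z. fst z \<in> A} = emeasure \<mu> A" if "A \<in> sets borel" for A
  proof -
    have "{z :: 'a \<times> 'b. fst z \<in> A} = A \<times> UNIV" by auto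
    then show ?thesis using that N.emeasure_space_1 borel_probs_space[OF \<nu>] borel_probs_sets[OF \<mu>] borel_probs_sets[OF \<nu>]
      by (simp add: N.emeasure_pair_measure_Times)
  qed
  moreover have "emeasure R {z. snd z \<in> B} = emeasure \<nu> B" if "B \<in> sets borel" for B
  proof -
    have "{z :: 'a \<times> 'b. snd z \<in> B} = UNIV \<times> B" by auto
    then show ?thesis using that M.emeasure_space_1 borel_probs_space[OF \<mu>] borel_probs_sets[OF \<mu>] borel_probs_sets[OF \<nu>]
      by (simp add: N.emeasure_pair_measure_Times)
  qed
  ultimately have "R \<in> couplings \<mu> \<nu>" by (subst coupling_marginals) auto
  then show ?thesis by (subst coupling_density_iff) (auto simp: density_1)
qed

lemma energy_1: "energy \<epsilon> (\<lambda>_. 1) = ennreal (\<integral>z. D z \<partial>R)"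
proof -
  have "energy \<epsilon> (\<lambda>_. 1) = (\<integral>\<^sup>+z. ennreal (D z) \<partial>R)" by (simp add: energy_def ent_def)
  also have "\<dots> = ennreal (\<integral>z. D z \<partial>R)" using integrable_D D_nonneg by (intro nn_integral_eq_integral) auto
  finally show ?thesis .
qed

lemma coupling_density_L1_limit:
  assumes u: "\<And>n. coupling_density (u n)" and p: "integrable R p" "\<And>z. 0 \<le> p z"
    and lim: "(\<lambda>n. \<integral>\<^sup>+z. ennreal \<bar>u n z - p z\<bar> \<partial>R) \<longlonglongrightarrow> 0"
  shows "coupling_density p"
proof -
  have i: "(\<lambda>n. \<integral>z. u n z * indicator S (h z) \<partial>R) \<longlonglongrightarrow> (\<integral>z. p z * indicator S (h z) \<partial>R)"
    if S: "{z. h z \<in> S} \<in> sets borel" for S and h :: "'a \<times> 'b \<Rightarrow> 'c"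
  proof (rule tendsto_L1_int)
    have ind: "indicator S (h z) = (indicator {z. h z \<in> S} z :: real)" for z by (simp add: indicator_def)
    show "integrable R (\<lambda>z. u n z * indicator S (h z))" "integrable R (\<lambda>z. p z * indicator S (h z))" for n
      unfolding ind using S p(1) coupling_densityD(1)[OF u[of n]] by (auto intro!: integrable_real_mult_indicator)
    show "(\<lambda>n. \<integral>\<^sup>+z. ennreal (norm (u n z * indicator S (h z) - p z * indicator S (h z))) \<partial>R) \<longlonglongrightarrow> 0"
    proof (rule tendsto_sandwich[OF _ _ tendsto_const lim])
      show "\<forall>\<^sub>F n in sequentially. (\<integral>\<^sup>+z. ennreal (norm (u n z * indicator S (h z) - p z * indicator S (h z))) \<partial>R)
          \<le> (\<integral>\<^sup>+z. ennreal \<bar>u n z - p z\<bar> \<partial>R)"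
        by (intro always_eventually allI nn_integral_mono ennreal_leI) (auto simp: indicator_def)
    qed simp
  qed
  have "(\<integral>z. p z * indicator A (fst z) \<partial>R) = measure \<mu> A" if A: "A \<in> sets borel" for A
    using i[OF vimage_sets(1)[OF A]] u A by (simp add: coupling_density_def LIMSEQ_const_iff)
  moreover have "(\<integral>z. p z * indicator A (snd z) \<partial>R) = measure \<nu> A" if A: "A \<in> sets borel" for A
    using i[OF vimage_sets(2)[OF A]] u A by (simp add: coupling_density_def LIMSEQ_const_iff)
  ultimately show ?thesis using p by (simp add: coupling_density_def)
qed

lemma energy_lsc:
  assumes u: "\<And>n. coupling_density (u n)" and AE: "AE z in R. (\<lambda>n. u n z) \<longlonglongrightarrow> p z" and \<epsilon>: "\<epsilon> > 0"
  shows "energy \<epsilon> p \<le> liminf (\<lambda>n. energy \<epsilon> (u n))"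
proof -
  have [measurable]: "u n \<in> borel_measurable R" for n by (rule coupling_density_measurable[OF u])
  have "energy \<epsilon> p = (\<integral>\<^sup>+z. liminf (\<lambda>n. ennreal (D z * u n z + \<epsilon> * ent (u n z))) \<partial>R)"
    unfolding energy_def
  proof (rule nn_integral_cong_AE)
    show "AE z in R. ennreal (D z * p z + \<epsilon> * ent (p z)) = liminf (\<lambda>n. ennreal (D z * u n z + \<epsilon> * ent (u n z)))"
      using AE
    proof eventually_elim
      case (elim z)
      have "(\<lambda>n. ent (u n z)) \<longlonglongrightarrow> ent (p z)" by (rule tendsto_ent[OF elim]) (rule coupling_densityD[OF u])
      then have "(\<lambda>n. ennreal (D z * u n z + \<epsilon> * ent (u n z))) \<longlonglongrightarrow> ennreal (D z * p z + \<epsilon> * ent (p z))"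
        by (intro tendsto_ennrealI tendsto_intros elim)
      then show ?case by (rule lim_imp_Liminf[OF sequentially_bot, symmetric])
    qed
  qed
  also have "\<dots> \<le> liminf (\<lambda>n. energy \<epsilon> (u n))"
    unfolding energy_def by (rule nn_integral_liminf) measurable
  finally show ?thesis .
qed

text \<open>Two almost minimal densities have an almost minimal midpoint, so the convexity estimate forces them
  to be close in \<open>L\<^sup>1\<close>: first choose \<open>t\<close> small, then the defect small compared to \<open>\<epsilon> t\<^sup>2\<close>. The limit is
  a coupling density, and Fatou's lemma shows that it is minimal.\<close>

lemma energy_minimiser_exists:
  assumes \<epsilon>: "\<epsilon> > 0"
  obtains p where "coupling_density p" "\<And>q. coupling_density q \<Longrightarrow> energy \<epsilon> p \<le> energy \<epsilon> q"
proof -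
  define m where "m = (INF q\<in>Collect coupling_density. energy \<epsilon> q)"
  have m_le: "m \<le> energy \<epsilon> q" if "coupling_density q" for q unfolding m_def using that by (intro INF_lower) simp
  have "m < \<infinity>" using m_le[OF coupling_density_1] by (auto simp: energy_1 intro: le_less_trans)
  then obtain m' where m': "m = ennreal m'" "0 \<le> m'" by (cases m) auto
  have "\<exists>q. coupling_density q \<and> energy \<epsilon> q < m + ennreal (1 / Suc n)" for n
  proof -
    have "m < m + ennreal (1 / Suc n)" using m' by (simp add: ennreal_less_iff flip: ennreal_plus)
    then show ?thesis unfolding m_def INF_less_iff by auto
  qed
  then obtain u where u: "\<And>n. coupling_density (u n)" "\<And>n. energy \<epsilon> (u n) < m + ennreal (1 / Suc n)" by metis
  have L1: "\<epsilon> * t * (\<integral>z. \<bar>u i z - u j z\<bar> \<partial>R) \<le> 1 / Suc i + 1 / Suc j + 2 * \<epsilon> * t\<^sup>2" if t: "t > 0" for t i j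
  proof -
    have "2 * m + ennreal (\<epsilon> * t * (\<integral>z. \<bar>u i z - u j z\<bar> \<partial>R))
        \<le> 2 * energy \<epsilon> (\<lambda>z. (u i z + u j z) / 2) + ennreal (\<epsilon> * t * (\<integral>z. \<bar>u i z - u j z\<bar> \<partial>R))"
      by (intro add_right_mono mult_left_mono m_le coupling_density_midpoint u) simp
    also have "\<dots> \<le> energy \<epsilon> (u i) + energy \<epsilon> (u j) + ennreal (2 * \<epsilon> * t\<^sup>2)"
      using t by (intro energy_strong_convexity u \<epsilon>) simp
    also have "\<dots> \<le> (m + ennreal (1 / Suc i)) + (m + ennreal (1 / Suc j)) + ennreal (2 * \<epsilon> * t\<^sup>2)"
      by (intro add_mono less_imp_le u order_refl)
    also have "2 * m + ennreal (\<epsilon> * t * (\<integral>z. \<bar>u i z - u j z\<bar> \<partial>R)) = ennreal (2 * m' + \<epsilon> * t * (\<integral>z. \<bar>u i z - u j z\<bar> \<partial>R))"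
      using m' \<epsilon> t by (subst ennreal_plus) (auto simp: ennreal_mult')
    also have "(m + ennreal (1 / Suc i)) + (m + ennreal (1 / Suc j)) + ennreal (2 * \<epsilon> * t\<^sup>2)
        = ennreal ((m' + 1 / Suc i) + (m' + 1 / Suc j) + 2 * \<epsilon> * t\<^sup>2)"
      using m' \<epsilon> t by (simp only: ennreal_plus add_nonneg_nonneg divide_nonneg_nonneg zero_le_one of_nat_0_le_iff
        mult_nonneg_nonneg zero_le_numeral less_imp_le zero_le_power2)
    finally have "ennreal (2 * m' + \<epsilon> * t * (\<integral>z. \<bar>u i z - u j z\<bar> \<partial>R))
        \<le> ennreal ((m' + 1 / Suc i) + (m' + 1 / Suc j) + 2 * \<epsilon> * t\<^sup>2)" .
    then show ?thesis using m' \<epsilon> by (subst (asm) ennreal_le_iff) (auto simp del: of_nat_Suc)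
  qed
  have Cauchy: "\<exists>N. \<forall>i\<ge>N. \<forall>j\<ge>N. (\<integral>z. \<bar>u i z - u j z\<bar> \<partial>R) < e" if e: "e > 0" for e
  proof -
    define t where "t = e / 4"
    have t: "t > 0" using e by (simp add: t_def)
    have "0 < \<epsilon> * t\<^sup>2" using \<epsilon> t by simp
    then obtain N where N: "1 / real (Suc N) < \<epsilon> * t\<^sup>2" using nat_approx_posE by blast
    have "(\<integral>z. \<bar>u i z - u j z\<bar> \<partial>R) < e" if "i \<ge> N" "j \<ge> N" for i j
    proof -
      have "1 / real (Suc i) \<le> 1 / real (Suc N)" "1 / real (Suc j) \<le> 1 / real (Suc N)"
        using that by (auto intro!: divide_left_mono)
      with L1[OF t, of i j] N have "\<epsilon> * t * (\<integral>z. \<bar>u i z - u j z\<bar> \<partial>R) < 4 * (\<epsilon> * t\<^sup>2)" by linarith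
      also have "\<dots> = \<epsilon> * t * e" by (simp add: t_def power2_eq_square)
      finally show ?thesis using \<epsilon> t by (simp add: mult_less_cancel_left_pos)
    qed
    then show ?thesis by blast
  qed
  obtain r p where r: "strict_mono r" "integrable R p" "\<And>z. 0 \<le> p z" "AE z in R. (\<lambda>n. u (r n) z) \<longlonglongrightarrow> p z"
    "(\<lambda>n. \<integral>\<^sup>+z. ennreal \<bar>u (r n) z - p z\<bar> \<partial>R) \<longlonglongrightarrow> 0"
    using L1_Cauchy_subsequence_converges[of R u, OF coupling_densityD(1)[OF u(1)] Cauchy coupling_densityD(2)[OF u(1)]] by blast
  have p: "coupling_density p" by (rule coupling_density_L1_limit[OF u(1) r(2,3,5)])
  have "energy \<epsilon> p \<le> liminf (\<lambda>n. energy \<epsilon> (u (r n)))" by (rule energy_lsc[OF u(1) r(4) \<epsilon>])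
  also have "\<dots> \<le> liminf (\<lambda>n. ennreal (m' + 1 / real (Suc n)))"
  proof (intro Liminf_mono always_eventually allI)
    fix n
    have "energy \<epsilon> (u (r n)) \<le> m + ennreal (1 / Suc (r n))" by (rule less_imp_le[OF u(2)])
    also have "\<dots> = ennreal (m' + 1 / real (Suc (r n)))" using m' by (simp add: ennreal_plus del: of_nat_Suc)
    also have "\<dots> \<le> ennreal (m' + 1 / real (Suc n))"
      using seq_suble[OF r(1), of n] by (intro ennreal_leI add_left_mono divide_left_mono) auto
    finally show "energy \<epsilon> (u (r n)) \<le> ennreal (m' + 1 / real (Suc n))" .
  qed
  also have "\<dots> = m"
  proof (rule lim_imp_Liminf[OF sequentially_bot])
    have "(\<lambda>n. m' + 1 / real (Suc n)) \<longlonglongrightarrow> m' + 0"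
      by (intro tendsto_intros) (use LIMSEQ_inverse_real_of_nat in \<open>simp add: inverse_eq_divide\<close>)
    then show "(\<lambda>n. ennreal (m' + 1 / real (Suc n))) \<longlonglongrightarrow> m" unfolding m'(1) by (intro tendsto_ennrealI) simp
  qed
  finally have "energy \<epsilon> p \<le> energy \<epsilon> q" if "coupling_density q" for q using m_le[OF that] by (rule order_trans)
  with p show thesis by (rule that)
qed


definition minimal_density :: "real \<Rightarrow> ('a \<times> 'b \<Rightarrow> real) \<Rightarrow> bool" where
  "minimal_density \<epsilon> p \<longleftrightarrow> coupling_density p \<and> (\<forall>q. coupling_density q \<longrightarrow> energy \<epsilon> p \<le> energy \<epsilon> q)"

lemma minimal_energy_le: "minimal_density \<epsilon> p \<Longrightarrow> energy \<epsilon> p \<le> ennreal (\<integral>z. D z \<partial>R)"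
  using coupling_density_1 energy_1 by (metis minimal_density_def)

text \<open>The midpoint of \<open>p\<close> and \<open>q\<close> has at least the energy of \<open>p\<close>.\<close>

lemma energy_gap:
  assumes p: "minimal_density \<epsilon> p" and q: "coupling_density q" and \<epsilon>: "\<epsilon> > 0" and t: "t \<ge> 0"
  shows "energy \<epsilon> p + ennreal (\<epsilon> * t * (\<integral>z. \<bar>p z - q z\<bar> \<partial>R)) \<le> energy \<epsilon> q + ennreal (2 * \<epsilon> * t\<^sup>2)"
proof -
  have cp: "coupling_density p" using p by (simp add: minimal_density_def)
  obtain m where m: "energy \<epsilon> p = ennreal m" "0 \<le> m"
    using minimal_energy_le[OF p] by (cases "energy \<epsilon> p") (auto simp: top_unique)
  have "2 * energy \<epsilon> p + ennreal (\<epsilon> * t * (\<integral>z. \<bar>p z - q z\<bar> \<partial>R))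
      \<le> 2 * energy \<epsilon> (\<lambda>z. (p z + q z) / 2) + ennreal (\<epsilon> * t * (\<integral>z. \<bar>p z - q z\<bar> \<partial>R))"
    using p coupling_density_midpoint[OF cp q]
    by (intro add_right_mono mult_left_mono) (auto simp: minimal_density_def)
  also have "\<dots> \<le> energy \<epsilon> p + energy \<epsilon> q + ennreal (2 * \<epsilon> * t\<^sup>2)"
    by (rule energy_strong_convexity[OF cp q \<epsilon> t])
  finally have "energy \<epsilon> p + (energy \<epsilon> p + ennreal (\<epsilon> * t * (\<integral>z. \<bar>p z - q z\<bar> \<partial>R)))
      \<le> energy \<epsilon> p + (energy \<epsilon> q + ennreal (2 * \<epsilon> * t\<^sup>2))"
    by (simp only: mult_2 add.assoc)
  then show ?thesis unfolding m(1) by (simp add: ennreal_add_left_cancel_le)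
qed

lemma minimal_density_unique:
  assumes p: "minimal_density \<epsilon> p" and q: "coupling_density q" "energy \<epsilon> q \<le> energy \<epsilon> p" and \<epsilon>: "\<epsilon> > 0"
  shows "density R q = density R p"
proof -
  have cp: "coupling_density p" using p by (simp add: minimal_density_def)
  note [measurable] = coupling_density_measurable[OF cp] coupling_density_measurable[OF q(1)]
  obtain m where m: "energy \<epsilon> p = ennreal m" "0 \<le> m"
    using minimal_energy_le[OF p] by (cases "energy \<epsilon> p") (auto simp: top_unique)
  let ?I = "\<integral>z. \<bar>p z - q z\<bar> \<partial>R"
  have "?I \<le> 0"
  proof (rule field_le_epsilon)
    fix e :: real assume e: "e > 0"
    have "energy \<epsilon> p + ennreal (\<epsilon> * (e/2) * ?I) \<le> energy \<epsilon> p + ennreal (2 * \<epsilon> * (e/2)\<^sup>2)"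
      using e by (intro order_trans[OF energy_gap[OF p q(1) \<epsilon>]] add_right_mono q) simp
    then have "ennreal (\<epsilon> * (e/2) * ?I) \<le> ennreal (2 * \<epsilon> * (e/2)\<^sup>2)"
      unfolding m(1) by (simp add: ennreal_add_left_cancel_le)
    then have "\<epsilon> * (e/2) * ?I \<le> 2 * \<epsilon> * (e/2)\<^sup>2" using \<epsilon> by (subst (asm) ennreal_le_iff) auto
    also have "\<dots> = \<epsilon> * (e/2) * e" by (simp add: power2_eq_square)
    finally show "?I \<le> 0 + e" using \<epsilon> e by (simp add: mult_le_cancel_left_pos)
  qed
  then have "?I = 0" by (intro antisym Bochner_Integration.integral_nonneg) auto
  then have "AE z in R. \<bar>p z - q z\<bar> = 0"
    using coupling_densityD(1)[OF cp] coupling_densityD(1)[OF q(1)]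
    by (subst (asm) integral_nonneg_eq_0_iff_AE) auto
  then show ?thesis by (intro density_cong) auto
qed

lemma enn2ereal_minus_less_iff: "enn2ereal x - ereal c < enn2ereal y - ereal c \<longleftrightarrow> x < y"
  by (cases x; cases y) (auto simp: ennreal_less_iff)

lemma entropic_minimiser_density:
  assumes \<epsilon>: "\<epsilon> > 0"
  obtains p where "minimal_density \<epsilon> p" "entropic_minimiser \<mu> \<nu> C \<epsilon> = density R p"
proof -
  obtain p where "coupling_density p" "\<And>q. coupling_density q \<Longrightarrow> energy \<epsilon> p \<le> energy \<epsilon> q"
    using energy_minimiser_exists[OF \<epsilon>] by blast
  then have p: "minimal_density \<epsilon> p" by (simp add: minimal_density_def)
  have cp: "coupling_density p" using p by (simp add: minimal_density_def)
  have in_couplings: "density R q \<in> couplings \<mu> \<nu>" if "coupling_density q" for q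
    using coupling_density_iff[OF coupling_densityD(3,2)[OF that]] that by simp
  have fin: "entropic_cost \<mu> \<nu> C \<epsilon> (density R p) < \<infinity>"
    using minimal_energy_le[OF p] unfolding entropic_cost_density[OF cp \<epsilon>]
    by (cases "energy \<epsilon> p") (auto simp: top_unique)
  have "entropic_minimiser \<mu> \<nu> C \<epsilon> = density R p"
    unfolding entropic_minimiser_def
  proof (rule the_equality)
    show "is_arg_min (entropic_cost \<mu> \<nu> C \<epsilon>) (\<lambda>\<rho>. \<rho> \<in> couplings \<mu> \<nu>) (density R p)"
      unfolding is_arg_min_def
    proof (intro conjI notI in_couplings[OF cp])
      assume "\<exists>\<rho>. \<rho> \<in> couplings \<mu> \<nu> \<and> entropic_cost \<mu> \<nu> C \<epsilon> \<rho> < entropic_cost \<mu> \<nu> C \<epsilon> (density R p)"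
      then obtain \<rho> where \<rho>: "\<rho> \<in> couplings \<mu> \<nu>" "entropic_cost \<mu> \<nu> C \<epsilon> \<rho> < entropic_cost \<mu> \<nu> C \<epsilon> (density R p)" by blast
      then have "absolutely_continuous R \<rho>" using entropic_cost_singular[OF \<rho>(1) _ \<epsilon>] by force
      then obtain q where q: "coupling_density q" "\<rho> = density R q" using coupling_has_density[OF \<rho>(1)] by blast
      with \<rho>(2) have "energy \<epsilon> q < energy \<epsilon> p"
        by (simp add: entropic_cost_density[OF _ \<epsilon>] cp enn2ereal_minus_less_iff)
      with p q(1) show False by (simp add: minimal_density_def leD)
    qed
  next
    fix \<rho> assume "is_arg_min (entropic_cost \<mu> \<nu> C \<epsilon>) (\<lambda>\<rho>. \<rho> \<in> couplings \<mu> \<nu>) \<rho>"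
    then have \<rho>: "\<rho> \<in> couplings \<mu> \<nu>" and le: "\<not> entropic_cost \<mu> \<nu> C \<epsilon> (density R p) < entropic_cost \<mu> \<nu> C \<epsilon> \<rho>"
      using in_couplings[OF cp] by (auto simp: is_arg_min_def)
    have "absolutely_continuous R \<rho>" using entropic_cost_singular[OF \<rho> _ \<epsilon>] le fin by force
    then obtain q where q: "coupling_density q" "\<rho> = density R q" using coupling_has_density[OF \<rho>] by blast
    with le have "energy \<epsilon> q \<le> energy \<epsilon> p"
      by (simp add: entropic_cost_density[OF _ \<epsilon>] cp enn2ereal_minus_less_iff)
    with minimal_density_unique[OF p q(1) _ \<epsilon>] q(2) show "\<rho> = density R p" by simp
  qed
  with p show thesis by (rule that)
qed

lemma energy_split:
  assumes p: "coupling_density p" and fin: "energy \<epsilon> p < \<infinity>" and \<epsilon>: "\<epsilon> > 0"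
  shows "integrable R (\<lambda>z. D z * p z)" "integrable R (\<lambda>z. ent (p z))"
    "\<And>\<epsilon>'. \<epsilon>' \<ge> 0 \<Longrightarrow> energy \<epsilon>' p = ennreal ((\<integral>z. D z * p z \<partial>R) + \<epsilon>' * (\<integral>z. ent (p z) \<partial>R))"
proof -
  note [measurable] = coupling_density_measurable[OF p]
  have nn: "0 \<le> D z * p z" "0 \<le> ent (p z)" for z
    using D_nonneg coupling_densityD(2)[OF p] ent_nonneg by auto
  have f: "integrable R (\<lambda>z. D z * p z + \<epsilon> * ent (p z))"
    by (rule integrableI_nonneg) (use fin nn \<epsilon> in \<open>auto simp: energy_def\<close>)
  show 1: "integrable R (\<lambda>z. D z * p z)"
    by (rule Bochner_Integration.integrable_bound[OF f]) (use nn \<epsilon> in \<open>auto intro!: AE_I2\<close>)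
  from Bochner_Integration.integrable_diff[OF f 1] have "integrable R (\<lambda>z. \<epsilon> * ent (p z))" by simp
  then show 2: "integrable R (\<lambda>z. ent (p z))" using \<epsilon> by simp
  fix \<epsilon>' :: real assume "\<epsilon>' \<ge> 0"
  then have "energy \<epsilon>' p = ennreal (\<integral>z. D z * p z + \<epsilon>' * ent (p z) \<partial>R)"
    unfolding energy_def using 1 2 nn by (intro nn_integral_eq_integral) auto
  also have "(\<integral>z. D z * p z + \<epsilon>' * ent (p z) \<partial>R) = (\<integral>z. D z * p z \<partial>R) + \<epsilon>' * (\<integral>z. ent (p z) \<partial>R)"
    using 1 2 by simp
  finally show "energy \<epsilon>' p = ennreal ((\<integral>z. D z * p z \<partial>R) + \<epsilon>' * (\<integral>z. ent (p z) \<partial>R))" .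
qed

text \<open>Test the minimality of \<open>p\<close> at \<open>\<epsilon>\<close> with \<open>q\<close>, and that of \<open>q\<close> at \<open>\<epsilon>'\<close> with \<open>p\<close>, and add; the first
  test is \<open>energy_gap\<close>, which brings in the \<open>L\<^sup>1\<close> distance. The costs cancel, and a multiple \<open>\<epsilon>' - \<epsilon>\<close> of the difference of the entropies remains. The product coupling has
  entropy \<open>0\<close>, which bounds the entropy of a minimiser by the cost of \<open>R\<close> divided by the parameter.\<close>

lemma minimal_density_perturbation:
  assumes p: "minimal_density \<epsilon> p" and q: "minimal_density \<epsilon>' q" and \<epsilon>: "\<epsilon> > 0" "\<epsilon>' > 0" and t: "t > 0"
  shows "\<epsilon> * t * (\<integral>z. \<bar>p z - q z\<bar> \<partial>R) \<le> \<bar>\<epsilon>' - \<epsilon>\<bar> * ((\<integral>z. D z \<partial>R) / \<epsilon> + (\<integral>z. D z \<partial>R) / \<epsilon>') + 2 * \<epsilon> * t\<^sup>2"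
proof -
  have cp: "coupling_density p" and cq: "coupling_density q" using p q by (simp_all add: minimal_density_def)
  have fp: "energy \<epsilon> p < \<infinity>" and fq: "energy \<epsilon>' q < \<infinity>"
    using minimal_energy_le[OF p] minimal_energy_le[OF q] by (auto intro: le_less_trans)
  note sp = energy_split[OF cp fp \<epsilon>(1)] and sq = energy_split[OF cq fq \<epsilon>(2)]
  define Jp Jq Hp Hq where "Jp = (\<integral>z. D z * p z \<partial>R)" and "Jq = (\<integral>z. D z * q z \<partial>R)"
    and "Hp = (\<integral>z. ent (p z) \<partial>R)" and "Hq = (\<integral>z. ent (q z) \<partial>R)"
  have nn: "0 \<le> Jp" "0 \<le> Jq" "0 \<le> Hp" "0 \<le> Hq"
    unfolding Jp_def Jq_def Hp_def Hq_def
    using D_nonneg coupling_densityD(2)[OF cp] coupling_densityD(2)[OF cq] ent_nonneg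
    by (auto intro!: Bochner_Integration.integral_nonneg)
  have e: "energy s p = ennreal (Jp + s * Hp)" "energy s q = ennreal (Jq + s * Hq)" if "s > 0" for s
    using sp(3)[of s] sq(3)[of s] that by (simp_all add: Jp_def Jq_def Hp_def Hq_def)
  let ?M = "\<integral>z. D z \<partial>R"
  have M0: "0 \<le> ?M" using D_nonneg by (intro Bochner_Integration.integral_nonneg)
  have "Jp + \<epsilon> * Hp \<le> ?M" using minimal_energy_le[OF p] M0 unfolding e[OF \<epsilon>(1)] by (simp add: ennreal_le_iff)
  with nn(1) have "\<epsilon> * Hp \<le> ?M" by linarith
  then have Hp: "Hp \<le> ?M / \<epsilon>" using \<epsilon> by (simp add: field_simps)
  have "Jq + \<epsilon>' * Hq \<le> ?M" using minimal_energy_le[OF q] M0 unfolding e[OF \<epsilon>(2)] by (simp add: ennreal_le_iff)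
  with nn(2) have "\<epsilon>' * Hq \<le> ?M" by linarith
  then have Hq: "Hq \<le> ?M / \<epsilon>'" using \<epsilon> by (simp add: field_simps)
  let ?I = "\<integral>z. \<bar>p z - q z\<bar> \<partial>R"
  have I0: "0 \<le> ?I" by (intro Bochner_Integration.integral_nonneg) auto
  have "energy \<epsilon> p + ennreal (\<epsilon> * t * ?I) \<le> energy \<epsilon> q + ennreal (2 * \<epsilon> * t\<^sup>2)"
    using t by (intro energy_gap[OF p cq \<epsilon>(1)]) simp
  then have "ennreal (Jp + \<epsilon> * Hp + \<epsilon> * t * ?I) \<le> ennreal (Jq + \<epsilon> * Hq + 2 * \<epsilon> * t\<^sup>2)"
    unfolding e[OF \<epsilon>(1)] using nn \<epsilon> t I0 by (subst ennreal_plus, simp, simp, subst ennreal_plus) auto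
  then have 1: "Jp + \<epsilon> * Hp + \<epsilon> * t * ?I \<le> Jq + \<epsilon> * Hq + 2 * \<epsilon> * t\<^sup>2"
    using nn \<epsilon> by (subst (asm) ennreal_le_iff) auto
  have "energy \<epsilon>' q \<le> energy \<epsilon>' p" using q cp by (simp add: minimal_density_def)
  then have 2: "Jq + \<epsilon>' * Hq \<le> Jp + \<epsilon>' * Hp"
    unfolding e[OF \<epsilon>(2)] using nn \<epsilon> by (subst (asm) ennreal_le_iff) auto
  have "(\<epsilon>' - \<epsilon>) * (Hp - Hq) \<le> \<bar>\<epsilon>' - \<epsilon>\<bar> * \<bar>Hp - Hq\<bar>" by (metis abs_ge_self abs_mult)
  also have "\<dots> \<le> \<bar>\<epsilon>' - \<epsilon>\<bar> * (?M / \<epsilon> + ?M / \<epsilon>')" using nn Hp Hq by (intro mult_left_mono) auto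
  finally have 3: "(\<epsilon>' - \<epsilon>) * (Hp - Hq) \<le> \<bar>\<epsilon>' - \<epsilon>\<bar> * (?M / \<epsilon> + ?M / \<epsilon>')" .
  have "(\<epsilon>' - \<epsilon>) * (Hp - Hq) = \<epsilon>' * Hp - \<epsilon>' * Hq - \<epsilon> * Hp + \<epsilon> * Hq" by (simp add: algebra_simps)
  with 1 2 3 show ?thesis by linarith
qed

lemma integral_density_diff:
  assumes p: "coupling_density p" and q: "coupling_density q" and f: "f \<in> borel_measurable borel" "\<And>z. \<bar>f z\<bar> \<le> B"
  shows "\<bar>(\<integral>z. f z \<partial>density R p) - (\<integral>z. f z \<partial>density R q)\<bar> \<le> B * (\<integral>z. \<bar>p z - q z\<bar> \<partial>R)"
proof -
  note cp = coupling_densityD[OF p] and cq = coupling_densityD[OF q]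
  note [measurable] = coupling_density_measurable[OF p] coupling_density_measurable[OF q] measurable_R[OF f(1)]
  have int: "integrable R (\<lambda>z. r z * f z)" if "integrable R r" for r
  proof (rule Bochner_Integration.integrable_bound[of _ "\<lambda>z. B * r z"])
    show "(\<lambda>z. r z * f z) \<in> borel_measurable R" using that by auto
    have "norm (r z * f z) \<le> norm (B * r z)" for z
      using mult_left_mono[OF f(2)[of z] abs_ge_zero[of "r z"]] order_trans[OF abs_ge_zero f(2)[of z]]
      by (simp add: abs_mult mult.commute)
    then show "AE z in R. norm (r z * f z) \<le> norm (B * r z)" by simp
  qed (use that in simp)
  have "(\<integral>z. f z \<partial>density R p) = (\<integral>z. p z * f z \<partial>R)" "(\<integral>z. f z \<partial>density R q) = (\<integral>z. q z * f z \<partial>R)"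
    using cp(2) cq(2) by (subst integral_density; simp)+
  then have "(\<integral>z. f z \<partial>density R p) - (\<integral>z. f z \<partial>density R q) = (\<integral>z. p z * f z - q z * f z \<partial>R)"
    using int cp(1) cq(1) by simp
  also have "\<bar>\<dots>\<bar> \<le> (\<integral>z. \<bar>p z * f z - q z * f z\<bar> \<partial>R)"
    using integral_norm_bound[of R "\<lambda>z. p z * f z - q z * f z"] by simp
  also have "\<dots> \<le> (\<integral>z. B * \<bar>p z - q z\<bar> \<partial>R)"
  proof (rule integral_mono)
    show "integrable R (\<lambda>z. \<bar>p z * f z - q z * f z\<bar>)" using int cp(1) cq(1) by simp
    show "integrable R (\<lambda>z. B * \<bar>p z - q z\<bar>)" using cp(1) cq(1) by simp
    fix z
    have "\<bar>p z * f z - q z * f z\<bar> = \<bar>p z - q z\<bar> * \<bar>f z\<bar>" by (simp add: abs_mult flip: left_diff_distrib)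
    also have "\<dots> \<le> \<bar>p z - q z\<bar> * B" by (intro mult_left_mono f) auto
    finally show "\<bar>p z * f z - q z * f z\<bar> \<le> B * \<bar>p z - q z\<bar>" by (simp add: mult.commute)
  qed
  finally show ?thesis by simp
qed

lemma continuous_on_entropic_minimiser:
  fixes f :: "'a \<times> 'b \<Rightarrow> real"
  assumes f: "f \<in> bcontfun"
  shows "continuous_on {0<..} (\<lambda>\<epsilon>. \<integral>z. f z \<partial>entropic_minimiser \<mu> \<nu> C \<epsilon>)"
proof -
  from f obtain B0 where B0: "\<And>z. norm (f z) \<le> B0" and c: "continuous_on UNIV f"
    by (auto simp: bcontfun_def bounded_iff)
  define B where "B = B0 + 1"
  have B: "\<bar>f z\<bar> \<le> B" for z using B0[of z] by (simp add: B_def)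
  have Bpos: "B > 0" using B0[of undefined] norm_ge_zero[of "f undefined"] unfolding B_def by linarith
  have fm: "f \<in> borel_measurable borel" by (rule borel_measurable_continuous_onI[OF c])
  let ?M = "\<integral>z. D z \<partial>R"
  have M0: "0 \<le> ?M" using D_nonneg by (intro Bochner_Integration.integral_nonneg)
  have diff: "\<bar>(\<integral>z. f z \<partial>entropic_minimiser \<mu> \<nu> C \<epsilon>') - (\<integral>z. f z \<partial>entropic_minimiser \<mu> \<nu> C \<epsilon>)\<bar>
      \<le> B * (\<bar>\<epsilon>' - \<epsilon>\<bar> * (?M / \<epsilon> + ?M / \<epsilon>') / (\<epsilon> * t) + 2 * t)"
    if \<epsilon>: "\<epsilon> > 0" "\<epsilon>' > 0" and t: "t > 0" for \<epsilon> \<epsilon>' t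
  proof -
    obtain p where p: "minimal_density \<epsilon> p" "entropic_minimiser \<mu> \<nu> C \<epsilon> = density R p"
      using entropic_minimiser_density[OF \<epsilon>(1)] .
    obtain q where q: "minimal_density \<epsilon>' q" "entropic_minimiser \<mu> \<nu> C \<epsilon>' = density R q"
      using entropic_minimiser_density[OF \<epsilon>(2)] .
    let ?I = "\<integral>z. \<bar>p z - q z\<bar> \<partial>R"
    have "\<epsilon> * t * ?I \<le> \<bar>\<epsilon>' - \<epsilon>\<bar> * (?M / \<epsilon> + ?M / \<epsilon>') + 2 * \<epsilon> * t\<^sup>2"
      by (rule minimal_density_perturbation[OF p(1) q(1) \<epsilon> t])
    then have "?I \<le> (\<bar>\<epsilon>' - \<epsilon>\<bar> * (?M / \<epsilon> + ?M / \<epsilon>') + 2 * \<epsilon> * t\<^sup>2) / (\<epsilon> * t)"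
      using \<epsilon> t by (subst pos_le_divide_eq) (auto simp: mult.commute)
    also have "\<dots> = \<bar>\<epsilon>' - \<epsilon>\<bar> * (?M / \<epsilon> + ?M / \<epsilon>') / (\<epsilon> * t) + 2 * t"
      using \<epsilon> t by (simp add: add_divide_distrib power2_eq_square)
    finally have "B * ?I \<le> B * (\<bar>\<epsilon>' - \<epsilon>\<bar> * (?M / \<epsilon> + ?M / \<epsilon>') / (\<epsilon> * t) + 2 * t)"
      using Bpos by (intro mult_left_mono) auto
    moreover have "\<bar>(\<integral>z. f z \<partial>density R p) - (\<integral>z. f z \<partial>density R q)\<bar> \<le> B * ?I"
      using p q by (intro integral_density_diff fm B) (auto simp: minimal_density_def)
    ultimately show ?thesis unfolding p(2) q(2) by (simp add: abs_minus_commute)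
  qed
  show ?thesis unfolding continuous_on_def
  proof (intro ballI tendstoI)
    fix \<epsilon> e :: real assume "\<epsilon> \<in> {0<..}" and e: "e > 0"
    then have \<epsilon>: "\<epsilon> > 0" by simp
    define t where "t = e / (4 * B)"
    have t: "t > 0" using e Bpos by (simp add: t_def)
    have "((\<lambda>\<epsilon>'. B * (\<bar>\<epsilon>' - \<epsilon>\<bar> * (?M / \<epsilon> + ?M / \<epsilon>') / (\<epsilon> * t) + 2 * t)) \<longlongrightarrow>
        B * (\<bar>\<epsilon> - \<epsilon>\<bar> * (?M / \<epsilon> + ?M / \<epsilon>) / (\<epsilon> * t) + 2 * t)) (at \<epsilon> within {0<..})"
      using \<epsilon> t by (intro tendsto_intros) auto
    moreover have "B * (\<bar>\<epsilon> - \<epsilon>\<bar> * (?M / \<epsilon> + ?M / \<epsilon>) / (\<epsilon> * t) + 2 * t) < e"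
      using e Bpos by (simp add: t_def)
    ultimately have "\<forall>\<^sub>F \<epsilon>' in at \<epsilon> within {0<..}. B * (\<bar>\<epsilon>' - \<epsilon>\<bar> * (?M / \<epsilon> + ?M / \<epsilon>') / (\<epsilon> * t) + 2 * t) < e"
      by (rule order_tendstoD)
    moreover have "\<forall>\<^sub>F \<epsilon>' in at \<epsilon> within {0<..}. \<epsilon>' > 0" by (simp add: eventually_at_filter)
    ultimately show "\<forall>\<^sub>F \<epsilon>' in at \<epsilon> within {0<..}. dist (\<integral>z. f z \<partial>entropic_minimiser \<mu> \<nu> C \<epsilon>')
        (\<integral>z. f z \<partial>entropic_minimiser \<mu> \<nu> C \<epsilon>) < e"
      by eventually_elim (use diff[OF \<epsilon> _ t] in \<open>auto simp: dist_real_def intro: le_less_trans\<close>)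
  qed
qed

lemma entropic_minimiser_coupling:
  assumes "\<epsilon> > 0"
  shows "entropic_minimiser \<mu> \<nu> C \<epsilon> \<in> couplings \<mu> \<nu>"
proof -
  obtain p where p: "minimal_density \<epsilon> p" "entropic_minimiser \<mu> \<nu> C \<epsilon> = density R p"
    using entropic_minimiser_density[OF assms] .
  then have "coupling_density p" by (simp add: minimal_density_def)
  with coupling_density_iff[OF coupling_densityD(3,2)[OF this]] p(2) show ?thesis by simp
qed

end

section \<open>Couplings with a bounded density\<close>

text \<open>The Radon--Nikodym derivative of a measure below \<open>M\<close> is at most \<open>1\<close> almost everywhere, so that
  truncation yields a representative with values in \<open>[0,1]\<close>.\<close>

lemma density_of_dominated_measure:
  assumes M: "finite_measure M" and sets: "sets K = sets M"
    and le: "\<And>A. A \<in> sets M \<Longrightarrow> emeasure K A \<le> emeasure M A"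
  obtains g where "g \<in> borel_measurable M" "\<And>x. 0 \<le> g x \<and> g x \<le> (1::real)"
    "\<And>A. A \<in> sets M \<Longrightarrow> (\<integral>x. g x * indicator A x \<partial>M) = measure K A"
proof -
  interpret finite_measure M by fact
  have ac: "absolutely_continuous M K"
    unfolding absolutely_continuous_def
  proof
    fix A assume "A \<in> null_sets M"
    then show "A \<in> null_sets K" using le[of A] sets by (auto simp: null_sets_def)
  qed
  obtain f where f[measurable]: "f \<in> borel_measurable M" and K: "density M f = K"
    using Radon_Nikodym[OF ac sets] by blast
  have f1: "AE x in M. f x \<le> 1"
  proof (rule ccontr)
    assume neg: "\<not> (AE x in M. f x \<le> 1)"
    define A where "A = {x \<in> space M. 1 < f x}"
    have A[measurable]: "A \<in> sets M" unfolding A_def by measurable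
    have "(\<integral>\<^sup>+x. indicator A x \<partial>M) < (\<integral>\<^sup>+x. f x * indicator A x \<partial>M)"
    proof (rule nn_integral_less)
      show "(\<integral>\<^sup>+x. indicator A x \<partial>M) \<noteq> \<infinity>" using emeasure_finite[of A] by simp
      show "AE x in M. indicator A x \<le> f x * indicator A x" by (auto simp: A_def indicator_def)
      show "\<not> (AE x in M. f x * indicator A x \<le> indicator A x)"
      proof
        assume "AE x in M. f x * indicator A x \<le> indicator A x"
        then have "AE x in M. f x \<le> 1" using AE_space
        proof eventually_elim
          case (elim x)
          then show ?case by (cases "1 < f x") (auto simp: A_def)
        qed
        with neg show False by simp
      qed
    qed measurable
    also have "(\<integral>\<^sup>+x. f x * indicator A x \<partial>M) = emeasure K A" unfolding K[symmetric] by (simp add: emeasure_density)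
    finally show False using le[OF A] by simp
  qed
  define g where "g x = min 1 (enn2real (f x))" for x
  have gm[measurable]: "g \<in> borel_measurable M" unfolding g_def by measurable
  have g: "0 \<le> g x \<and> g x \<le> 1" for x by (simp add: g_def)
  have gf: "AE x in M. ennreal (g x) = f x"
    using f1
  proof eventually_elim
    case (elim x)
    then obtain r where "f x = ennreal r" "0 \<le> r" by (cases "f x") (auto simp: top_unique)
    with elim show ?case by (simp add: g_def)
  qed
  have "(\<integral>x. g x * indicator A x \<partial>M) = measure K A" if A[measurable]: "A \<in> sets M" for A
  proof -
    have "integrable M (\<lambda>x. g x * indicator A x)"
      by (rule integrable_const_bound[of _ 1]) (use g in \<open>auto simp: indicator_def\<close>)
    then have "ennreal (\<integral>x. g x * indicator A x \<partial>M) = (\<integral>\<^sup>+x. ennreal (g x * indicator A x) \<partial>M)"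
      using g by (intro nn_integral_eq_integral[symmetric]) auto
    also have "\<dots> = (\<integral>\<^sup>+x. f x * indicator A x \<partial>M)"
      using gf by (intro nn_integral_cong_AE) (auto simp: indicator_def elim!: eventually_mono)
    also have "\<dots> = emeasure K A" unfolding K[symmetric] by (simp add: emeasure_density)
    finally have "emeasure K A = ennreal (\<integral>x. g x * indicator A x \<partial>M)" by simp
    then show ?thesis using g by (simp add: measure_def integral_nonneg_AE)
  qed
  with gm g show thesis by (rule that)
qed

text \<open>The piece of \<open>\<rho>\<close> on \<open>E\<close> has an image under \<open>h\<close> that lies below the image of \<open>\<rho>\<close>. It is carried by \<open>U\<close>,
  so its density may be taken to vanish off \<open>U\<close>.\<close>

lemma marginal_density_of_piece:
  assumes \<rho>: "\<rho> \<in> borel_probs" and h: "h \<in> measurable borel borel" and \<kappa>: "distr \<rho> borel h = \<kappa>"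
    and E: "E \<in> sets borel" and U: "U \<in> sets borel" "\<And>z. z \<in> E \<Longrightarrow> h z \<in> U"
  obtains g where "g \<in> borel_measurable borel" "\<And>x. 0 \<le> g x \<and> g x \<le> (1::real)" "\<And>x. x \<notin> U \<Longrightarrow> g x = 0"
    "\<And>A. A \<in> sets borel \<Longrightarrow> (\<integral>x. g x * indicator A x \<partial>\<kappa>) = measure \<rho> (E \<inter> {z. h z \<in> A})"
proof -
  interpret P: prob_space \<rho> by (rule borel_probs_prob[OF \<rho>])
  have hm: "h \<in> measurable \<rho> borel" by (rule borel_probs_measurable[OF \<rho> h])
  interpret K: prob_space \<kappa> unfolding \<kappa>[symmetric] by (rule P.prob_space_distr[OF hm])
  have s\<kappa>: "sets \<kappa> = sets borel" unfolding \<kappa>[symmetric] by simp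
  have sp: "space \<rho> = UNIV" by (rule borel_probs_space[OF \<rho>])
  have Em: "E \<in> sets \<rho>" using E borel_probs_sets[OF \<rho>] by simp
  have pre: "{z. h z \<in> A} \<in> sets \<rho>" if "A \<in> sets borel" for A
    using measurable_sets[OF hm that] by (simp add: sp vimage_def)
  define K where "K = distr (density \<rho> (indicator E)) borel h"
  have hd: "h \<in> measurable (density \<rho> (indicator E)) borel" using hm by simp
  have KA: "emeasure K A = emeasure \<rho> (E \<inter> {z. h z \<in> A})" if "A \<in> sets borel" for A
  proof -
    have "emeasure K A = emeasure (density \<rho> (indicator E)) {z. h z \<in> A}"
      unfolding K_def using emeasure_distr[OF hd that] by (simp add: sp vimage_def)
    also have "\<dots> = (\<integral>\<^sup>+z. indicator E z * indicator {z. h z \<in> A} z \<partial>\<rho>)"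
      using Em pre[OF that] by (intro emeasure_density) auto
    also have "\<dots> = (\<integral>\<^sup>+z. indicator (E \<inter> {z. h z \<in> A}) z \<partial>\<rho>)"
      by (intro nn_integral_cong) (auto simp: indicator_def)
    also have "\<dots> = emeasure \<rho> (E \<inter> {z. h z \<in> A})" using Em pre[OF that] by (intro nn_integral_indicator) auto
    finally show ?thesis .
  qed
  have le: "emeasure K A \<le> emeasure \<kappa> A" if "A \<in> sets \<kappa>" for A
  proof -
    have A: "A \<in> sets borel" using that s\<kappa> by simp
    have "emeasure \<kappa> A = emeasure \<rho> {z. h z \<in> A}"
      unfolding \<kappa>[symmetric] using emeasure_distr[OF hm A] by (simp add: sp vimage_def)
    then show ?thesis unfolding KA[OF A] using pre[OF A] by (auto intro: emeasure_mono)
  qed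
  have sK: "sets K = sets \<kappa>" by (simp add: K_def s\<kappa>)
  obtain g0 where g0: "g0 \<in> borel_measurable \<kappa>" "\<And>x. 0 \<le> g0 x \<and> g0 x \<le> (1::real)"
    "\<And>A. A \<in> sets \<kappa> \<Longrightarrow> (\<integral>x. g0 x * indicator A x \<partial>\<kappa>) = measure K A"
    using density_of_dominated_measure[OF K.finite_measure_axioms sK le] by blast
  define g where "g x = g0 x * indicator U x" for x
  have "g0 \<in> borel_measurable borel" using g0(1) by (simp add: measurable_cong_sets[OF s\<kappa> refl])
  then have gm: "g \<in> borel_measurable borel" unfolding g_def using U(1) by simp
  have g: "0 \<le> g x \<and> g x \<le> 1" "x \<notin> U \<Longrightarrow> g x = 0" for x using g0(2) by (auto simp: g_def indicator_def)
  have "(\<integral>x. g x * indicator A x \<partial>\<kappa>) = measure \<rho> (E \<inter> {z. h z \<in> A})" if A: "A \<in> sets borel" for A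
  proof -
    have "(\<integral>x. g x * indicator A x \<partial>\<kappa>) = (\<integral>x. g0 x * indicator (U \<inter> A) x \<partial>\<kappa>)"
      by (simp add: g_def indicator_inter_arith mult.assoc)
    also have "\<dots> = measure K (U \<inter> A)" using A U(1) s\<kappa> by (intro g0(3)) auto
    also have "\<dots> = measure \<rho> (E \<inter> {z. h z \<in> U \<inter> A})" using KA[of "U \<inter> A"] A U(1) by (simp add: measure_def)
    also have "E \<inter> {z. h z \<in> U \<inter> A} = E \<inter> {z. h z \<in> A}" using U(2) by blast
    finally show ?thesis .
  qed
  with gm g show thesis by (intro that)
qed

lemma countable_rectangle_cover_small_oscillation:
  fixes f :: "'a::second_countable_topology \<times> 'b::second_countable_topology \<Rightarrow> real"
  assumes f: "continuous_on UNIV f" and d: "d > 0"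
  obtains U :: "nat \<Rightarrow> 'a set" and V :: "nat \<Rightarrow> 'b set" where
    "\<And>n. open (U n)" "\<And>n. open (V n)" "(\<Union>n. U n \<times> V n) = UNIV"
    "\<And>n z z'. z \<in> U n \<times> V n \<Longrightarrow> z' \<in> U n \<times> V n \<Longrightarrow> f z \<le> f z' + d"
proof -
  define F where "F = {W. \<exists>U V. W = U \<times> V \<and> open U \<and> open V \<and> (\<forall>z\<in>U \<times> V. \<forall>z'\<in>U \<times> V. f z \<le> f z' + d)}"
  have cover: "\<Union>F = UNIV"
  proof (intro set_eqI iffI UNIV_I)
    fix z :: "'a \<times> 'b"
    define O' where "O' = f -` {f z - d / 2 <..< f z + d / 2}"
    have "open O'" unfolding O'_def using f by (intro open_vimage) auto
    moreover have "z \<in> O'" using d by (simp add: O'_def)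
    ultimately obtain U V where UV: "open U" "open V" "z \<in> U \<times> V" "U \<times> V \<subseteq> O'"
      by (rule open_prod_elim)
    have "f x \<le> f y + d" if "x \<in> U \<times> V" "y \<in> U \<times> V" for x y
    proof -
      have "f x < f z + d / 2" "f z - d / 2 < f y" using that UV(4) by (auto simp: O'_def)
      then show ?thesis by linarith
    qed
    then have "U \<times> V \<in> F" unfolding F_def using UV(1,2) by (intro CollectI exI[of _ U] exI[of _ V] conjI ballI refl)
    from UnionI[OF this UV(3)] show "z \<in> \<Union>F" .
  qed
  have "open W" if "W \<in> F" for W using that by (auto simp: F_def intro: open_Times)
  then obtain G where G: "G \<subseteq> F" "countable G" "\<Union>G = \<Union>F" by (rule Lindelof)
  then have ne: "G \<noteq> {}" using cover by auto
  have "\<forall>n. \<exists>U V. from_nat_into G n = U \<times> V \<and> open U \<and> open V \<and> (\<forall>z\<in>U \<times> V. \<forall>z'\<in>U \<times> V. f z \<le> f z' + d)"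
  proof
    fix n
    have "from_nat_into G n \<in> F" using from_nat_into[OF ne] G(1) by blast
    then show "\<exists>U V. from_nat_into G n = U \<times> V \<and> open U \<and> open V \<and> (\<forall>z\<in>U \<times> V. \<forall>z'\<in>U \<times> V. f z \<le> f z' + d)"
      unfolding F_def by (rule CollectD)
  qed
  from choice[OF this] obtain U where "\<forall>n. \<exists>V. from_nat_into G n = U n \<times> V \<and> open (U n) \<and> open V \<and>
    (\<forall>z\<in>U n \<times> V. \<forall>z'\<in>U n \<times> V. f z \<le> f z' + d)" by blast
  from choice[OF this] obtain V where "\<forall>n. from_nat_into G n = U n \<times> V n \<and> open (U n) \<and> open (V n) \<and>
    (\<forall>z\<in>U n \<times> V n. \<forall>z'\<in>U n \<times> V n. f z \<le> f z' + d)" by blast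
  then have UV: "\<And>n. from_nat_into G n = U n \<times> V n" "\<And>n. open (U n)" "\<And>n. open (V n)"
    "\<And>n z z'. z \<in> U n \<times> V n \<Longrightarrow> z' \<in> U n \<times> V n \<Longrightarrow> f z \<le> f z' + d" by blast+
  have "(\<Union>n. U n \<times> V n) = \<Union>(range (from_nat_into G))" by (simp add: UV(1))
  then have "(\<Union>n. U n \<times> V n) = UNIV"
    unfolding range_from_nat_into[OF ne G(2)] using G(3) cover by simp
  from that[OF UV(2,3) this UV(4)] show thesis .
qed

context entropic_problem begin

lemma integrable_product:
  fixes f :: "'a \<Rightarrow> real" and k :: "'b \<Rightarrow> real"
  assumes f: "f \<in> borel_measurable borel" "\<And>x. \<bar>f x\<bar> \<le> a" and k: "k \<in> borel_measurable borel" "\<And>y. \<bar>k y\<bar> \<le> c"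
    and F: "integrable R F"
  shows "integrable R (\<lambda>z. F z * (f (fst z) * k (snd z)))"
proof -
  have m: "f \<in> borel_measurable \<mu>" "k \<in> borel_measurable \<nu>"
    by (rule borel_probs_measurable[OF \<mu> f(1)], rule borel_probs_measurable[OF \<nu> k(1)])
  note [measurable] = m
  have a0: "0 \<le> a" using order_trans[OF abs_ge_zero f(2)] .
  show ?thesis
  proof (rule Bochner_Integration.integrable_bound[of _ "\<lambda>z. a * c * F z"])
    have "(\<lambda>z. f (fst z) * k (snd z)) \<in> borel_measurable R" by measurable
    then show "(\<lambda>z. F z * (f (fst z) * k (snd z))) \<in> borel_measurable R" using F by auto
    have "norm (F z * (f (fst z) * k (snd z))) \<le> norm (a * c * F z)" for z
    proof -
      have "\<bar>f (fst z)\<bar> * \<bar>k (snd z)\<bar> \<le> a * c" by (intro mult_mono f k a0) auto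
      from mult_left_mono[OF this abs_ge_zero[of "F z"]] show ?thesis
        using order_trans[OF abs_ge_zero k(2)] a0 by (simp add: abs_mult mult_ac)
    qed
    then show "AE z in R. norm (F z * (f (fst z) * k (snd z))) \<le> norm (a * c * F z)" by simp
  qed (use F in simp)
qed

lemma integral_product:
  fixes f :: "'a \<Rightarrow> real" and k :: "'b \<Rightarrow> real"
  assumes f: "f \<in> borel_measurable borel" "\<And>x. \<bar>f x\<bar> \<le> a" and k: "k \<in> borel_measurable borel" "\<And>y. \<bar>k y\<bar> \<le> c"
  shows "(\<integral>z. f (fst z) * k (snd z) \<partial>R) = (\<integral>x. f x \<partial>\<mu>) * (\<integral>y. k y \<partial>\<nu>)"
proof -
  have "integrable R (\<lambda>z. 1 * (f (fst z) * k (snd z)))"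
    by (rule integrable_product[OF f k]) simp
  then have "integrable R (\<lambda>(x, y). f x * k y)" by (simp add: case_prod_beta')
  from R.integral_fst'[OF this] show ?thesis by (simp add: case_prod_beta')
qed


text \<open>Cut \<open>\<rho>\<close> into pieces on disjoint sets \<open>E j\<close>, each inside a rectangle on which the cost varies by at most
  \<open>\<delta>\<close>. Replacing a piece by the normalised product of its marginals keeps both marginals, stays in the
  rectangle, and raises the cost by at most \<open>\<delta>\<close> times its mass. Only finitely many pieces are
  treated in this way. The rest has small mass \<open>\<eta>\<close>, but the normalised product of its marginals
  could be expensive. Therefore the first \<open>N\<close> pieces are scaled by \<open>1 - \<theta>\<close>, and what is missing
  from the marginals, with densities \<open>a = \<theta> + (1 - \<theta>) g'\<close> and \<open>k = \<theta> + (1 - \<theta>) h'\<close> and mass \<open>s \<ge> \<theta>\<close>, is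
  coupled by its product. Its density with respect to \<open>R\<close> is \<open>a k / s\<close>, whose cost is at most a
  multiple of \<open>\<theta>\<close> plus integrals of the cost over small parts of \<open>R\<close>.\<close>

lemma bounded_coupling_density_near:
  assumes \<rho>: "\<rho> \<in> couplings \<mu> \<nu>" and fin: "(\<integral>\<^sup>+z. ennreal (D z) \<partial>\<rho>) < \<infinity>" and e: "e > 0"
  obtains q B where "coupling_density q" "\<And>z. q z \<le> B" "(\<integral>z. D z * q z \<partial>R) \<le> (\<integral>z. D z \<partial>\<rho>) + e"
proof -
  have \<rho>b: "\<rho> \<in> borel_probs" and dfst: "distr \<rho> borel fst = \<mu>" and dsnd: "distr \<rho> borel snd = \<nu>"
    using \<rho> by (simp_all add: couplings_iff)
  interpret P: prob_space \<rho> by (rule borel_probs_prob[OF \<rho>b])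
  note s\<rho> = borel_probs_sets[OF \<rho>b] and sp\<rho> = borel_probs_space[OF \<rho>b]
  have D\<rho>: "integrable \<rho> D"
    by (rule integrableI_nonneg) (use fin D_nonneg borel_probs_measurable[OF \<rho>b measurable_D] in auto)
  have mfst: "fst \<in> measurable (borel :: ('a \<times> 'b) measure) borel" and msnd: "snd \<in> measurable (borel :: ('a \<times> 'b) measure) borel"
    by (auto intro!: borel_measurable_continuous_onI continuous_intros)
  define M0 where "M0 = (\<integral>z. D z \<partial>R)"
  have M0: "0 \<le> M0" unfolding M0_def using D_nonneg by (intro Bochner_Integration.integral_nonneg)
  define \<delta> where "\<delta> = e / 4"
  define \<theta> where "\<theta> = min (1 / 2) (e / (4 * (M0 + 1)))"
  have \<theta>: "0 < \<theta>" "\<theta> < 1" using e M0 by (auto simp: \<theta>_def)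
  have "\<theta> * M0 \<le> e / (4 * (M0 + 1)) * (M0 + 1)" using M0 e by (intro mult_mono) (auto simp: \<theta>_def)
  also have "\<dots> = e / 4" using M0 by (simp add: divide_simps)
  finally have \<theta>M: "\<theta> * M0 \<le> e / 4" .
  \<comment> \<open>The factor in front of the contribution of small parts of \<open>R\<close>; \<open>\<theta>\<close> is fixed first, then the
    truncation level \<open>m\<close> of the cost, then the number \<open>N\<close> of pieces.\<close>
  define c where "c = 2 + 1 / \<theta>"
  have c: "c > 0" using \<theta> by (simp add: c_def add_pos_pos)
  define T where "T m = (\<integral>z. max 0 (D z - real m) \<partial>R)" for m :: nat
  have Tint: "integrable R (\<lambda>z. max 0 (D z - real m))" for m :: nat
    by (rule Bochner_Integration.integrable_bound[OF integrable_D]) (use D_nonneg in \<open>auto intro!: AE_I2\<close>)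
  have "T \<longlonglongrightarrow> (\<integral>z. 0 \<partial>R)"
    unfolding T_def
  proof (rule integral_dominated_convergence[OF _ _ integrable_D])
    have "(\<lambda>m. max 0 (D z - real m)) \<longlonglongrightarrow> 0" for z
    proof (rule tendsto_eventually, rule eventually_mono[OF eventually_ge_at_top[of "nat \<lceil>D z\<rceil>"]])
      fix m assume "nat \<lceil>D z\<rceil> \<le> m"
      then have "D z \<le> real m" by linarith
      then show "max 0 (D z - real m) = 0" by simp
    qed
    then show "AE z in R. (\<lambda>m. max 0 (D z - real m)) \<longlonglongrightarrow> 0" by simp
    show "AE z in R. norm (max 0 (D z - real m)) \<le> D z" for m using D_nonneg by (intro AE_I2) auto
  qed measurable
  then have "\<forall>\<^sub>F m in sequentially. T m < e / (4 * c)" using e c by (intro order_tendstoD) auto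
  then obtain m where "T m < e / (4 * c)" unfolding eventually_sequentially by blast
  then have Tm: "c * T m \<le> e / 4" using c by (simp add: field_simps)
  obtain U :: "nat \<Rightarrow> 'a set" and V :: "nat \<Rightarrow> 'b set" where
    UV: "\<And>n. open (U n)" "\<And>n. open (V n)" "(\<Union>n. U n \<times> V n) = UNIV"
    and osc: "\<And>n z z'. z \<in> U n \<times> V n \<Longrightarrow> z' \<in> U n \<times> V n \<Longrightarrow> D z \<le> D z' + \<delta>"
    by (rule countable_rectangle_cover_small_oscillation[OF continuous_D, of \<delta>]) (use e in \<open>simp add: \<delta>_def\<close>, blast)
  define E where "E = disjointed (\<lambda>n. U n \<times> V n)"
  have Esub: "E n \<subseteq> U n \<times> V n" for n unfolding E_def by (rule disjointed_subset)
  have Edisj: "disjoint_family E" unfolding E_def by (rule disjoint_family_disjointed)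
  have Eun: "(\<Union>n. E n) = UNIV" unfolding E_def UN_disjointed_eq by (rule UV(3))
  have "range (\<lambda>n. U n \<times> V n) \<subseteq> sets borel" using UV by (auto intro!: borel_open open_Times)
  then have "range E \<subseteq> sets borel" unfolding E_def by (rule sets.range_disjointed_sets)
  then have Em: "E n \<in> sets borel" for n by auto
  then have Em': "E n \<in> sets \<rho>" for n by (simp add: s\<rho>)
  define w where "w n = measure \<rho> (E n)" for n
  define rest where "rest N = UNIV - (\<Union>j<N. E j)" for N
  have rest_m: "rest N \<in> sets borel" for N unfolding rest_def using Em by auto
  have split: "(\<Sum>j<N. measure \<rho> (E j \<inter> S)) + measure \<rho> (rest N \<inter> S) = measure \<rho> S" if S: "S \<in> sets borel" for N S
  proof -
    have "measure \<rho> (\<Union>j<N. E j \<inter> S) = (\<Sum>j<N. measure \<rho> (E j \<inter> S))"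
      using Edisj Em S by (intro P.finite_measure_finite_Union) (auto simp: s\<rho> disjoint_family_on_def)
    moreover have "measure \<rho> ((\<Union>j<N. E j \<inter> S) \<union> (rest N \<inter> S)) = measure \<rho> (\<Union>j<N. E j \<inter> S) + measure \<rho> (rest N \<inter> S)"
      using Em rest_m S by (intro P.finite_measure_Union) (auto simp: s\<rho> rest_def)
    moreover have "(\<Union>j<N. E j \<inter> S) \<union> (rest N \<inter> S) = S" by (auto simp: rest_def)
    ultimately show ?thesis by simp
  qed
  have total: "(\<Sum>j<N. w j) + measure \<rho> (rest N) = 1" for N
    using split[of UNIV N] P.prob_space by (simp add: w_def sp\<rho>)
  have "w sums 1"
    using P.finite_measure_UNION[of E] Em' Edisj P.prob_space unfolding w_def Eun by (auto simp: sp\<rho>)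
  then have "(\<lambda>N. \<Sum>j<N. w j) \<longlonglongrightarrow> 1" by (simp add: sums_def)
  moreover have "1 - e / (4 * c * (real m + 1)) < 1" using e c by simp
  ultimately have "\<forall>\<^sub>F N in sequentially. 1 - e / (4 * c * (real m + 1)) < (\<Sum>j<N. w j)"
    by (rule order_tendstoD)
  then obtain N where N: "1 - e / (4 * c * (real m + 1)) < (\<Sum>j<N. w j)" unfolding eventually_sequentially by blast
  define \<eta> where "\<eta> = measure \<rho> (rest N)"
  have \<eta>0: "0 \<le> \<eta>" by (simp add: \<eta>_def)
  have "\<eta> < e / (4 * c * (real m + 1))" using N total[of N] by (simp add: \<eta>_def)
  then have "\<eta> * (4 * c * (real m + 1)) < e" using c by (simp add: pos_less_divide_eq)
  moreover have "\<eta> * (4 * c * (real m + 1)) = 4 * (c * (real m * \<eta>)) + 4 * (c * \<eta>)" by (simp add: algebra_simps)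
  moreover have "0 \<le> c * \<eta>" using c \<eta>0 by simp
  ultimately have m\<eta>: "c * (real m * \<eta>) \<le> e / 4" by linarith
  have w0: "0 \<le> w j" for j by (simp add: w_def)

  have "\<forall>j. \<exists>g. g \<in> borel_measurable borel \<and> (\<forall>x. 0 \<le> g x \<and> g x \<le> (1::real)) \<and> (\<forall>x. x \<notin> U j \<longrightarrow> g x = 0) \<and>
    (\<forall>A\<in>sets borel. (\<integral>x. g x * indicator A x \<partial>\<mu>) = measure \<rho> (E j \<inter> {z. fst z \<in> A}))"
  proof
    fix j
    have "U j \<in> sets borel" using UV by auto
    moreover have "fst z \<in> U j" if "z \<in> E j" for z using that Esub by force
    ultimately show "\<exists>g. g \<in> borel_measurable borel \<and> (\<forall>x. 0 \<le> g x \<and> g x \<le> (1::real)) \<and> (\<forall>x. x \<notin> U j \<longrightarrow> g x = 0) \<and>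
      (\<forall>A\<in>sets borel. (\<integral>x. g x * indicator A x \<partial>\<mu>) = measure \<rho> (E j \<inter> {z. fst z \<in> A}))"
      by (rule marginal_density_of_piece[OF \<rho>b mfst dfst Em[of j]]) (assumption, rule exI, rule conjI, assumption, auto)
  qed
  from choice[OF this] obtain g where
    g: "\<And>j. g j \<in> borel_measurable borel" "\<And>j x. 0 \<le> g j x \<and> g j x \<le> (1::real)" "\<And>j x. x \<notin> U j \<Longrightarrow> g j x = 0"
    "\<And>j A. A \<in> sets borel \<Longrightarrow> (\<integral>x. g j x * indicator A x \<partial>\<mu>) = measure \<rho> (E j \<inter> {z. fst z \<in> A})" by blast
  have "\<forall>j. \<exists>g. g \<in> borel_measurable borel \<and> (\<forall>x. 0 \<le> g x \<and> g x \<le> (1::real)) \<and> (\<forall>x. x \<notin> V j \<longrightarrow> g x = 0) \<and>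
    (\<forall>A\<in>sets borel. (\<integral>x. g x * indicator A x \<partial>\<nu>) = measure \<rho> (E j \<inter> {z. snd z \<in> A}))"
  proof
    fix j
    have "V j \<in> sets borel" using UV by auto
    moreover have "snd z \<in> V j" if "z \<in> E j" for z using that Esub by force
    ultimately show "\<exists>g. g \<in> borel_measurable borel \<and> (\<forall>x. 0 \<le> g x \<and> g x \<le> (1::real)) \<and> (\<forall>x. x \<notin> V j \<longrightarrow> g x = 0) \<and>
      (\<forall>A\<in>sets borel. (\<integral>x. g x * indicator A x \<partial>\<nu>) = measure \<rho> (E j \<inter> {z. snd z \<in> A}))"
      by (rule marginal_density_of_piece[OF \<rho>b msnd dsnd Em[of j]]) (assumption, rule exI, rule conjI, assumption, auto)
  qed
  from choice[OF this] obtain h where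
    h: "\<And>j. h j \<in> borel_measurable borel" "\<And>j x. 0 \<le> h j x \<and> h j x \<le> (1::real)" "\<And>j x. x \<notin> V j \<Longrightarrow> h j x = 0"
    "\<And>j A. A \<in> sets borel \<Longrightarrow> (\<integral>x. h j x * indicator A x \<partial>\<nu>) = measure \<rho> (E j \<inter> {z. snd z \<in> A})" by blast
  obtain g' where g': "g' \<in> borel_measurable borel" "\<And>x. 0 \<le> g' x \<and> g' x \<le> (1::real)"
    "\<And>A. A \<in> sets borel \<Longrightarrow> (\<integral>x. g' x * indicator A x \<partial>\<mu>) = measure \<rho> (rest N \<inter> {z. fst z \<in> A})"
    by (rule marginal_density_of_piece[OF \<rho>b mfst dfst rest_m, of UNIV N]) (auto intro: that)
  obtain h' where h': "h' \<in> borel_measurable borel" "\<And>x. 0 \<le> h' x \<and> h' x \<le> (1::real)"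
    "\<And>A. A \<in> sets borel \<Longrightarrow> (\<integral>x. h' x * indicator A x \<partial>\<nu>) = measure \<rho> (rest N \<inter> {z. snd z \<in> A})"
    by (rule marginal_density_of_piece[OF \<rho>b msnd dsnd rest_m, of UNIV N]) (auto intro: that)
  have g1: "(\<integral>x. g j x \<partial>\<mu>) = w j" and h1: "(\<integral>x. h j x \<partial>\<nu>) = w j" for j
    using g(4)[of UNIV j] h(4)[of UNIV j] by (simp_all add: w_def)
  have g'1: "(\<integral>x. g' x \<partial>\<mu>) = \<eta>" and h'1: "(\<integral>x. h' x \<partial>\<nu>) = \<eta>"
    using g'(3)[of UNIV] h'(3)[of UNIV] by (simp_all add: \<eta>_def)
  define a where "a x = \<theta> + (1 - \<theta>) * g' x" for x
  define k where "k y = \<theta> + (1 - \<theta>) * h' y" for y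
  define s where "s = \<theta> + (1 - \<theta>) * \<eta>"
  have s: "\<theta> \<le> s" "0 < s" using \<theta> \<eta>0 by (auto simp: s_def intro!: add_pos_nonneg)
  have cv: "0 \<le> \<theta> + (1 - \<theta>) * r" "\<theta> + (1 - \<theta>) * r \<le> 1" "\<theta> + (1 - \<theta>) * r \<le> \<theta> + r" if "0 \<le> r \<and> r \<le> 1" for r
  proof -
    have "0 \<le> (1 - \<theta>) * r" "(1 - \<theta>) * r \<le> (1 - \<theta>) * 1" "0 \<le> \<theta> * r"
      using that \<theta> by (auto intro!: mult_left_mono)
    then show "0 \<le> \<theta> + (1 - \<theta>) * r" "\<theta> + (1 - \<theta>) * r \<le> 1" "\<theta> + (1 - \<theta>) * r \<le> \<theta> + r"
      using \<theta> by (auto simp: algebra_simps)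
  qed
  have am: "a \<in> borel_measurable borel" and km: "k \<in> borel_measurable borel"
    unfolding a_def[abs_def] k_def[abs_def] using g'(1) h'(1) by auto
  have a01: "0 \<le> a x" "a x \<le> 1" "a x \<le> \<theta> + g' x" for x unfolding a_def using cv[OF g'(2)] by auto
  have k01: "0 \<le> k y" "k y \<le> 1" "k y \<le> \<theta> + h' y" for y unfolding k_def using cv[OF h'(2)] by auto
  have a_abs: "\<bar>a x\<bar> \<le> 1" and k_abs: "\<bar>k y\<bar> \<le> 1" and g_abs: "\<bar>g j x\<bar> \<le> 1" and h_abs: "\<bar>h j y\<bar> \<le> 1"
    and g'_abs: "\<bar>g' x\<bar> \<le> 1" and h'_abs: "\<bar>h' y\<bar> \<le> 1" for x y j
    using a01[of x] k01[of y] g(2)[of j x] h(2)[of j y] g'(2)[of x] h'(2)[of y] by auto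
  define q where "q z = (1 - \<theta>) * (\<Sum>j<N. g j (fst z) * h j (snd z) / w j) + a (fst z) * k (snd z) / s" for z
  have gh_int: "integrable R (\<lambda>z. F z * (g j (fst z) * h j (snd z)))"
    and ak_int: "integrable R (\<lambda>z. F z * (a (fst z) * k (snd z)))" if "integrable R F" for F j
    by (rule integrable_product[OF g(1) g_abs h(1) h_abs that], rule integrable_product[OF am a_abs km k_abs that])
  have q_eq: "F z * q z = (1 - \<theta>) * (\<Sum>j<N. F z * (g j (fst z) * h j (snd z)) / w j) + F z * (a (fst z) * k (snd z)) / s" for F z
    by (simp add: q_def distrib_left sum_distrib_left mult.left_commute)
  have q_int: "integrable R (\<lambda>z. F z * q z)" if "integrable R F" for F
    unfolding q_eq using gh_int[OF that] ak_int[OF that] by simp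
  have q_integral: "(\<integral>z. F z * q z \<partial>R) = (1 - \<theta>) * (\<Sum>j<N. (\<integral>z. F z * (g j (fst z) * h j (snd z)) \<partial>R) / w j)
      + (\<integral>z. F z * (a (fst z) * k (snd z)) \<partial>R) / s" if "integrable R F" for F
    unfolding q_eq using gh_int[OF that] ak_int[OF that] by simp
  have q0: "0 \<le> q z" for z
    unfolding q_def using g h w0 a01 k01 s \<theta>
    by (intro add_nonneg_nonneg mult_nonneg_nonneg sum_nonneg divide_nonneg_nonneg) auto

  \<comment> \<open>On the rectangle of \<open>E j\<close> the cost exceeds its average over the piece by at most \<open>\<delta>\<close>.\<close>
  define L where "L j = (\<integral>z. D z * indicator (E j) z \<partial>\<rho>)" for j
  have LI: "integrable \<rho> (\<lambda>z. D z * indicator (E j) z)" for j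
    using Em' D\<rho> by (intro integrable_real_mult_indicator)
  have L0: "0 \<le> L j" for j unfolding L_def using D_nonneg by (intro Bochner_Integration.integral_nonneg) simp
  have piece: "(\<integral>z. D z * (g j (fst z) * h j (snd z)) \<partial>R) / w j \<le> L j + \<delta> * w j" for j
  proof (cases "w j = 0")
    case False
    with w0[of j] have wj: "w j > 0" by simp
    have pt: "D z * w j \<le> L j + \<delta> * w j" if z: "z \<in> U j \<times> V j" for z
    proof -
      have i: "integrable \<rho> (indicator (E j) :: _ \<Rightarrow> real)" using Em' by (simp add: less_top[symmetric])
      have "D z * w j = (\<integral>z'. D z * indicator (E j) z' \<partial>\<rho>)" using Em'[of j] by (simp add: w_def)
      also have "\<dots> \<le> (\<integral>z'. D z' * indicator (E j) z' + \<delta> * indicator (E j) z' \<partial>\<rho>)"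
      proof (rule integral_mono)
        show "D z * indicator (E j) z' \<le> D z' * indicator (E j) z' + \<delta> * indicator (E j) z'" for z'
          using osc[OF z, of z'] Esub[of j] by (auto simp: indicator_def)
      qed (use i LI in auto)
      also have "\<dots> = L j + \<delta> * w j" using i LI Em'[of j] by (simp add: L_def w_def)
      finally show ?thesis .
    qed
    have "(\<integral>z. D z * (g j (fst z) * h j (snd z)) \<partial>R) \<le> (\<integral>z. (L j + \<delta> * w j) / w j * (g j (fst z) * h j (snd z)) \<partial>R)"
    proof (rule integral_mono)
      show "integrable R (\<lambda>z. D z * (g j (fst z) * h j (snd z)))" by (rule gh_int[OF integrable_D])
      show "integrable R (\<lambda>z. (L j + \<delta> * w j) / w j * (g j (fst z) * h j (snd z)))" by (rule gh_int) simp
      fix z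
      show "D z * (g j (fst z) * h j (snd z)) \<le> (L j + \<delta> * w j) / w j * (g j (fst z) * h j (snd z))"
      proof (cases "z \<in> U j \<times> V j")
        case True
        then have "D z \<le> (L j + \<delta> * w j) / w j" using pt[OF True] wj by (simp add: pos_le_divide_eq)
        then show ?thesis using g h by (intro mult_right_mono mult_nonneg_nonneg) auto
      next
        case False
        then have zero: "g j (fst z) * h j (snd z) = 0" using g(3) h(3) by (cases z) auto
        show ?thesis unfolding zero by simp
      qed
    qed
    also have "\<dots> = (L j + \<delta> * w j) / w j * (w j * w j)"
      using integral_product[OF g(1) g_abs h(1) h_abs, of j j] by (simp add: g1 h1)
    also have "\<dots> = (L j + \<delta> * w j) * w j" using wj by simp
    finally show ?thesis using wj by (simp add: pos_divide_le_eq)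
  qed (use L0 in simp)
  have sumL: "(\<Sum>j<N. L j) \<le> (\<integral>z. D z \<partial>\<rho>)"
  proof -
    have "(\<Sum>j<N. L j) = (\<integral>z. (\<Sum>j<N. D z * indicator (E j) z) \<partial>\<rho>)"
      unfolding L_def by (rule Bochner_Integration.integral_sum[symmetric]) (rule LI)
    also have "\<dots> \<le> (\<integral>z. D z \<partial>\<rho>)"
    proof (rule integral_mono[OF _ D\<rho>])
      fix z
      have "(\<Sum>j<N. indicator (E j) z) = (indicator (\<Union>j<N. E j) z :: real)"
        using Edisj by (intro indicator_UN_disjoint[symmetric]) (auto simp: disjoint_family_on_def)
      then have "(\<Sum>j<N. indicator (E j) z) \<le> (1 :: real)" by simp
      from mult_left_mono[OF this D_nonneg[of z]]
      show "(\<Sum>j<N. D z * indicator (E j) z) \<le> D z" unfolding sum_distrib_left by simp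
    qed (intro Bochner_Integration.integrable_sum LI)
    finally show ?thesis .
  qed
  have "(\<Sum>j<N. w j) \<le> 1" using total[of N] \<eta>0 unfolding \<eta>_def by linarith
  then have "\<delta> * (\<Sum>j<N. w j) \<le> \<delta> * 1" using e by (intro mult_left_mono) (auto simp: \<delta>_def)
  then have "(\<Sum>j<N. \<delta> * w j) \<le> \<delta>" by (simp add: sum_distrib_left)
  with sumL have sum_pieces: "(\<Sum>j<N. L j + \<delta> * w j) \<le> (\<integral>z. D z \<partial>\<rho>) + \<delta>" by (simp add: sum.distrib)
  have pieces0: "0 \<le> (\<Sum>j<N. L j + \<delta> * w j)" using L0 w0 e by (intro sum_nonneg) (simp add: \<delta>_def)
  have "(\<Sum>j<N. (\<integral>z. D z * (g j (fst z) * h j (snd z)) \<partial>R) / w j) \<le> (\<Sum>j<N. L j + \<delta> * w j)"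
    by (intro sum_mono piece)
  then have "(1 - \<theta>) * (\<Sum>j<N. (\<integral>z. D z * (g j (fst z) * h j (snd z)) \<partial>R) / w j) \<le> (1 - \<theta>) * (\<Sum>j<N. L j + \<delta> * w j)"
    using \<theta> by (intro mult_left_mono) auto
  also have "\<dots> \<le> 1 * (\<Sum>j<N. L j + \<delta> * w j)" using \<theta> pieces0 by (intro mult_right_mono) auto
  finally have cost1: "(1 - \<theta>) * (\<Sum>j<N. (\<integral>z. D z * (g j (fst z) * h j (snd z)) \<partial>R) / w j) \<le> (\<integral>z. D z \<partial>\<rho>) + \<delta>"
    using sum_pieces by linarith

  \<comment> \<open>A function with values in \<open>[0,1]\<close> and integral \<open>\<eta>\<close> picks up at most the tail of the cost above
    level \<open>m\<close>, plus \<open>m \<eta>\<close>.\<close>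
  define X where "X = T m + real m * \<eta>"
  have tail: "(\<integral>z. D z * f z \<partial>R) \<le> X" and tail_int: "integrable R (\<lambda>z. D z * f z)"
    if f: "integrable R f" "\<And>z. 0 \<le> f z \<and> f z \<le> 1" "(\<integral>z. f z \<partial>R) = \<eta>" for f
  proof -
    show i: "integrable R (\<lambda>z. D z * f z)"
    proof (rule Bochner_Integration.integrable_bound[OF integrable_D])
      show "(\<lambda>z. D z * f z) \<in> borel_measurable R" using f(1) by auto
      have "norm (D z * f z) \<le> norm (D z)" for z
        using mult_left_mono[of "f z" 1 "D z"] f(2)[of z] D_nonneg[of z] by simp
      then show "AE z in R. norm (D z * f z) \<le> norm (D z)" by simp
    qed
    have "(\<integral>z. D z * f z \<partial>R) \<le> (\<integral>z. max 0 (D z - real m) + real m * f z \<partial>R)"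
    proof (rule integral_mono[OF i])
      show "integrable R (\<lambda>z. max 0 (D z - real m) + real m * f z)" using Tint f(1) by simp
      fix z
      have "(D z - real m) * f z \<le> max 0 (D z - real m) * f z" using f(2)[of z] by (intro mult_right_mono) auto
      also have "\<dots> \<le> max 0 (D z - real m) * 1" using f(2)[of z] by (intro mult_left_mono) auto
      finally show "D z * f z \<le> max 0 (D z - real m) + real m * f z" by (simp add: left_diff_distrib)
    qed
    also have "\<dots> = X" using Tint f by (simp add: X_def T_def)
    finally show "(\<integral>z. D z * f z \<partial>R) \<le> X" .
  qed
  have g'i: "integrable R (\<lambda>z. g' (fst z))" "(\<integral>z. g' (fst z) \<partial>R) = \<eta>"
    using integrable_product[OF g'(1) g'_abs, of "\<lambda>_. 1" 1 "\<lambda>_. 1"] integral_product[OF g'(1) g'_abs, of "\<lambda>_. 1" 1]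
    by (simp_all add: g'1 N.prob_space)
  have h'i: "integrable R (\<lambda>z. h' (snd z))" "(\<integral>z. h' (snd z) \<partial>R) = \<eta>"
    using integrable_product[OF _ _ h'(1) h'_abs, of "\<lambda>_. 1" 1 "\<lambda>_. 1"] integral_product[OF _ _ h'(1) h'_abs, of "\<lambda>_. 1" 1]
    by (simp_all add: h'1 M.prob_space)
  note tg = tail[OF g'i(1) g'(2) g'i(2)] tail_int[OF g'i(1) g'(2) g'i(2)]
  note th = tail[OF h'i(1) h'(2) h'i(2)] tail_int[OF h'i(1) h'(2) h'i(2)]
  have "(\<integral>z. D z * (a (fst z) * k (snd z)) \<partial>R) \<le>
      (\<integral>z. \<theta>\<^sup>2 * D z + (\<theta> + 1) * (D z * g' (fst z)) + \<theta> * (D z * h' (snd z)) \<partial>R)"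
  proof (rule integral_mono)
    show "integrable R (\<lambda>z. D z * (a (fst z) * k (snd z)))" by (rule ak_int[OF integrable_D])
    show "integrable R (\<lambda>z. \<theta>\<^sup>2 * D z + (\<theta> + 1) * (D z * g' (fst z)) + \<theta> * (D z * h' (snd z)))"
      using integrable_D tg(2) th(2) by simp
    fix z
    have "a (fst z) * k (snd z) \<le> (\<theta> + g' (fst z)) * (\<theta> + h' (snd z))"
      using a01 k01 g'(2) h'(2) \<theta> by (intro mult_mono) (auto simp: add_nonneg_nonneg)
    also have "\<dots> = \<theta>\<^sup>2 + \<theta> * g' (fst z) + \<theta> * h' (snd z) + g' (fst z) * h' (snd z)"
      by (simp add: power2_eq_square algebra_simps)
    also have "\<dots> \<le> \<theta>\<^sup>2 + \<theta> * g' (fst z) + \<theta> * h' (snd z) + g' (fst z) * 1"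
      using g'(2)[of "fst z"] h'(2)[of "snd z"] by (intro add_left_mono mult_left_mono) auto
    finally have "D z * (a (fst z) * k (snd z)) \<le> D z * (\<theta>\<^sup>2 + \<theta> * g' (fst z) + \<theta> * h' (snd z) + g' (fst z) * 1)"
      using D_nonneg by (intro mult_left_mono)
    then show "D z * (a (fst z) * k (snd z)) \<le> \<theta>\<^sup>2 * D z + (\<theta> + 1) * (D z * g' (fst z)) + \<theta> * (D z * h' (snd z))"
      by (simp add: algebra_simps)
  qed
  also have "\<dots> = \<theta>\<^sup>2 * M0 + (\<theta> + 1) * (\<integral>z. D z * g' (fst z) \<partial>R) + \<theta> * (\<integral>z. D z * h' (snd z) \<partial>R)"
    using integrable_D tg(2) th(2) by (simp add: M0_def)
  also have "\<dots> \<le> \<theta>\<^sup>2 * M0 + (\<theta> + 1) * X + \<theta> * X"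
    using tg(1) th(1) \<theta> by (intro add_mono mult_left_mono) auto
  also have "\<dots> = \<theta> * (\<theta> * M0 + c * X)" using \<theta> by (simp add: c_def power2_eq_square field_simps)
  finally have 1: "(\<integral>z. D z * (a (fst z) * k (snd z)) \<partial>R) \<le> \<theta> * (\<theta> * M0 + c * X)" .
  have "0 \<le> T m" unfolding T_def by (intro Bochner_Integration.integral_nonneg) simp
  then have X0: "0 \<le> X" using \<eta>0 by (simp add: X_def)
  have "\<theta> * (\<theta> * M0 + c * X) \<le> s * (\<theta> * M0 + c * X)"
    using s M0 c X0 \<theta> by (intro mult_right_mono) auto
  with 1 have cost2: "(\<integral>z. D z * (a (fst z) * k (snd z)) \<partial>R) / s \<le> \<theta> * M0 + c * X"
    using s by (simp add: pos_divide_le_eq mult.commute)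
  have "c * X \<le> e / 4 + e / 4" using Tm m\<eta> by (simp add: X_def distrib_left)
  with cost1 cost2 \<theta>M have cost: "(\<integral>z. D z * q z \<partial>R) \<le> (\<integral>z. D z \<partial>\<rho>) + e"
    unfolding q_integral[OF integrable_D] by (simp add: \<delta>_def)

  \<comment> \<open>Pieces of mass \<open>0\<close> contribute nothing, in agreement with division by zero being zero.\<close>
  have cancel: "measure \<rho> (E j \<inter> S) * w j / w j = measure \<rho> (E j \<inter> S)" for j S
  proof (cases "w j = 0")
    case True
    have "measure \<rho> (E j \<inter> S) \<le> w j" unfolding w_def using Em' by (intro P.finite_measure_mono) auto
    with True show ?thesis by (simp add: measure_le_0_iff)
  qed simp
  have fst_marginal: "(\<integral>z. q z * indicator A (fst z) \<partial>R) = measure \<mu> A" if A: "A \<in> sets borel" for A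
  proof -
    let ?S = "{z :: 'a \<times> 'b. fst z \<in> A}"
    have ind: "(\<lambda>x. f x * indicator A x) \<in> borel_measurable borel" "\<bar>f x * indicator A x\<bar> \<le> 1"
      if "f \<in> borel_measurable borel" "\<And>x. \<bar>f x\<bar> \<le> (1::real)" for f x
      using that A by (auto simp: indicator_def)
    have IA: "integrable R (\<lambda>z. indicator A (fst z) :: real)"
      using integrable_product[of "indicator A" 1 "\<lambda>_. 1" 1 "\<lambda>_. 1"] A by (simp add: indicator_def)
    have 1: "(\<integral>z. indicator A (fst z) * (g j (fst z) * h j (snd z)) \<partial>R) = measure \<rho> (E j \<inter> ?S) * w j" for j
      using integral_product[OF ind(1)[OF g(1) g_abs] ind(2)[OF g(1) g_abs] h(1) h_abs, of j j] g(4)[OF A, of j]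
      by (simp add: h1 mult_ac)
    have ga: "integrable \<mu> (\<lambda>x. g' x * indicator A x)"
      by (rule borel_probs_integrable[OF \<mu> ind(1)[OF g'(1) g'_abs] ind(2)[OF g'(1) g'_abs]])
    have iA: "integrable \<mu> (indicator A :: 'a \<Rightarrow> real)" "(\<integral>x. indicator A x \<partial>\<mu>) = measure \<mu> A"
      using A borel_probs_sets[OF \<mu>] borel_probs_space[OF \<mu>] by (auto simp: less_top[symmetric])
    have "(\<integral>x. a x * indicator A x \<partial>\<mu>) = (\<integral>x. \<theta> * indicator A x + (1 - \<theta>) * (g' x * indicator A x) \<partial>\<mu>)"
      by (simp add: a_def algebra_simps)
    also have "\<dots> = \<theta> * measure \<mu> A + (1 - \<theta>) * measure \<rho> (rest N \<inter> ?S)"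
      using ga iA by (simp add: g'(3)[OF A])
    finally have aA: "(\<integral>x. a x * indicator A x \<partial>\<mu>) = \<theta> * measure \<mu> A + (1 - \<theta>) * measure \<rho> (rest N \<inter> ?S)" .
    have "integrable \<nu> h'" by (rule borel_probs_integrable[OF \<nu> h'(1) h'_abs])
    then have "(\<integral>y. k y \<partial>\<nu>) = s" by (simp add: k_def s_def h'1 N.prob_space)
    then have 2: "(\<integral>z. indicator A (fst z) * (a (fst z) * k (snd z)) \<partial>R) = (\<theta> * measure \<mu> A + (1 - \<theta>) * measure \<rho> (rest N \<inter> ?S)) * s"
      using integral_product[OF ind(1)[OF am a_abs] ind(2)[OF am a_abs] km k_abs] by (simp add: aA mult_ac)
    have S: "?S \<in> sets borel" by (rule vimage_sets(1)[OF A])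
    have "measure \<rho> ?S = measure \<mu> A"
      using measure_distr[of fst \<rho> borel A] borel_probs_measurable[OF \<rho>b mfst] A dfst by (simp add: sp\<rho> vimage_def)
    with split[OF S, of N] have sum: "(\<Sum>j<N. measure \<rho> (E j \<inter> ?S)) + measure \<rho> (rest N \<inter> ?S) = measure \<mu> A" by simp
    have "(\<integral>z. q z * indicator A (fst z) \<partial>R) = (\<integral>z. indicator A (fst z) * q z \<partial>R)" by (simp add: mult.commute)
    also have "\<dots> = (1 - \<theta>) * (\<Sum>j<N. measure \<rho> (E j \<inter> ?S)) + (\<theta> * measure \<mu> A + (1 - \<theta>) * measure \<rho> (rest N \<inter> ?S))"
      unfolding q_integral[OF IA] 1 2 cancel using s by simp
    also have "\<dots> = (1 - \<theta>) * ((\<Sum>j<N. measure \<rho> (E j \<inter> ?S)) + measure \<rho> (rest N \<inter> ?S)) + \<theta> * measure \<mu> A"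
      by (simp only: distrib_left)
    also have "\<dots> = measure \<mu> A" unfolding sum by (simp add: left_diff_distrib)
    finally show ?thesis .
  qed
  have snd_marginal: "(\<integral>z. q z * indicator A (snd z) \<partial>R) = measure \<nu> A" if A: "A \<in> sets borel" for A
  proof -
    let ?S = "{z :: 'a \<times> 'b. snd z \<in> A}"
    have ind: "(\<lambda>x. f x * indicator A x) \<in> borel_measurable borel" "\<bar>f x * indicator A x\<bar> \<le> 1"
      if "f \<in> borel_measurable borel" "\<And>x. \<bar>f x\<bar> \<le> (1::real)" for f x
      using that A by (auto simp: indicator_def)
    have IA: "integrable R (\<lambda>z. indicator A (snd z) :: real)"
      using integrable_product[of "\<lambda>_. 1" 1 "indicator A" 1 "\<lambda>_. 1"] A by (simp add: indicator_def)
    have 1: "(\<integral>z. indicator A (snd z) * (g j (fst z) * h j (snd z)) \<partial>R) = w j * measure \<rho> (E j \<inter> ?S)" for j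
      using integral_product[OF g(1) g_abs ind(1)[OF h(1) h_abs] ind(2)[OF h(1) h_abs], of j j] h(4)[OF A, of j]
      by (simp add: g1 mult_ac)
    have ha: "integrable \<nu> (\<lambda>x. h' x * indicator A x)"
      by (rule borel_probs_integrable[OF \<nu> ind(1)[OF h'(1) h'_abs] ind(2)[OF h'(1) h'_abs]])
    have iA: "integrable \<nu> (indicator A :: 'b \<Rightarrow> real)" "(\<integral>x. indicator A x \<partial>\<nu>) = measure \<nu> A"
      using A borel_probs_sets[OF \<nu>] borel_probs_space[OF \<nu>] by (auto simp: less_top[symmetric])
    have "(\<integral>x. k x * indicator A x \<partial>\<nu>) = (\<integral>x. \<theta> * indicator A x + (1 - \<theta>) * (h' x * indicator A x) \<partial>\<nu>)"
      by (simp add: k_def algebra_simps)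
    also have "\<dots> = \<theta> * measure \<nu> A + (1 - \<theta>) * measure \<rho> (rest N \<inter> ?S)"
      using ha iA by (simp add: h'(3)[OF A])
    finally have kA: "(\<integral>x. k x * indicator A x \<partial>\<nu>) = \<theta> * measure \<nu> A + (1 - \<theta>) * measure \<rho> (rest N \<inter> ?S)" .
    have "integrable \<mu> g'" by (rule borel_probs_integrable[OF \<mu> g'(1) g'_abs])
    then have "(\<integral>x. a x \<partial>\<mu>) = s" by (simp add: a_def s_def g'1 M.prob_space)
    then have 2: "(\<integral>z. indicator A (snd z) * (a (fst z) * k (snd z)) \<partial>R) = (\<theta> * measure \<nu> A + (1 - \<theta>) * measure \<rho> (rest N \<inter> ?S)) * s"
      using integral_product[OF am a_abs ind(1)[OF km k_abs] ind(2)[OF km k_abs]] by (simp add: kA mult_ac)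
    have S: "?S \<in> sets borel" by (rule vimage_sets(2)[OF A])
    have "measure \<rho> ?S = measure \<nu> A"
      using measure_distr[of snd \<rho> borel A] borel_probs_measurable[OF \<rho>b msnd] A dsnd by (simp add: sp\<rho> vimage_def)
    with split[OF S, of N] have sum: "(\<Sum>j<N. measure \<rho> (E j \<inter> ?S)) + measure \<rho> (rest N \<inter> ?S) = measure \<nu> A" by simp
    have "(\<integral>z. q z * indicator A (snd z) \<partial>R) = (\<integral>z. indicator A (snd z) * q z \<partial>R)" by (simp add: mult.commute)
    also have "\<dots> = (1 - \<theta>) * (\<Sum>j<N. measure \<rho> (E j \<inter> ?S)) + (\<theta> * measure \<nu> A + (1 - \<theta>) * measure \<rho> (rest N \<inter> ?S))"
      unfolding q_integral[OF IA] 1 2 mult.commute[of "w _"] cancel using s by simp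
    also have "\<dots> = (1 - \<theta>) * ((\<Sum>j<N. measure \<rho> (E j \<inter> ?S)) + measure \<rho> (rest N \<inter> ?S)) + \<theta> * measure \<nu> A"
      by (simp only: distrib_left)
    also have "\<dots> = measure \<nu> A" unfolding sum by (simp add: left_diff_distrib)
    finally show ?thesis .
  qed
  have "integrable R q" using q_int[of "\<lambda>_. 1"] by simp
  then have cd: "coupling_density q" using q0 fst_marginal snd_marginal by (simp add: coupling_density_def)
  have "q z \<le> (\<Sum>j<N. 1 / w j) + 1 / s" for z
  proof -
    have "(\<Sum>j<N. g j (fst z) * h j (snd z) / w j) \<le> (\<Sum>j<N. 1 / w j)"
      using g h w0 by (intro sum_mono divide_right_mono mult_le_one) auto
    moreover have "0 \<le> (\<Sum>j<N. g j (fst z) * h j (snd z) / w j)"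
      using g h w0 by (intro sum_nonneg divide_nonneg_nonneg mult_nonneg_nonneg) auto
    then have "(1 - \<theta>) * (\<Sum>j<N. g j (fst z) * h j (snd z) / w j) \<le> 1 * (\<Sum>j<N. g j (fst z) * h j (snd z) / w j)"
      using \<theta> by (intro mult_right_mono) auto
    moreover have "a (fst z) * k (snd z) / s \<le> 1 / s"
      using a01 k01 s by (intro divide_right_mono mult_le_one) auto
    ultimately show ?thesis unfolding q_def by linarith
  qed
  from that[OF cd this cost] show thesis .
qed

end

section \<open>Limits of the entropic minimisers\<close>

context entropic_problem begin

text \<open>The entropy of the minimiser is nonnegative, and that of a competitor bounded by \<open>B\<close> is at most
  \<open>(B + 1)\<^sup>2\<close>.\<close>

lemma cost_of_minimiser_le:
  assumes q: "coupling_density q" "\<And>z. q z \<le> B" and \<epsilon>: "\<epsilon> > 0"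
  shows "(\<integral>\<^sup>+z. ennreal (D z) \<partial>entropic_minimiser \<mu> \<nu> C \<epsilon>) \<le> ennreal ((\<integral>z. D z * q z \<partial>R) + \<epsilon> * (B + 1)\<^sup>2)"
proof -
  note cq = coupling_densityD[OF q(1)]
  note [measurable] = coupling_density_measurable[OF q(1)]
  obtain p where p: "minimal_density \<epsilon> p" "entropic_minimiser \<mu> \<nu> C \<epsilon> = density R p"
    using entropic_minimiser_density[OF \<epsilon>] .
  have cdp: "coupling_density p" using p by (simp add: minimal_density_def)
  note cp = coupling_densityD[OF cdp]
  note [measurable] = coupling_density_measurable[OF cdp]
  have B: "0 \<le> B" using cq(2) q(2) order_trans by blast
  have Dq: "integrable R (\<lambda>z. D z * q z)"
  proof (rule Bochner_Integration.integrable_bound[of _ "\<lambda>z. B * D z"])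
    have "norm (D z * q z) \<le> norm (B * D z)" for z
      using mult_left_mono[OF q(2)[of z] D_nonneg[of z]] D_nonneg[of z] cq(2)[of z] B by (simp add: mult.commute)
    then show "AE z in R. norm (D z * q z) \<le> norm (B * D z)" by simp
  qed (use integrable_D in simp, measurable)
  have ent: "ent (q z) \<le> (B + 1)\<^sup>2" for z
  proof -
    have "ent (q z) \<le> (q z - 1)\<^sup>2" by (rule ent_le_square[OF cq(2)])
    also have "\<dots> \<le> (B + 1)\<^sup>2" using cq(2)[of z] q(2)[of z] by (intro power2_le_iff_abs_le[THEN iffD2]) auto
    finally show ?thesis .
  qed
  have "(\<integral>\<^sup>+z. ennreal (D z) \<partial>density R p) = (\<integral>\<^sup>+z. ennreal (D z * p z) \<partial>R)"
    using cp(2) D_nonneg by (subst nn_integral_density) (auto simp: ennreal_mult' mult.commute)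
  also have "\<dots> \<le> energy \<epsilon> p"
    unfolding energy_def using \<epsilon> ent_nonneg[OF cp(2)] by (intro nn_integral_mono ennreal_leI) simp
  also have "\<dots> \<le> energy \<epsilon> q" using p(1) q(1) by (simp add: minimal_density_def)
  also have "\<dots> \<le> (\<integral>\<^sup>+z. ennreal (D z * q z + \<epsilon> * (B + 1)\<^sup>2) \<partial>R)"
    unfolding energy_def using \<epsilon> ent by (intro nn_integral_mono ennreal_leI add_left_mono mult_left_mono) auto
  also have "\<dots> = ennreal (\<integral>z. D z * q z + \<epsilon> * (B + 1)\<^sup>2 \<partial>R)"
    using Dq D_nonneg cq(2) \<epsilon> by (intro nn_integral_eq_integral) auto
  also have "(\<integral>z. D z * q z + \<epsilon> * (B + 1)\<^sup>2 \<partial>R) = (\<integral>z. D z * q z \<partial>R) + \<epsilon> * (B + 1)\<^sup>2"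
    using Dq R.prob_space by simp
  finally show ?thesis unfolding p(2) .
qed

text \<open>The cost is the supremum of the bounded continuous functions \<open>min D n\<close>.\<close>

lemma cost_weakly_lsc:
  assumes P: "\<And>k :: nat. P k \<in> borel_probs" and lim: "limitin weak_topology P \<pi> sequentially"
    and le: "\<forall>\<^sub>F k in sequentially. (\<integral>\<^sup>+z. ennreal (D z) \<partial>P k) \<le> ennreal l"
  shows "(\<integral>\<^sup>+z. ennreal (D z) \<partial>\<pi>) \<le> ennreal l"
proof -
  have \<pi>: "\<pi> \<in> borel_probs" using lim by (simp add: limitin_weak_topology)
  define f where "f n z = min (D z) (real n)" for n z
  have fc: "continuous_on UNIV (f n)" for n unfolding f_def by (intro continuous_intros continuous_D)
  have f0: "0 \<le> f n z" and fD: "f n z \<le> D z" for n z using D_nonneg[of z] by (auto simp: f_def)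
  have fb: "f n \<in> bcontfun" for n
  proof -
    have "bounded (range (f n))" unfolding bounded_iff using f0[of n] by (intro exI[of _ "real n"]) (auto simp: f_def)
    with fc show ?thesis by (simp add: bcontfun_def)
  qed
  have nn: "(\<integral>\<^sup>+z. ennreal (f n z) \<partial>M) = ennreal (\<integral>z. f n z \<partial>M)" if "M \<in> borel_probs" for n M
    using borel_probs_integrable_bcontfun[OF that fb] f0 by (intro nn_integral_eq_integral) auto
  have bound: "(\<integral>\<^sup>+z. ennreal (f n z) \<partial>\<pi>) \<le> ennreal l" for n
  proof -
    have "(\<lambda>k. \<integral>z. f n z \<partial>P k) \<longlonglongrightarrow> (\<integral>z. f n z \<partial>\<pi>)" using lim fb by (simp add: limitin_weak_topology)
    then have "(\<lambda>k. ennreal (\<integral>z. f n z \<partial>P k)) \<longlonglongrightarrow> ennreal (\<integral>z. f n z \<partial>\<pi>)" by (rule tendsto_ennrealI)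
    moreover have "\<forall>\<^sub>F k in sequentially. ennreal (\<integral>z. f n z \<partial>P k) \<le> ennreal l"
      using le
    proof eventually_elim
      case (elim k)
      have "ennreal (\<integral>z. f n z \<partial>P k) \<le> (\<integral>\<^sup>+z. ennreal (D z) \<partial>P k)"
        unfolding nn[OF P, symmetric] using fD by (intro nn_integral_mono ennreal_leI)
      with elim show ?case by (rule order_trans[rotated])
    qed
    ultimately show ?thesis unfolding nn[OF \<pi>] by (rule tendsto_upperbound) simp
  qed
  have "(SUP n. ennreal (f n z)) = ennreal (D z)" for z
  proof (rule antisym[OF SUP_least])
    obtain n where "D z \<le> real n" using real_arch_simple by blast
    then have "ennreal (D z) = ennreal (f n z)" by (simp add: f_def)
    then show "ennreal (D z) \<le> (SUP n. ennreal (f n z))" by (intro SUP_upper2[of n]) auto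
  qed (use fD in \<open>simp add: ennreal_leI\<close>)
  then have "(\<integral>\<^sup>+z. ennreal (D z) \<partial>\<pi>) = (\<integral>\<^sup>+z. (SUP n. ennreal (f n z)) \<partial>\<pi>)" by simp
  also have "\<dots> = (SUP n. \<integral>\<^sup>+z. ennreal (f n z) \<partial>\<pi>)"
  proof (rule nn_integral_monotone_convergence_SUP)
    show "incseq (\<lambda>n z. ennreal (f n z))"
      by (intro monoI le_funI ennreal_leI) (auto simp: f_def intro: min.coboundedI2)
    show "(\<lambda>z. ennreal (f n z)) \<in> borel_measurable \<pi>" for n
      using borel_probs_measurable[OF \<pi> borel_measurable_continuous_onI[OF fc]] by simp
  qed
  also have "\<dots> \<le> ennreal l" by (rule SUP_least) (rule bound)
  finally show ?thesis .
qed

text \<open>A coupling \<open>\<rho>\<close> cheaper than a cluster point has finite cost. A bounded coupling density whose cost is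
  close to that of \<open>\<rho>\<close> eventually bounds the costs of the minimisers, as the entropy term tends to \<open>0\<close>, and
  the bound passes to the cluster point by lower semicontinuity.\<close>

lemma weak_cluster_set_subset_opt_plans:
  "weak_cluster_set \<mu> \<nu> (entropic_minimiser \<mu> \<nu> C) \<subseteq> opt_plans \<mu> \<nu> C"
proof
  fix \<pi> assume "\<pi> \<in> weak_cluster_set \<mu> \<nu> (entropic_minimiser \<mu> \<nu> C)"
  then obtain \<epsilon> where \<pi>: "\<pi> \<in> couplings \<mu> \<nu>" and \<epsilon>: "\<And>k. \<epsilon> k > 0" "\<epsilon> \<longlonglongrightarrow> 0"
    and lim: "limitin weak_topology (\<lambda>k. entropic_minimiser \<mu> \<nu> C (\<epsilon> k)) \<pi> sequentially"
    by (auto simp: weak_cluster_set_def)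
  have "\<not> eintegral \<rho> C < eintegral \<pi> C" if \<rho>: "\<rho> \<in> couplings \<mu> \<nu>" for \<rho>
  proof
    assume "eintegral \<rho> C < eintegral \<pi> C"
    then have less: "(\<integral>\<^sup>+z. ennreal (D z) \<partial>\<rho>) < (\<integral>\<^sup>+z. ennreal (D z) \<partial>\<pi>)"
      unfolding eintegral_cost[OF \<rho>] eintegral_cost[OF \<pi>] enn2ereal_minus_less_iff .
    then have fin: "(\<integral>\<^sup>+z. ennreal (D z) \<partial>\<rho>) < \<infinity>" by (rule less_le_trans) simp
    have \<rho>b: "\<rho> \<in> borel_probs" using \<rho> by (simp add: couplings_iff)
    have "integrable \<rho> D"
      by (rule integrableI_nonneg) (use fin D_nonneg borel_probs_measurable[OF \<rho>b measurable_D] in auto)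
    then have L: "(\<integral>\<^sup>+z. ennreal (D z) \<partial>\<rho>) = ennreal (\<integral>z. D z \<partial>\<rho>)"
      using D_nonneg by (intro nn_integral_eq_integral) auto
    have "(\<integral>\<^sup>+z. ennreal (D z) \<partial>\<pi>) \<le> ennreal (\<integral>z. D z \<partial>\<rho>)"
    proof (rule ennreal_le_epsilon)
      fix e :: real assume e: "0 < e"
      obtain q B where q: "coupling_density q" "\<And>z. q z \<le> B" "(\<integral>z. D z * q z \<partial>R) \<le> (\<integral>z. D z \<partial>\<rho>) + e / 2"
        using bounded_coupling_density_near[OF \<rho> fin, of "e / 2"] e by auto
      have "(\<lambda>k. \<epsilon> k * (B + 1)\<^sup>2) \<longlonglongrightarrow> 0 * (B + 1)\<^sup>2" by (intro tendsto_intros \<epsilon>)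
      then have "\<forall>\<^sub>F k in sequentially. \<epsilon> k * (B + 1)\<^sup>2 < e / 2" using e by (intro order_tendstoD) auto
      then have "\<forall>\<^sub>F k in sequentially. (\<integral>\<^sup>+z. ennreal (D z) \<partial>entropic_minimiser \<mu> \<nu> C (\<epsilon> k)) \<le> ennreal ((\<integral>z. D z \<partial>\<rho>) + e)"
      proof eventually_elim
        case (elim k)
        have "(\<integral>\<^sup>+z. ennreal (D z) \<partial>entropic_minimiser \<mu> \<nu> C (\<epsilon> k)) \<le> ennreal ((\<integral>z. D z * q z \<partial>R) + \<epsilon> k * (B + 1)\<^sup>2)"
          by (rule cost_of_minimiser_le[OF q(1,2) \<epsilon>(1)])
        also have "\<dots> \<le> ennreal ((\<integral>z. D z \<partial>\<rho>) + e)" using q(3) elim by (intro ennreal_leI) linarith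
        finally show ?case .
      qed
      moreover have "entropic_minimiser \<mu> \<nu> C (\<epsilon> k) \<in> borel_probs" for k
        using entropic_minimiser_coupling[OF \<epsilon>(1)] by (simp add: couplings_iff)
      ultimately have "(\<integral>\<^sup>+z. ennreal (D z) \<partial>\<pi>) \<le> ennreal ((\<integral>z. D z \<partial>\<rho>) + e)"
        using cost_weakly_lsc[OF _ lim] by blast
      also have "\<dots> = ennreal (\<integral>z. D z \<partial>\<rho>) + ennreal e"
        using e D_nonneg by (intro ennreal_plus Bochner_Integration.integral_nonneg) auto
      finally show "(\<integral>\<^sup>+z. ennreal (D z) \<partial>\<pi>) \<le> ennreal (\<integral>z. D z \<partial>\<rho>) + ennreal e" .
    qed
    with less L show False by simp
  qed
  with \<pi> show "\<pi> \<in> opt_plans \<mu> \<nu> C" by (auto simp: opt_plans_def is_arg_min_def)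
qed

end

theorem theorem1p1:
  fixes \<mu> :: "'a::polish_space measure"
    and \<nu> :: "'b::polish_space measure"
    and C :: "'a \<times> 'b \<Rightarrow> real"
  assumes "\<mu> \<in> borel_probs"
    and "\<nu> \<in> borel_probs"
    and "continuous_on UNIV C"
    and "bdd_below (range C)"
    and "integrable (\<mu> \<Otimes>\<^sub>M \<nu>) C"
  shows "let K = weak_cluster_set \<mu> \<nu> (entropic_minimiser \<mu> \<nu> C)
    in K \<noteq> {} \<and> compactin weak_topology K \<and> connectedin weak_topology K \<and> K \<subseteq> opt_plans \<mu> \<nu> C"
proof -
  from assms(4) obtain m where m: "\<And>z. m \<le> C z" by (auto simp: bdd_below_def)
  have "0 \<le> C z + \<bar>m\<bar>" for z using m[of z] by linarith
  with assms interpret entropic_problem \<mu> \<nu> C "\<bar>m\<bar>" by unfold_locales auto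
  show ?thesis
    unfolding Let_def
    using weak_cluster_set_of_curve[OF \<mu> \<nu> entropic_minimiser_coupling continuous_on_entropic_minimiser]
      weak_cluster_set_subset_opt_plans by blast
qed

end
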